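(* Let $f:\mathbb{P}^n\to\mathbb{R}$ be the nonnegative objective to be minimized over the manifold $\mathbb{P}^n$ of $n\times n$ real symmetric positive definite matrices with the affine-invariant metric. Assume that $f$ is geodesically $L$-smooth and satisfies the spectral gap assumption (both defined in the context). Then the R1RSD algorithm (defined in the context) yields an $\epsilon$-stationary point, i.e. its iterates $\mathbf{X}_0,\ldots,\mathbf{X}_{T-1}$ satisfy $$\mathbb{E}\Big[\min_{0\le t\le T-1}\big\|\mathrm{grad}^R f(\mathbf{X}_t)\big\|_{\mathbf{X}_t}\Big]\le\epsilon ,$$ in $T=\mathcal{O}\!\left(\frac{nL}{\epsilon^2}\right)$ iterations, and each iteration incurs $\mathcal{O}(n^2\log(n))$ flops. (The iteration bound also depends on the initialization through $D_0:=f(\mathbf{X}_0)$, a dependence suppressed in the $\mathcal{O}$-notation.)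
   Context: **Geometry.** The tangent space $T_{\mathbf{X}}\mathbb{P}^n$ is identified with the symmetric $n\times n$ matrices, with metric $\langle \xi,\eta\rangle_{\mathbf{X}}=\mathrm{tr}(\mathbf{X}^{-1}\xi\mathbf{X}^{-1}\eta)$ and norm $\|\xi\|_{\mathbf{X}}=\sqrt{\langle\xi,\xi\rangle_{\mathbf{X}}}$. $\mathcal{L}(\mathbf{X})$ is the lower triangular Cholesky factor of $\mathbf{X}$, so $\mathbf{X}=\mathcal{L}(\mathbf{X})\mathcal{L}(\mathbf{X})^{\mathsf T}$. With $\mathbf{B}=\mathcal{L}(\mathbf{X})$, the geodesic from $\mathbf{X}$ with initial velocity $\xi$ is $\gamma(\lambda)=\mathbf{B}\exp(\lambda\,\mathbf{B}^{-1}\xi\mathbf{B}^{-\mathsf T})\mathbf{B}^{\mathsf T}$. For $\mathbf{X},\mathbf{Y}\in\mathbb{P}^n$, $\xi_{\mathbf{X}\mathbf{Y}}:=\gamma'(0)$ where $\gamma$ is the geodesic with $\gamma(0)=\mathbf{X}$, $\gamma(1)=\mathbf{Y}$. $\mathrm{grad} f(\mathbf{X})$ is the Euclidean gradient and $\mathrm{grad}^R f(\mathbf{X})=\mathbf{X}\,\mathrm{grad} f(\mathbf{X})\,\mathbf{X}$ the Riemannian gradient. **Objective.** $f$ is the squared Frobenius norm of the residual of a nonlinear matrix equation, $f(\mathbf{X})=\|\mathcal{G}(\mathbf{X})\|_F^2\ge 0$, where $\mathcal{G}$ is built from $\mathbf{X}$ and constant matrices by standard matrix operations (scaling, transpose,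 sum, product, inverse of positive definite matrices), so that, by maintaining the outputs of inverse operations through low-rank updates, the product $\mathrm{grad} f(\mathbf{X}_t)\mathbf{v}$ can be computed in $\mathcal{O}(n^2)$ flops for any vector $\mathbf{v}\in\mathbb{R}^n$. **Geodesic $L$-smoothness.** For all $\mathbf{X},\mathbf{Y}\in\mathbb{P}^n$: $f(\mathbf{Y})\le f(\mathbf{X})+\langle \mathrm{grad}^R f(\mathbf{X}),\xi_{\mathbf{X}\mathbf{Y}}\rangle_{\mathbf{X}}+\frac{L}{2}\|\xi_{\mathbf{X}\mathbf{Y}}\|_{\mathbf{X}}^2$. **Spectral gap assumption.** Let $\mathbf{P}(\mathbf{X}):=\mathcal{L}(\mathbf{X})^{\mathsf T}\,\mathrm{grad} f(\mathbf{X})\,\mathcal{L}(\mathbf{X})$, with eigenvalues arranged so that $|\lambda^{(1)}(\mathbf{X})|>|\lambda^{(2)}(\mathbf{X})|\ge\cdots\ge|\lambda^{(n)}(\mathbf{X})|$. For some constant $\rho$, $\frac{|\lambda^{(2)}(\mathbf{X})|}{|\lambda^{(1)}(\mathbf{X})|}\le\rho<1$ for all $\mathbf{X}\in\mathbb{P}^n$. **R1RSD (rank-one Riemannian subspace descent) algorithm.** Input: $\mathbf{X}_0=\mathbf{B}_0\mathbf{B}_0^{\mathsf T}\in\mathbb{P}^n$ with $\mathbf{B}_0=\mathcal{L}(\mathbf{X}_0)$, number of iterations $T$, step sizes $\beta_t>0$; $r$ denotes the number of inner power iterations. The statement itself does not prescribe particular values of $\beta_t$ and $r$. For $t=0,\ldots,T-1$: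 draw $\mathbf{u}_t\sim\mathcal{N}(\mathbf{0},\mathbf{I}_n)$ and set $\mathbf{y}_t^{(0)}=\mathbf{u}_t/\|\mathbf{u}_t\|$; for $i=1,\ldots,r$ set $$\mathbf{y}_t^{(i)}=\frac{\mathbf{B}_t^{\mathsf T}\mathrm{grad} f(\mathbf{X}_t)\mathbf{B}_t\mathbf{y}_t^{(i-1)}}{\|\mathbf{B}_t^{\mathsf T}\mathrm{grad} f(\mathbf{X}_t)\mathbf{B}_t\mathbf{y}_t^{(i-1)}\|_2};$$ set $\mathbf{y}_t=\mathbf{y}_t^{(r)}$, $\lambda_t=\mathbf{y}_t^{\mathsf T}\mathbf{B}_t^{\mathsf T}\mathrm{grad} f(\mathbf{X}_t)\mathbf{B}_t\mathbf{y}_t$, and $$\mathbf{X}_{t+1}=\mathbf{X}_t+\big[\exp(-\lambda_t\beta_t)-1\big]\mathbf{B}_t\mathbf{y}_t\mathbf{y}_t^{\mathsf T}\mathbf{B}_t^{\mathsf T},$$ and update the Cholesky factor to $\mathbf{B}_{t+1}=\mathcal{L}(\mathbf{X}_{t+1})$ by a rank-one Cholesky update ($\mathcal{O}(n^2)$ flops). $\mathbb{E}$ is the full expectation over all the draws $\mathbf{u}_t$. *)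

theory Defs
  imports
    "HOL-Probability.Probability"
    "HOL-Library.Landau_Symbols"
    "Jordan_Normal_Form.Char_Poly"
    "Jordan_Normal_Form.Gauss_Jordan_Elimination"
begin

(* The dimension n has to vary inside statements of the form O(n^2 log n), so matrices are those
   of Jordan_Normal_Form.Matrix (explicit nat dimensions); the competing HOL-Analysis syntax
   is switched off. *)
unbundle no vec_syntax

section \<open>Symmetric positive definite matrices\<close>

definition symmetric_mats :: "nat \<Rightarrow> real mat set" where
  "symmetric_mats n = {A \<in> carrier_mat n n. A\<^sup>T = A}"

definition spd :: "nat \<Rightarrow> real mat set" where
  "spd n = {A \<in> symmetric_mats n. \<forall>v \<in> carrier_vec n. v \<noteq> 0\<^sub>v n \<longrightarrow> v \<bullet> (A *\<^sub>v v) > 0}"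

definition mat_tr :: "real mat \<Rightarrow> real" where
  "mat_tr A = (\<Sum>i<dim_row A. A $$ (i, i))"

definition frobenius_norm :: "real mat \<Rightarrow> real" where
  "frobenius_norm A = sqrt (\<Sum>i<dim_row A. \<Sum>j<dim_col A. (A $$ (i, j))\<^sup>2)"

definition vec_norm2 :: "real vec \<Rightarrow> real" where
  "vec_norm2 v = sqrt (v \<bullet> v)"

definition outer_prod :: "real vec \<Rightarrow> real vec \<Rightarrow> real mat" where
  "outer_prod v w = mat (dim_vec v) (dim_vec w) (\<lambda>(i, j). v $ i * w $ j)"

definition minv :: "real mat \<Rightarrow> real mat" where
  "minv A = the (mat_inverse A)"

definition mat_exp :: "real mat \<Rightarrow> real mat" where
  "mat_exp A = mat (dim_row A) (dim_row A) (\<lambda>(i, j). \<Sum>k. (A ^\<^sub>m k) $$ (i, j) / fact k)"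

definition lower_triangular :: "real mat \<Rightarrow> bool" where
  "lower_triangular A \<longleftrightarrow> upper_triangular (A\<^sup>T)"

definition cholesky :: "nat \<Rightarrow> real mat \<Rightarrow> real mat" where
  "cholesky n X = (THE B. B \<in> carrier_mat n n \<and> lower_triangular B \<and>
     (\<forall>i<n. B $$ (i, i) > 0) \<and> B * B\<^sup>T = X)"

section \<open>Affine-invariant geometry\<close>

definition rinner :: "real mat \<Rightarrow> real mat \<Rightarrow> real mat \<Rightarrow> real" where
  "rinner X \<xi> \<eta> = mat_tr (minv X * \<xi> * minv X * \<eta>)"

definition rnorm :: "real mat \<Rightarrow> real mat \<Rightarrow> real" where
  "rnorm X \<xi> = sqrt (rinner X \<xi> \<xi>)"

definition geodesic :: "nat \<Rightarrow> real mat \<Rightarrow> real mat \<Rightarrow> real \<Rightarrow> real mat" where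
  "geodesic n X \<xi> s = (let B = cholesky n X in
     B * mat_exp (s \<cdot>\<^sub>m (minv B * \<xi> * (minv B)\<^sup>T)) * B\<^sup>T)"

(* The geodesic with initial velocity xi starts at X by construction, so xi is the velocity
   at 0 of the geodesic from X to Y as soon as that geodesic takes the value Y at time 1. *)
definition geodesic_velocity :: "nat \<Rightarrow> real mat \<Rightarrow> real mat \<Rightarrow> real mat \<Rightarrow> bool" where
  "geodesic_velocity n X Y \<xi> \<longleftrightarrow> \<xi> \<in> symmetric_mats n \<and> geodesic n X \<xi> 1 = Y"

(* Frechet derivative of f : spd n -> R with respect to the trace inner product on the space of
   symmetric matrices, in which spd n is open; G is therefore itself symmetric. *)
definition has_euclidean_gradient ::
    "nat \<Rightarrow> (real mat \<Rightarrow> real) \<Rightarrow> real mat \<Rightarrow> real mat \<Rightarrow> bool" where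
  "has_euclidean_gradient n f G X \<longleftrightarrow> G \<in> symmetric_mats n \<and>
     (\<forall>e>0. \<exists>d>0. \<forall>Y \<in> spd n. frobenius_norm (Y - X) < d \<longrightarrow>
        \<bar>f Y - f X - mat_tr (G * (Y - X))\<bar> \<le> e * frobenius_norm (Y - X))"

(* In the following, grad is the Euclidean gradient field. *)
definition rgrad :: "(real mat \<Rightarrow> real mat) \<Rightarrow> real mat \<Rightarrow> real mat" where
  "rgrad grad X = X * grad X * X"

definition geodesically_smooth ::
    "nat \<Rightarrow> real \<Rightarrow> (real mat \<Rightarrow> real) \<Rightarrow> (real mat \<Rightarrow> real mat) \<Rightarrow> bool" where
  "geodesically_smooth n L f grad \<longleftrightarrow>
     (\<forall>X \<in> spd n. \<forall>Y \<in> spd n. \<forall>\<xi>. geodesic_velocity n X Y \<xi> \<longrightarrow>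
        f Y \<le> f X + rinner X (rgrad grad X) \<xi> + L / 2 * (rnorm X \<xi>)\<^sup>2)"

definition pmat :: "nat \<Rightarrow> (real mat \<Rightarrow> real mat) \<Rightarrow> real mat \<Rightarrow> real mat" where
  "pmat n grad X = (cholesky n X)\<^sup>T * grad X * cholesky n X"

(* es lists the eigenvalues with multiplicity. *)
definition spectral_gap :: "nat \<Rightarrow> real \<Rightarrow> (real mat \<Rightarrow> real mat) \<Rightarrow> bool" where
  "spectral_gap n \<rho> grad \<longleftrightarrow>
     (\<forall>X \<in> spd n. \<exists>es. length es = n \<and>
        char_poly (pmat n grad X) = (\<Prod>e\<leftarrow>es. [:- e, 1:]) \<and>
        sorted_wrt (\<lambda>a b. \<bar>a\<bar> \<ge> \<bar>b\<bar>) es \<and>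
        \<bar>es ! 0\<bar> > \<bar>es ! 1\<bar> \<and> \<bar>es ! 1\<bar> / \<bar>es ! 0\<bar> \<le> \<rho>)"

section \<open>Residuals of nonlinear matrix equations\<close>

datatype mexpr =
    MVar
  | MConst "real mat"
  | MScale real mexpr
  | MTranspose mexpr
  | MSum mexpr mexpr
  | MProd mexpr mexpr
  | MInv mexpr

fun meval :: "real mat \<Rightarrow> mexpr \<Rightarrow> real mat" where
  "meval X MVar = X"
| "meval X (MConst A) = A"
| "meval X (MScale c a) = c \<cdot>\<^sub>m meval X a"
| "meval X (MTranspose a) = (meval X a)\<^sup>T"
| "meval X (MSum a b) = meval X a + meval X b"
| "meval X (MProd a b) = meval X a * meval X b"
| "meval X (MInv a) = minv (meval X a)"

(* Numbers of rows and columns of the value at an n x n argument. *)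
fun mdims :: "nat \<Rightarrow> mexpr \<Rightarrow> nat \<times> nat" where
  "mdims n MVar = (n, n)"
| "mdims n (MConst A) = (dim_row A, dim_col A)"
| "mdims n (MScale c a) = mdims n a"
| "mdims n (MTranspose a) = prod.swap (mdims n a)"
| "mdims n (MSum a b) = mdims n a"
| "mdims n (MProd a b) = (fst (mdims n a), snd (mdims n b))"
| "mdims n (MInv a) = mdims n a"

(* Dimensions agree, and only positive definite matrices are inverted. *)
fun mwf :: "nat \<Rightarrow> mexpr \<Rightarrow> bool" where
  "mwf n MVar = True"
| "mwf n (MConst A) = True"
| "mwf n (MScale c a) = mwf n a"
| "mwf n (MTranspose a) = mwf n a"
| "mwf n (MSum a b) = (mwf n a \<and> mwf n b \<and> mdims n a = mdims n b)"
| "mwf n (MProd a b) = (mwf n a \<and> mwf n b \<and> snd (mdims n a) = fst (mdims n b))"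
| "mwf n (MInv a) = (mwf n a \<and> (\<forall>X \<in> spd n. meval X a \<in> spd (fst (mdims n a))))"

fun inverse_ops :: "mexpr \<Rightarrow> mexpr set" where
  "inverse_ops MVar = {}"
| "inverse_ops (MConst A) = {}"
| "inverse_ops (MScale c a) = inverse_ops a"
| "inverse_ops (MTranspose a) = inverse_ops a"
| "inverse_ops (MSum a b) = inverse_ops a \<union> inverse_ops b"
| "inverse_ops (MProd a b) = inverse_ops a \<union> inverse_ops b"
| "inverse_ops (MInv a) = insert (MInv a) (inverse_ops a)"

definition residual_objective :: "nat \<Rightarrow> mexpr \<Rightarrow> (real mat \<Rightarrow> real) \<Rightarrow> bool" where
  "residual_objective n R f \<longleftrightarrow> mwf n R \<and> (\<forall>X \<in> spd n. f X = (frobenius_norm (meval X R))\<^sup>2)"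

section \<open>Flop counts\<close>

(* Straight-line programs over the reals. A quantity is a function of the program's input s.
   After k flops, starting from the quantities A and real constants, the quantities V are
   available; results of flops may be reused for free. *)
inductive straight_line ::
    "('s \<Rightarrow> real) set \<Rightarrow> nat \<Rightarrow> ('s \<Rightarrow> real) set \<Rightarrow> bool" for A where
  start: "straight_line A 0 (A \<union> range (\<lambda>c _. c))"
| unary: "straight_line A k V \<Longrightarrow> g \<in> V \<Longrightarrow> opr \<in> {sqrt, exp} \<Longrightarrow>
    straight_line A (Suc k) (insert (\<lambda>s. opr (g s)) V)"
| binary: "straight_line A k V \<Longrightarrow> g \<in> V \<Longrightarrow> h \<in> V \<Longrightarrow> opr \<in> {(+), (-), (*), (/)} \<Longrightarrow>
    straight_line A (Suc k) (insert (\<lambda>s. opr (g s) (h s)) V)"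

(* On all inputs in D, the quantities Q can be computed from the quantities A in at most k flops
   by a single program. *)
definition flops_within ::
    "'s set \<Rightarrow> ('s \<Rightarrow> real) set \<Rightarrow> nat \<Rightarrow> ('s \<Rightarrow> real) set \<Rightarrow> bool" where
  "flops_within D A k Q \<longleftrightarrow> (\<exists>m V. m \<le> k \<and> straight_line A m V \<and>
     (\<forall>q \<in> Q. \<exists>v \<in> V. \<forall>s \<in> D. q s = v s))"

definition vec_entries :: "nat \<Rightarrow> ('s \<Rightarrow> real vec) \<Rightarrow> ('s \<Rightarrow> real) set" where
  "vec_entries n F = {\<lambda>s. F s $ i | i. i < n}"

definition mat_entries :: "nat \<times> nat \<Rightarrow> ('s \<Rightarrow> real mat) \<Rightarrow> ('s \<Rightarrow> real) set" where
  "mat_entries d F = {\<lambda>s. F s $$ (i, j) | i j. i < fst d \<and> j < snd d}"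

definition inverse_entries ::
    "nat \<Rightarrow> mexpr \<Rightarrow> ('s \<Rightarrow> real mat) \<Rightarrow> ('s \<Rightarrow> real) set" where
  "inverse_entries n R F = (\<Union>e \<in> inverse_ops R. mat_entries (mdims n e) (\<lambda>s. meval (F s) e))"

(* With the outputs of the inverse operations at hand, a gradient-vector product takes at most
   q flops, and these outputs can be brought up to date after a rank-one change of X in at most
   q flops. *)
definition gradient_product_flops ::
    "nat \<Rightarrow> mexpr \<Rightarrow> (real mat \<Rightarrow> real mat) \<Rightarrow> nat \<Rightarrow> bool" where
  "gradient_product_flops n R grad q \<longleftrightarrow>
     flops_within (spd n \<times> carrier_vec n)
       (mat_entries (n, n) fst \<union> inverse_entries n R fst \<union> vec_entries n snd)
       q
       (vec_entries n (\<lambda>(X, v). grad X *\<^sub>v v)) \<and>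
     flops_within
       {(X, \<alpha>, w). X \<in> spd n \<and> w \<in> carrier_vec n \<and> X + \<alpha> \<cdot>\<^sub>m outer_prod w w \<in> spd n}
       (mat_entries (n, n) fst \<union> inverse_entries n R fst \<union>
        {\<lambda>(X, \<alpha>, w). \<alpha>} \<union> vec_entries n (\<lambda>(X, \<alpha>, w). w))
       q
       (inverse_entries n R (\<lambda>(X, \<alpha>, w). X + \<alpha> \<cdot>\<^sub>m outer_prod w w))"

section \<open>Rank-one Riemannian subspace descent\<close>

definition normalize_vec :: "real vec \<Rightarrow> real vec" where
  "normalize_vec v = (1 / vec_norm2 v) \<cdot>\<^sub>v v"

fun power_iterate ::
    "nat \<Rightarrow> (real mat \<Rightarrow> real mat) \<Rightarrow> real mat \<Rightarrow> real vec \<Rightarrow> nat \<Rightarrow> real vec" where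
  "power_iterate n grad X u 0 = normalize_vec u"
| "power_iterate n grad X u (Suc i) =
     normalize_vec (pmat n grad X *\<^sub>v power_iterate n grad X u i)"

definition rayleigh ::
    "nat \<Rightarrow> (real mat \<Rightarrow> real mat) \<Rightarrow> nat \<Rightarrow> real mat \<Rightarrow> real vec \<Rightarrow> real" where
  "rayleigh n grad r X u = (let y = power_iterate n grad X u r in y \<bullet> (pmat n grad X *\<^sub>v y))"

definition r1rsd_step ::
    "nat \<Rightarrow> (real mat \<Rightarrow> real mat) \<Rightarrow> nat \<Rightarrow> real \<Rightarrow> real mat \<Rightarrow> real vec \<Rightarrow> real mat" where
  "r1rsd_step n grad r \<beta> X u =
     (let B = cholesky n X; y = power_iterate n grad X u r in
      X + (exp (- rayleigh n grad r X u * \<beta>) - 1) \<cdot>\<^sub>m (B * outer_prod y y * B\<^sup>T))"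

(* omega t i is the i-th coordinate of the draw in iteration t. *)
fun r1rsd :: "nat \<Rightarrow> (real mat \<Rightarrow> real mat) \<Rightarrow> nat \<Rightarrow> (nat \<Rightarrow> real) \<Rightarrow> real mat \<Rightarrow>
    (nat \<Rightarrow> nat \<Rightarrow> real) \<Rightarrow> nat \<Rightarrow> real mat" where
  "r1rsd n grad r \<beta> X0 \<omega> 0 = X0"
| "r1rsd n grad r \<beta> X0 \<omega> (Suc t) =
     r1rsd_step n grad r (\<beta> t) (r1rsd n grad r \<beta> X0 \<omega> t) (vec n (\<omega> t))"

definition gaussian_draws :: "nat \<Rightarrow> nat \<Rightarrow> (nat \<Rightarrow> nat \<Rightarrow> real) measure" where
  "gaussian_draws n T =
     (\<Pi>\<^sub>M t\<in>{..<T}. \<Pi>\<^sub>M i\<in>{..<n}. density lborel (\<lambda>x. ennreal (std_normal_density x)))"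

definition best_gradient_norm :: "nat \<Rightarrow> (real mat \<Rightarrow> real mat) \<Rightarrow> nat \<Rightarrow> (nat \<Rightarrow> real) \<Rightarrow>
    real mat \<Rightarrow> nat \<Rightarrow> (nat \<Rightarrow> nat \<Rightarrow> real) \<Rightarrow> real" where
  "best_gradient_norm n grad r \<beta> X0 T \<omega> =
     Min ((\<lambda>t. let X = r1rsd n grad r \<beta> X0 \<omega> t in rnorm X (rgrad grad X)) ` {..<T})"

(* One iteration enters with X, its Cholesky factor and the outputs of the inverse operations,
   and has to produce every intermediate quantity of the algorithm as well as the updated X,
   Cholesky factor and inverse outputs. The n scalar Gaussian draws are charged one unit each. *)
definition iteration_flops :: "nat \<Rightarrow> mexpr \<Rightarrow> (real mat \<Rightarrow> real mat) \<Rightarrow> nat \<Rightarrow> real \<Rightarrow>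
    nat \<Rightarrow> bool" where
  "iteration_flops n R grad r \<beta> K \<longleftrightarrow> (\<exists>k. n + k \<le> K \<and>
     flops_within (spd n \<times> carrier_vec n)
       (mat_entries (n, n) fst \<union> mat_entries (n, n) (\<lambda>(X, u). cholesky n X) \<union>
        inverse_entries n R fst \<union> vec_entries n snd)
       k
       ((\<Union>i\<le>r. vec_entries n (\<lambda>(X, u). power_iterate n grad X u i)) \<union>
        {\<lambda>(X, u). rayleigh n grad r X u} \<union>
        mat_entries (n, n) (\<lambda>(X, u). r1rsd_step n grad r \<beta> X u) \<union>
        mat_entries (n, n) (\<lambda>(X, u). cholesky n (r1rsd_step n grad r \<beta> X u)) \<union>
        inverse_entries n R (\<lambda>(X, u). r1rsd_step n grad r \<beta> X u)))"

end

(* Writing X = B B^T and P = B^T (grad f) B, the Riemannian gradient has norm ||P||_F, at most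
   sqrt n times the dominant eigenvalue of P in absolute value. The step is the point at time 1 on
   the geodesic with initial velocity -(lambda / L) B y y^T B^T, so smoothness gives a decrease of f
   by at least lambda^2 / (2L) for every outcome of the draws; since f >= 0, the squares of the
   Rayleigh quotients sum up to at most 2 L f(X0).

   Conversely let v be a unit eigenvector for the dominant eigenvalue. For a Gaussian u, v . u is
   standard normal, so |v . u| >= 1/4 and |u|^2 <= 4n hold together with probability at least 1/2.
   In that event, and if rho^(2r) <= 1/(128 n), which needs only r = O(log n), the Rayleigh quotient
   is at least a third of the dominant eigenvalue. Hence the expected squared gradient norm is at
   most 18 n times the expected squared Rayleigh quotient, and averaging over T iterations gives
   the constant 36.

   The Cholesky factor of I + a y y^T is explicit, with entries that are rational up to square roots
   in the leading principal minors, and its product with B needs O(n^2) flops without any branching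
   on the sign of a. *)

theory Submission
  imports Defs "HOL-Real_Asymp.Real_Asymp"
begin

unbundle no inner_syntax

section \<open>Straight-line programs\<close>

text \<open>Two obstacles separate the pointwise estimates from the expectation. The eigenvector v
  varies with X_t, so the estimate is proved for a deterministic X, with v chosen before u, and
  carried over to X_t by integrating out the draw u_t, on which X_t does not depend. And the
  integrals must make sense although \<open>cholesky\<close> is a definite description and the
  gradient is given abstractly: the quantities of the algorithm are outputs of straight-line
  programs, hence Borel functions of the draws. The flop count therefore also serves the
  probabilistic part. Constants: the events of a small |v . u| (density at most 1/2 on an interval
  of length 1/2) and of a large |u| (Markov, mean n) have probability at most 1/4 each. With (v .
  u)^2 \<ge> 1/16 and |u|^2 \<le> 4 n, the condition 2 \<rho>^(2 r) 4 n \<le> 1/16 makes the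
  dominant part of the squared norm at least twice the rest; this is the 128. The 18 is 9, from the
  square of one third, times 2, from the probability; the 36 includes the 2 of the bound 2 L f(X0).
  Squares are averaged, and the first moment follows since a variance is nonnegative.\<close>

lemma straight_line_inputs: "straight_line A k V \<Longrightarrow> A \<union> range (\<lambda>c _. c) \<subseteq> V"
  by (induction rule: straight_line.induct) auto

text \<open>Each instruction of the first program is replayed on the counterparts of its operands,
  so the costs add. Counterparts have to agree on \<open>D\<close> only, as in
  \<open>flops_within\<close>, and \<open>W\<close> stays inside \<open>W'\<close> so that results
  obtained before the call remain available.\<close>

lemma straight_line_subst:
  assumes "straight_line A k V" and W: "straight_line A' m W"
    and "\<forall>a\<in>A. \<exists>w\<in>W. \<forall>s\<in>D. a (h s) = w s"
  shows "\<exists>W'. straight_line A' (m + k) W' \<and> W \<subseteq> W' \<and> (\<forall>v\<in>V. \<exists>w\<in>W'. \<forall>s\<in>D. v (h s) = w s)"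
  using assms(1)
proof (induction rule: straight_line.induct)
  case start
  have "\<forall>v\<in>A \<union> range (\<lambda>c _. c). \<exists>w\<in>W. \<forall>s\<in>D. v (h s) = w s"
    using assms(3) straight_line_inputs[OF W] by (fastforce simp: image_iff)
  then show ?case using W by auto
next
  case (unary k V g opr)
  then obtain W' where W': "straight_line A' (m + k) W'" "W \<subseteq> W'"
    "\<forall>v\<in>V. \<exists>w\<in>W'. \<forall>s\<in>D. v (h s) = w s" by blast
  then obtain w where w: "w \<in> W'" "\<forall>s\<in>D. g (h s) = w s" using unary by blast
  have "straight_line A' (m + Suc k) (insert (\<lambda>s. opr (w s)) W')"
    using straight_line.unary[OF W'(1) w(1) unary(3)] by simp
  moreover have "\<forall>v\<in>insert (\<lambda>s. opr (g s)) V. \<exists>w\<in>insert (\<lambda>s. opr (w s)) W'. \<forall>s\<in>D. v (h s) = w s"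
    using W'(3) w(2) by auto
  ultimately show ?case using W'(2) by blast
next
  case (binary k V g g' opr)
  then obtain W' where W': "straight_line A' (m + k) W'" "W \<subseteq> W'"
    "\<forall>v\<in>V. \<exists>w\<in>W'. \<forall>s\<in>D. v (h s) = w s" by blast
  obtain w where w: "w \<in> W'" "\<forall>s\<in>D. g (h s) = w s" using W'(3) binary(2) by blast
  obtain w' where w': "w' \<in> W'" "\<forall>s\<in>D. g' (h s) = w' s" using W'(3) binary(3) by blast
  have "straight_line A' (m + Suc k) (insert (\<lambda>s. opr (w s) (w' s)) W')"
    using straight_line.binary[OF W'(1) w(1) w'(1) binary(4)] by simp
  moreover have "\<forall>v\<in>insert (\<lambda>s. opr (g s) (g' s)) V.
      \<exists>w\<in>insert (\<lambda>s. opr (w s) (w' s)) W'. \<forall>s\<in>D. v (h s) = w s"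
    using W'(3) w(2) w'(2) by auto
  ultimately show ?case using W'(2) by blast
qed

lemma flops_within_mono: "flops_within D A k Q \<Longrightarrow> k \<le> k' \<Longrightarrow> Q' \<subseteq> Q \<Longrightarrow> flops_within D A k' Q'"
  unfolding flops_within_def by (elim exE conjE, intro exI conjI) (auto intro: order_trans)

lemma flops_within_inputs: "Q \<subseteq> A \<union> range (\<lambda>c _. c) \<Longrightarrow> flops_within D A 0 Q"
  unfolding flops_within_def
  by (intro exI[of _ 0] exI[of _ "A \<union> range (\<lambda>c _. c)"] conjI straight_line.start) auto

lemma flops_within_cong:
  assumes "flops_within D A k Q" "\<And>q'. q' \<in> Q' \<Longrightarrow> \<exists>q\<in>Q. \<forall>s\<in>D. q' s = q s"
  shows "flops_within D A k Q'"
  proof -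
  obtain m V where V: "m \<le> k" "straight_line A m V" "\<forall>q\<in>Q. \<exists>v\<in>V. \<forall>s\<in>D. q s = v s"
    using assms(1) unfolding flops_within_def by auto
  have "\<exists>v\<in>V. \<forall>s\<in>D. q' s = v s" if q': "q' \<in> Q'" for q'
  proof -
    obtain q where q: "q \<in> Q" "\<forall>s\<in>D. q' s = q s" using assms(2)[OF q'] by blast
    show ?thesis using bspec[OF V(3) q(1)] q(2) by simp
  qed
  then show ?thesis using V unfolding flops_within_def by (intro exI[of _ m] exI[of _ V]) simp
qed

text \<open>Calling a program as a subroutine on a computed state \<open>h s\<close>: in this way
  the two programs granted by \<open>gradient_product_flops\<close> are run on intermediate
  quantities. Keeping \<open>W\<close> in the result makes sequential composition the instance where
  \<open>h\<close> is the identity.\<close>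

lemma flops_within_subst_Un:
  assumes Q: "flops_within D A k Q" and A: "flops_within D' A' m W"
    and h: "\<And>s. s \<in> D' \<Longrightarrow> h s \<in> D" and W: "\<And>a. a \<in> A \<Longrightarrow> (\<lambda>s. a (h s)) \<in> W"
  shows "flops_within D' A' (m + k) (W \<union> (\<lambda>q s. q (h s)) ` Q)"
proof -
  obtain m0 V where V: "m0 \<le> k" "straight_line A m0 V" "\<forall>q\<in>Q. \<exists>v\<in>V. \<forall>s\<in>D. q s = v s"
    using Q unfolding flops_within_def by auto
  obtain m1 V1 where V1: "m1 \<le> m" "straight_line A' m1 V1" "\<forall>q\<in>W. \<exists>v\<in>V1. \<forall>s\<in>D'. q s = v s"
    using A unfolding flops_within_def by auto
  have "\<forall>a\<in>A. \<exists>w\<in>V1. \<forall>s\<in>D'. a (h s) = w s"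
    using bspec[OF V1(3) W] by blast
  from straight_line_subst[OF V(2) V1(2) this] obtain W'
    where W': "straight_line A' (m1 + m0) W'" "V1 \<subseteq> W'" "\<forall>v\<in>V. \<exists>w\<in>W'. \<forall>s\<in>D'. v (h s) = w s"
    by auto
  have "\<exists>v\<in>W'. \<forall>s\<in>D'. q s = v s" if "q \<in> W \<union> (\<lambda>q s. q (h s)) ` Q" for q
  proof (cases "q \<in> W")
    case True
    then show ?thesis using V1(3) W'(2) by blast
  next
    case False
    then have "q \<in> (\<lambda>q s. q (h s)) ` Q" using that by blast
    then obtain q' where q': "q' \<in> Q" "q = (\<lambda>s. q' (h s))" by (rule imageE)
    obtain v where v: "v \<in> V" "\<forall>s\<in>D. q' s = v s" using bspec[OF V(3) q'(1)] by blast
    obtain w where w: "w \<in> W'" "\<forall>s\<in>D'. v (h s) = w s" using bspec[OF W'(3) v(1)] by blast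
    show ?thesis using w v(2) q'(2) h by (intro bexI[OF _ w(1)]) simp
  qed
  then show ?thesis using W'(1) V(1) V1(1) unfolding flops_within_def
    by (intro exI[of _ "m1 + m0"] exI[of _ W']) auto
qed

lemma flops_within_subst:
  assumes "flops_within D A k Q" "flops_within D' A' m ((\<lambda>a s. a (h s)) ` A)"
    "\<And>s. s \<in> D' \<Longrightarrow> h s \<in> D"
  shows "flops_within D' A' (m + k) ((\<lambda>q s. q (h s)) ` Q)"
  by (rule flops_within_mono[OF flops_within_subst_Un[OF assms(1,2,3)]]) auto

lemma flops_within_seq:
  assumes "flops_within D A k Q" "flops_within D (A \<union> Q) k' Q'"
  shows "flops_within D A (k + k') (Q \<union> Q')"
proof -
  have "flops_within D A k (A \<union> Q)"
    using assms(1) straight_line_inputs unfolding flops_within_def by blast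
  from flops_within_subst_Un[OF assms(2) this, of "\<lambda>s. s"] show ?thesis
    by (rule flops_within_mono) auto
qed

lemma flops_within_inputs_mono:
  assumes "flops_within D A k Q" "A \<subseteq> A'"
  shows "flops_within D A' k Q"
proof -
  have "flops_within D A' (0 + k) (A' \<union> (\<lambda>q. q) ` Q)"
    using flops_within_subst_Un[OF assms(1) flops_within_inputs[of A' A' D], of "\<lambda>s. s"] assms(2) by auto
  then show ?thesis by (rule flops_within_mono) auto
qed

lemma flops_within_Un:
  assumes "flops_within D A k Q" "flops_within D A k' Q'"
  shows "flops_within D A (k + k') (Q \<union> Q')"
  using flops_within_seq[OF assms(1) flops_within_inputs_mono[OF assms(2)]] by simp

lemma flops_within_UN:
  assumes "finite I" "\<And>i. i \<in> I \<Longrightarrow> flops_within D A k (Q i)"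
  shows "flops_within D A (card I * k) (\<Union>i\<in>I. Q i)"
  using assms
proof (induction I rule: finite_induct)
  case empty
  then show ?case using flops_within_inputs[of "{}"] by simp
next
  case (insert i I)
  show ?case
    using flops_within_Un[OF insert(4)[of i] insert(3)[OF insert(4)]] insert(1,2) by simp
qed

text \<open>A loop whose rounds read the inputs and the preceding round, with all rounds available
  afterwards. It serves both the power iteration and the suffix sums of the Cholesky update.\<close>

lemma flops_within_iterate:
  assumes "flops_within D A k (Q 0)" "\<And>i. i < m \<Longrightarrow> flops_within D (A \<union> Q i) k' (Q (Suc i))"
  shows "flops_within D A (k + m * k') (\<Union>i\<le>m. Q i)"
  using assms(2)
proof (induction m)
  case 0
  then show ?case using assms(1) by simp
next
  case (Suc m)
  have "flops_within D (A \<union> (\<Union>i\<le>m. Q i)) k' (Q (Suc m))"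
    by (rule flops_within_inputs_mono[OF Suc(2)]) auto
  then have "flops_within D A (k + m * k' + k') ((\<Union>i\<le>m. Q i) \<union> Q (Suc m))"
    by (rule flops_within_seq[OF Suc(1)[OF Suc(2)], rotated]) simp_all
  then show ?case by (rule flops_within_mono) (auto simp: le_Suc_eq)
qed

lemma flops_within_unary:
  assumes "flops_within D A k {g}" "opr \<in> {sqrt, exp}"
  shows "flops_within D A (Suc k) {\<lambda>s. opr (g s)}"
proof -
  obtain m V v where V: "m \<le> k" "straight_line A m V" "v \<in> V" "\<forall>s\<in>D. g s = v s"
    using assms(1) unfolding flops_within_def by auto
  show ?thesis using straight_line.unary[OF V(2,3) assms(2)] V(1,4) unfolding flops_within_def
    by (intro exI[of _ "Suc m"] exI[of _ "insert (\<lambda>s. opr (v s)) V"]) auto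
qed

lemma flops_within_binary:
  assumes "flops_within D A k {g}" "flops_within D A k' {h}" "opr \<in> {(+), (-), (*), (/)}"
  shows "flops_within D A (Suc (k + k')) {\<lambda>s. opr (g s) (h s)}"
proof -
  obtain m V v w where V: "m \<le> k + k'" "straight_line A m V" "v \<in> V" "\<forall>s\<in>D. g s = v s"
      "w \<in> V" "\<forall>s\<in>D. h s = w s"
    using flops_within_Un[OF assms(1,2)] unfolding flops_within_def by auto
  show ?thesis using straight_line.binary[OF V(2,3,5) assms(3)] V unfolding flops_within_def
    by (intro exI[of _ "Suc m"] exI[of _ "insert (\<lambda>s. opr (v s) (w s)) V"]) auto
qed

lemma flops_within_input: "g \<in> A \<Longrightarrow> flops_within D A 0 {g}"
  by (rule flops_within_inputs) auto

lemma flops_within_const: "flops_within D A 0 {\<lambda>_. c}"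
  by (rule flops_within_inputs) auto

lemmas flops_within_add = flops_within_binary[where opr="(+)", simplified]
  and flops_within_diff = flops_within_binary[where opr="(-)", simplified]
  and flops_within_mult = flops_within_binary[where opr="(*)", simplified]
  and flops_within_divide = flops_within_binary[where opr="(/)", simplified]
  and flops_within_sqrt = flops_within_unary[where opr=sqrt, simplified]
  and flops_within_exp = flops_within_unary[where opr=exp, simplified]

text \<open>One product and one addition per index, since the empty sum is a free constant.\<close>

lemma flops_within_dot:
  fixes m :: nat
  assumes "\<And>i. i < m \<Longrightarrow> F i \<in> A" "\<And>i. i < m \<Longrightarrow> G i \<in> A"
  shows "flops_within D A (2 * m) {\<lambda>s. \<Sum>i<m. F i s * G i s}"
  using assms
proof (induction m)
  case 0
  then show ?case by (simp add: flops_within_const)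
next
  case (Suc m)
  have "flops_within D A (Suc (2 * m + Suc (0 + 0))) {\<lambda>s. (\<Sum>i<m. F i s * G i s) + F m s * G m s}"
    by (intro flops_within_add flops_within_mult flops_within_input Suc) auto
  then show ?case by simp
qed

section \<open>Measurability of computed quantities\<close>

lemma straight_line_measurable:
  assumes "straight_line A k V" "\<And>a. a \<in> A \<Longrightarrow> (\<lambda>x. a (h x)) \<in> borel_measurable M" "v \<in> V"
  shows "(\<lambda>x. v (h x)) \<in> borel_measurable M"
  using assms(1,3)
proof (induction arbitrary: v rule: straight_line.induct)
  case start
  then show ?case using assms(2) by auto
next
  case (unary k V g opr)
  have "(\<lambda>x. g (h x)) \<in> borel_measurable M" using unary by blast
  then show ?case using unary by auto
next
  case (binary k V g g' opr)
  have "(\<lambda>x. g (h x)) \<in> borel_measurable M" "(\<lambda>x. g' (h x)) \<in> borel_measurable M"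
    using binary by blast+
  then show ?case using binary by auto
qed

text \<open>All permitted operations are Borel as total functions, division by zero included, so a
  program needs no side conditions. Since \<open>h\<close> maps into \<open>D\<close>, agreement
  there is enough. This reaches functions such as \<open>cholesky\<close>, whose definition gives no
  hold on measurability.\<close>

lemma flops_within_measurable:
  assumes "flops_within D A k Q" "\<And>x. x \<in> space M \<Longrightarrow> h x \<in> D"
    and "\<And>a. a \<in> A \<Longrightarrow> (\<lambda>x. a (h x)) \<in> borel_measurable M" "q \<in> Q"
  shows "(\<lambda>x. q (h x)) \<in> borel_measurable M"
proof -
  obtain m V v where "straight_line A m V" "v \<in> V" "\<forall>s\<in>D. q s = v s"
    using assms(1,4) unfolding flops_within_def by auto
  moreover from this have "(\<lambda>x. v (h x)) \<in> borel_measurable M"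
    using straight_line_measurable[where h=h, OF _ assms(3)] by blast
  moreover have "(\<lambda>x. q (h x)) \<in> borel_measurable M \<longleftrightarrow> (\<lambda>x. v (h x)) \<in> borel_measurable M"
    using calculation(3) assms(2) by (intro measurable_cong) blast
  ultimately show ?thesis by blast
qed

section \<open>Entrywise formulas and the scalar product\<close>

lemma index_mult_mat_sum:
  "A \<in> carrier_mat n m \<Longrightarrow> B \<in> carrier_mat m p \<Longrightarrow> i < n \<Longrightarrow> j < p \<Longrightarrow>
    (A * B) $$ (i, j) = (\<Sum>k<m. A $$ (i, k) * B $$ (k, j))"
  by (auto simp: scalar_prod_def lessThan_atLeast0 intro!: sum.cong)

lemma index_mult_vec_sum:
  "A \<in> carrier_mat n m \<Longrightarrow> v \<in> carrier_vec m \<Longrightarrow> i < n \<Longrightarrow>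
    (A *\<^sub>v v) $ i = (\<Sum>k<m. A $$ (i, k) * v $ k)"
  by (auto simp: scalar_prod_def lessThan_atLeast0 intro!: sum.cong)

lemma scalar_prod_sum: "w \<in> carrier_vec n \<Longrightarrow> v \<bullet> w = (\<Sum>i<n. v $ i * w $ i)"
  by (simp add: scalar_prod_def lessThan_atLeast0)

lemma scalar_prod_self: "v \<in> carrier_vec n \<Longrightarrow> v \<bullet> v = (\<Sum>i<n. (v $ i)\<^sup>2)"
  for v :: "real vec"
  by (simp add: scalar_prod_sum power2_eq_square)

lemma scalar_prod_self_nonneg: "v \<bullet> v \<ge> 0" for v :: "real vec"
  by (auto simp: scalar_prod_def intro: sum_nonneg)

lemma scalar_prod_self_pos:
  fixes v :: "real vec"
  assumes "v \<in> carrier_vec n" "v \<noteq> 0\<^sub>v n"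
  shows "v \<bullet> v > 0"
proof -
  obtain i where "i < n" "v $ i \<noteq> 0" using assms by (auto simp: vec_eq_iff)
  then have "(\<Sum>i<n. (v $ i)\<^sup>2) > 0" by (intro sum_pos2[of _ i]) auto
  then show ?thesis using scalar_prod_self[OF assms(1)] by simp
qed

lemma scalar_prod_mult_mat_vec:
  fixes A :: "real mat"
  assumes "A \<in> carrier_mat n m" "v \<in> carrier_vec n" "w \<in> carrier_vec m"
  shows "v \<bullet> (A *\<^sub>v w) = (A\<^sup>T *\<^sub>v v) \<bullet> w"
  using transpose_vec_mult_scalar[OF assms(1,3,2)] assms
  by (simp add: comm_scalar_prod[of v n] comm_scalar_prod[of "A\<^sup>T *\<^sub>v v" m])

section \<open>Trace\<close>

lemma mat_tr_mult:
  assumes "A \<in> carrier_mat n m" "B \<in> carrier_mat m n"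
  shows "mat_tr (A * B) = (\<Sum>i<n. \<Sum>k<m. A $$ (i, k) * B $$ (k, i))"
  unfolding mat_tr_def using assms by (auto simp: index_mult_mat_sum simp del: index_mult_mat(1))

lemma mat_tr_comm:
  assumes "A \<in> carrier_mat n m" "B \<in> carrier_mat m n"
  shows "mat_tr (A * B) = mat_tr (B * A)"
  unfolding mat_tr_mult[OF assms] mat_tr_mult[OF assms(2,1)]
  by (subst sum.swap) (simp add: mult.commute)

text \<open>Along a rank-one direction the trace form sees only the quadratic form at y; this is how
  the Rayleigh quotient enters the smoothness inequality.\<close>

lemma mat_tr_mult_outer_prod:
  assumes "A \<in> carrier_mat n n" "y \<in> carrier_vec n"
  shows "mat_tr (A * (c \<cdot>\<^sub>m outer_prod y y)) = c * (y \<bullet> (A *\<^sub>v y))"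
proof -
  have "mat_tr (A * (c \<cdot>\<^sub>m outer_prod y y)) = (\<Sum>i<n. \<Sum>k<n. A $$ (i, k) * (c * (y $ k * y $ i)))"
    using assms by (subst mat_tr_mult[of _ n n]) (auto simp: outer_prod_def)
  also have "\<dots> = c * (\<Sum>i<n. y $ i * (\<Sum>k<n. A $$ (i, k) * y $ k))"
    by (simp add: sum_distrib_left mult_ac)
  also have "\<dots> = c * (y \<bullet> (A *\<^sub>v y))"
    using assms by (subst scalar_prod_sum[of _ n])
      (auto simp: index_mult_vec_sum simp del: index_mult_mat_vec)
  finally show ?thesis .
qed

section \<open>Inverses\<close>

text \<open>A one-sided inverse of a square matrix is two-sided, and membership in
  \<open>Units\<close> excludes the result \<open>None\<close> of the elimination behind
  \<open>mat_inverse\<close>.\<close>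

lemma minv_eqI:
  assumes "A \<in> carrier_mat n n" "C \<in> carrier_mat n n" "A * C = 1\<^sub>m n"
  shows "minv A = C"
proof -
  have CA: "C * A = 1\<^sub>m n" using mat_mult_left_right_inverse[OF assms] .
  have "A \<in> Units (ring_mat TYPE(real) n undefined)"
    unfolding Units_def using assms CA by (auto simp: ring_mat_def)
  then obtain B where B: "mat_inverse A = Some B"
    using mat_inverse(1)[OF assms(1)] by fastforce
  from mat_inverse(2)[OF assms(1) B] have B': "B * A = 1\<^sub>m n" "B \<in> carrier_mat n n" by auto
  have "B = B * (A * C)" using assms B' by simp
  also have "\<dots> = (B * A) * C" by (rule assoc_mult_mat[symmetric, OF B'(2) assms(1,2)])
  also have "\<dots> = C" using assms B' by simp
  finally show ?thesis using B by (simp add: minv_def)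
qed

lemma minv_det_nonzero:
  assumes "A \<in> carrier_mat n n" "det A \<noteq> 0"
  shows "minv A \<in> carrier_mat n n" "A * minv A = 1\<^sub>m n" "minv A * A = 1\<^sub>m n"
proof -
  obtain C where C: "C \<in> carrier_mat n n" "A * C = 1\<^sub>m n"
    using det_non_zero_imp_unit[OF assms, of undefined] unfolding Units_def
    by (auto simp: ring_mat_def)
  from minv_eqI[OF assms(1) C] C mat_mult_left_right_inverse[OF assms(1) C]
  show "minv A \<in> carrier_mat n n" "A * minv A = 1\<^sub>m n" "minv A * A = 1\<^sub>m n" by auto
qed

section \<open>Cholesky factors\<close>

text \<open>Elimination of the first row and column: the Schur complement \<open>a'\<close> of the
  pivot is again positive definite, and a factor of it extends by the first column divided by the
  root of the pivot. Entry functions replace matrices so that passing to the complement is an index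
  shift.\<close>

lemma cholesky_entries_exist:
  fixes a :: "nat \<Rightarrow> nat \<Rightarrow> real"
  assumes "\<And>i j. i < n \<Longrightarrow> j < n \<Longrightarrow> a i j = a j i"
    and "\<And>x. (\<exists>i<n. x i \<noteq> 0) \<Longrightarrow> (\<Sum>i<n. \<Sum>j<n. x i * a i j * x j) > 0"
  shows "\<exists>l. (\<forall>i<n. l i i > 0) \<and> (\<forall>i j. i < j \<longrightarrow> l i j = 0) \<and>
    (\<forall>i<n. \<forall>j<n. (\<Sum>k<n. l i k * l j k) = a i j)"
  using assms
proof (induction n arbitrary: a)
  case 0
  show ?case by (rule exI[of _ "\<lambda>_ _. 0"]) auto
next
  case (Suc n)
  define p where "p = a 0 0"
  \<comment> \<open>Testing the form on the first unit vector gives positivity of the pivot.\<close>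
  have "(\<Sum>i<Suc n. \<Sum>j<Suc n. of_bool (i = 0) * a i j * of_bool (j = 0)) > 0"
    by (rule Suc.prems(2)[of "\<lambda>i. of_bool (i = 0)"]) auto
  then have p: "p > 0" unfolding p_def sum.lessThan_Suc_shift by simp
  define a' where "a' = (\<lambda>i j. a (Suc i) (Suc j) - a (Suc i) 0 * a 0 (Suc j) / p)"
  have "\<exists>l. (\<forall>i<n. l i i > 0) \<and> (\<forall>i j. i < j \<longrightarrow> l i j = 0) \<and>
    (\<forall>i<n. \<forall>j<n. (\<Sum>k<n. l i k * l j k) = a' i j)"
  proof (rule Suc.IH)
    fix i j assume "i < n" "j < n"
    then show "a' i j = a' j i"
      unfolding a'_def using Suc.prems(1)[of "Suc i" "Suc j"] Suc.prems(1)[of 0 "Suc j"]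
        Suc.prems(1)[of "Suc i" 0] by simp
  next
    fix x :: "nat \<Rightarrow> real" assume x: "\<exists>i<n. x i \<noteq> 0"
    define b where "b = (\<Sum>j<n. a 0 (Suc j) * x j)"
    have b': "(\<Sum>i<n. x i * a (Suc i) 0) = b"
      unfolding b_def by (rule sum.cong) (use Suc.prems(1)[of _ 0] in auto)
    \<comment> \<open>The first coordinate minimises the quadratic form over all extensions of x.\<close>
    define z where "z = (\<lambda>i. case i of 0 \<Rightarrow> - b / p | Suc i \<Rightarrow> x i)"
    have "\<exists>i<Suc n. z i \<noteq> 0" using x unfolding z_def by (metis Suc_less_eq nat.case(2))
    from Suc.prems(2)[OF this]
    have "0 < (\<Sum>i<Suc n. \<Sum>j<Suc n. z i * a i j * z j)" .
    also have "\<dots> = (b / p)\<^sup>2 * p + (- b / p) * (\<Sum>j<n. a 0 (Suc j) * x j)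
        + (\<Sum>i<n. x i * a (Suc i) 0) * (- b / p) + (\<Sum>i<n. \<Sum>j<n. x i * a (Suc i) (Suc j) * x j)"
      unfolding sum.lessThan_Suc_shift
      by (simp add: z_def sum.distrib sum_distrib_left sum_distrib_right p_def power2_eq_square
          mult_ac sum_negf sum_subtractf)
    also have "\<dots> = (\<Sum>i<n. \<Sum>j<n. x i * a (Suc i) (Suc j) * x j) - b * b / p"
      unfolding b' b_def[symmetric] using p by (simp add: power2_eq_square field_simps)
    also have "b * b / p = (\<Sum>i<n. \<Sum>j<n. x i * (a (Suc i) 0 * a 0 (Suc j) / p) * x j)"
    proof -
      have "b * b = (\<Sum>i<n. x i * a (Suc i) 0) * (\<Sum>j<n. a 0 (Suc j) * x j)"
        unfolding b' b_def[symmetric] ..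
      then show ?thesis unfolding sum_product by (simp only: sum_divide_distrib) (simp add: mult_ac)
    qed
    also have "(\<Sum>i<n. \<Sum>j<n. x i * a (Suc i) (Suc j) * x j) - \<dots> = (\<Sum>i<n. \<Sum>j<n. x i * a' i j * x j)"
      unfolding a'_def by (simp add: sum_subtractf algebra_simps)
    finally show "(\<Sum>i<n. \<Sum>j<n. x i * a' i j * x j) > 0" .
  qed
  then obtain l' where "(\<forall>i<n. l' i i > 0) \<and> (\<forall>i j. i < j \<longrightarrow> l' i j = 0) \<and>
    (\<forall>i<n. \<forall>j<n. (\<Sum>k<n. l' i k * l' j k) = a' i j)" ..
  note l' = this[THEN conjunct1, rule_format] this[THEN conjunct2, THEN conjunct1, rule_format]
    this[THEN conjunct2, THEN conjunct2, rule_format]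
  define l where "l = (\<lambda>i j. case i of 0 \<Rightarrow> if j = 0 then sqrt p else 0
     | Suc i \<Rightarrow> (case j of 0 \<Rightarrow> a (Suc i) 0 / sqrt p | Suc j \<Rightarrow> l' i j))"
  have "(\<Sum>k<Suc n. l i k * l j k) = a i j" if "i < Suc n" "j < Suc n" for i j
    using that p l'(3)[of "i - 1" "j - 1"] Suc.prems(1)[of 0 j]
    unfolding sum.lessThan_Suc_shift
    by (auto simp: l_def p_def a'_def less_Suc_eq_0_disj)
  moreover have "l i i > 0" if "i < Suc n" for i
    using that p l'(1) by (auto simp: l_def split: nat.split)
  moreover have "l i j = 0" if "i < j" for i j
    using that l'(2) by (auto simp: l_def split: nat.split)
  ultimately show ?case by blast
qed

text \<open>The predicate described by \<open>cholesky\<close>. Once existence and uniqueness are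
  settled, a Cholesky factor is identified by exhibiting any matrix that satisfies it.\<close>

definition cholesky_factor :: "nat \<Rightarrow> real mat \<Rightarrow> real mat \<Rightarrow> bool" where
  "cholesky_factor n X B \<longleftrightarrow> B \<in> carrier_mat n n \<and> lower_triangular B \<and>
     (\<forall>i<n. B $$ (i, i) > 0) \<and> B * B\<^sup>T = X"

lemma lower_triangular_iff:
  "B \<in> carrier_mat n n \<Longrightarrow> lower_triangular B \<longleftrightarrow> (\<forall>i j. i < j \<longrightarrow> j < n \<longrightarrow> B $$ (i, j) = 0)"
  unfolding lower_triangular_def upper_triangular_def by auto

lemma index_mult_transpose_sum:
  assumes "B \<in> carrier_mat n n" "i < n" "j < n"
  shows "(B * B\<^sup>T) $$ (i, j) = (\<Sum>k<n. B $$ (i, k) * B $$ (j, k))"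
  using assms by (subst index_mult_mat_sum[of _ n n _ n]) auto

lemma spd_carrier: "X \<in> spd n \<Longrightarrow> X \<in> carrier_mat n n"
  by (auto simp: spd_def symmetric_mats_def)

lemma cholesky_factor_exists:
  assumes X: "X \<in> spd n"
  shows "\<exists>B. cholesky_factor n X B"
proof -
  have Xc: "X \<in> carrier_mat n n" and sym: "X\<^sup>T = X"
    using X by (auto simp: spd_def symmetric_mats_def)
  have "\<exists>l. (\<forall>i<n. l i i > 0) \<and> (\<forall>i j. i < j \<longrightarrow> l i j = 0) \<and>
    (\<forall>i<n. \<forall>j<n. (\<Sum>k<n. l i k * l j k) = X $$ (i, j))"
  proof (rule cholesky_entries_exist)
    fix i j assume "i < n" "j < n"
    then show "X $$ (i, j) = X $$ (j, i)" using Xc index_transpose_mat(1)[of i X j] sym by auto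
  next
    fix x :: "nat \<Rightarrow> real" assume "\<exists>i<n. x i \<noteq> 0"
    then have "vec n x \<noteq> 0\<^sub>v n" by (auto simp: vec_eq_iff)
    then have "vec n x \<bullet> (X *\<^sub>v vec n x) > 0" using X by (auto simp: spd_def)
    also have "vec n x \<bullet> (X *\<^sub>v vec n x) = (\<Sum>i<n. \<Sum>j<n. x i * X $$ (i, j) * x j)"
      using Xc by (subst scalar_prod_sum[of _ n])
        (auto simp: index_mult_vec_sum sum_distrib_left mult.assoc simp del: index_mult_mat_vec)
    finally show "(\<Sum>i<n. \<Sum>j<n. x i * X $$ (i, j) * x j) > 0" .
  qed
  then obtain l where "(\<forall>i<n. l i i > 0) \<and> (\<forall>i j. i < j \<longrightarrow> l i j = 0) \<and>
    (\<forall>i<n. \<forall>j<n. (\<Sum>k<n. l i k * l j k) = X $$ (i, j))" ..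
  note l = this[THEN conjunct1, rule_format] this[THEN conjunct2, THEN conjunct1, rule_format]
    this[THEN conjunct2, THEN conjunct2, rule_format]
  have "cholesky_factor n X (mat n n (\<lambda>(i, j). l i j))"
    unfolding cholesky_factor_def
  proof (intro conjI)
    show "mat n n (\<lambda>(i, j). l i j) * (mat n n (\<lambda>(i, j). l i j))\<^sup>T = X"
      using Xc l(3) by (intro eq_matI)
        (auto simp: index_mult_transpose_sum[of _ n] simp del: index_mult_mat(1))
  qed (use l in \<open>auto simp: lower_triangular_iff[of _ n]\<close>)
  then show ?thesis ..
qed

text \<open>Entry (i, j) of the product involves columns up to j only. Once the earlier columns
  agree, row j equates the squares of the diagonal entries; positivity fixes their sign and lets
  them be cancelled in the other rows.\<close>

lemma cholesky_factor_unique: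
  assumes B: "cholesky_factor n X B" and M: "cholesky_factor n X M"
  shows "B = M"
proof -
  note d = B[unfolded cholesky_factor_def] M[unfolded cholesky_factor_def]
  have low: "B $$ (i, j) = 0" "M $$ (i, j) = 0" if "i < j" "j < n" for i j
    using d lower_triangular_iff that by blast+
  have tail: "(\<Sum>k<n. N $$ (i, k) * N $$ (j, k)) =
      (\<Sum>k<j. N $$ (i, k) * N $$ (j, k)) + N $$ (i, j) * N $$ (j, j)"
    if "\<And>k. j < k \<Longrightarrow> k < n \<Longrightarrow> N $$ (j, k) = 0" "j < n" for N :: "real mat" and i j
  proof -
    have "(\<Sum>k<n. N $$ (i, k) * N $$ (j, k)) = (\<Sum>k<Suc j. N $$ (i, k) * N $$ (j, k))"
      using that by (intro sum.mono_neutral_right) auto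
    then show ?thesis by simp
  qed
  have eq: "(\<Sum>k<n. B $$ (i, k) * B $$ (j, k)) = (\<Sum>k<n. M $$ (i, k) * M $$ (j, k))"
    if "i < n" "j < n" for i j
    using index_mult_transpose_sum[of B n i j] index_mult_transpose_sum[of M n i j] d that by simp
  have "\<forall>i<n. B $$ (i, j) = M $$ (i, j)" if "j < n" for j
    using that
  proof (induction j rule: less_induct)
    case (less j)
    have st: "B $$ (i, j) * B $$ (j, j) = M $$ (i, j) * M $$ (j, j)" if "i < n" for i
    proof -
      have "(\<Sum>k<j. B $$ (i, k) * B $$ (j, k)) = (\<Sum>k<j. M $$ (i, k) * M $$ (j, k))"
        using less that by (intro sum.cong) auto
      then show ?thesis using eq[OF that less(2)] tail[of j B i] tail[of j M i] low less(2) by simp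
    qed
    have "(B $$ (j, j))\<^sup>2 = (M $$ (j, j))\<^sup>2"
      using st[OF less(2)] by (simp add: power2_eq_square)
    then have "B $$ (j, j) = M $$ (j, j)"
      using d less(2) by (simp add: less_imp_le)
    then show ?case using st d less(2) by (metis less_irrefl mult_right_cancel)
  qed
  then show ?thesis using d by (intro eq_matI) auto
qed

lemma cholesky_eqI: "cholesky_factor n X B \<Longrightarrow> cholesky n X = B"
  unfolding cholesky_def cholesky_factor_def[symmetric]
  by (rule the_equality) (auto intro: cholesky_factor_unique)

lemma cholesky_factor_cholesky: "X \<in> spd n \<Longrightarrow> cholesky_factor n X (cholesky n X)"
  using cholesky_factor_exists cholesky_eqI by metis

lemma cholesky_factor_minv:
  assumes "cholesky_factor n X B"
  shows "minv B \<in> carrier_mat n n" "B * minv B = 1\<^sub>m n" "minv B * B = 1\<^sub>m n"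
proof -
  have B: "B \<in> carrier_mat n n" "\<And>i j. i < j \<Longrightarrow> j < n \<Longrightarrow> B $$ (i, j) = 0"
    "\<And>i. i < n \<Longrightarrow> B $$ (i, i) > 0"
    using assms lower_triangular_iff unfolding cholesky_factor_def by blast+
  have "det B = prod_list (diag_mat B)" by (rule det_lower_triangular[OF B(2,1)])
  moreover have "0 \<notin> set (diag_mat B)" using B(1,3) by (force simp: diag_mat_def)
  ultimately have "det B \<noteq> 0" by (simp add: prod_list_zero_iff)
  from minv_det_nonzero[OF B(1) this]
  show "minv B \<in> carrier_mat n n" "B * minv B = 1\<^sub>m n" "minv B * B = 1\<^sub>m n" .
qed

text \<open>The form at v equals |B^T v|^2 and B is invertible. Positive definiteness of every new
  iterate is obtained from its explicit factor in this way.\<close>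

lemma cholesky_factor_spd:
  assumes "cholesky_factor n X B"
  shows "X \<in> spd n"
proof -
  note inv = cholesky_factor_minv[OF assms]
  have B: "B \<in> carrier_mat n n" "B * B\<^sup>T = X" using assms by (auto simp: cholesky_factor_def)
  have sym: "X\<^sup>T = X" using B(1) unfolding B(2)[symmetric] by (subst transpose_mult[of _ n n _ n]) auto
  have "v \<bullet> (X *\<^sub>v v) > 0" if v: "v \<in> carrier_vec n" "v \<noteq> 0\<^sub>v n" for v
  proof -
    have "B\<^sup>T *\<^sub>v v \<noteq> 0\<^sub>v n"
    proof
      assume "B\<^sup>T *\<^sub>v v = 0\<^sub>v n"
      then have "(minv B)\<^sup>T *\<^sub>v (B\<^sup>T *\<^sub>v v) = 0\<^sub>v n" using inv by (auto intro!: eq_vecI)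
      also have "(minv B)\<^sup>T *\<^sub>v (B\<^sup>T *\<^sub>v v) = (B * minv B)\<^sup>T *\<^sub>v v"
        using inv(1) B(1) v(1) by (simp add: transpose_mult[of _ n n _ n] del: inv(2))
      finally show False using v inv by simp
    qed
    then have "(B\<^sup>T *\<^sub>v v) \<bullet> (B\<^sup>T *\<^sub>v v) > 0" using B v by (intro scalar_prod_self_pos[of _ n]) auto
    moreover have "v \<bullet> (B *\<^sub>v (B\<^sup>T *\<^sub>v v)) = (B\<^sup>T *\<^sub>v v) \<bullet> (B\<^sup>T *\<^sub>v v)"
      using B(1) v(1) by (intro scalar_prod_mult_mat_vec) auto
    ultimately show ?thesis using B v(1) by (simp flip: B(2))
  qed
  then show ?thesis using B sym by (auto simp: spd_def symmetric_mats_def)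
qed

section \<open>Rank-one modification of Cholesky factors\<close>

context
  fixes \<alpha> :: real and y :: "real vec"
begin


text \<open>The leading principal minor of order j of \<open>I + \<alpha> y y\<^sup>T\<close>: quotients of consecutive minors are the
  squared diagonal entries of the Cholesky factor.\<close>

definition leading_minor :: "nat \<Rightarrow> real" where
  "leading_minor j = 1 + \<alpha> * (\<Sum>i<j. (y $ i)\<^sup>2)"

text \<open>Found by elimination: writing s_j for the leading minors, the Schur complement of I +
  \<alpha> y y^T after j steps is I + (\<alpha> / s_j) y y^T on the remaining coordinates. Its pivot
  is s_(j+1) / s_j, and dividing its first column by the root of the pivot gives the entries below
  the diagonal.\<close>

definition rank_one_factor :: "nat \<Rightarrow> real mat" where
  "rank_one_factor n = mat n n (\<lambda>(i, j).
     if i = j then sqrt (leading_minor (Suc j) / leading_minor j)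
     else if j < i then \<alpha> * y $ i * y $ j / sqrt (leading_minor j * leading_minor (Suc j))
     else 0)"

text \<open>The partial sum of squares lies in [0, 1], so the minor is at least the smaller of 1 and
  1 + \<alpha>. The norm is bounded by 1 instead of being equal to 1 because a power iterate may be
  the zero vector.\<close>

lemma leading_minor_pos:
  assumes "y \<in> carrier_vec n" "y \<bullet> y \<le> 1" "\<alpha> > -1" "j \<le> n"
  shows "leading_minor j > 0"
proof -
  define S where "S = (\<Sum>i<j. (y $ i)\<^sup>2)"
  have "S \<le> (\<Sum>i<n. (y $ i)\<^sup>2)" unfolding S_def using assms(4) by (intro sum_mono2) auto
  then have S: "0 \<le> S" "S \<le> 1"
    using assms(1,2) scalar_prod_self[of y n] by (auto simp: S_def intro: sum_nonneg)
  have "1 + \<alpha> * S > 0"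
  proof (cases "\<alpha> \<ge> 0")
    case True
    then show ?thesis using S by (simp add: add_pos_nonneg)
  next
    case False
    then have "\<alpha> * S \<ge> \<alpha> * 1" using S by (intro mult_left_mono_neg) auto
    then show ?thesis using assms(3) by simp
  qed
  then show ?thesis unfolding leading_minor_def S_def .
qed

text \<open>Telescoping: \<alpha> y_k^2 is the difference of consecutive minors, so each summand is
  \<alpha> times a difference of their reciprocals, starting from the minor 1 of order 0.\<close>

lemma sum_leading_minor:
  assumes "\<And>j. j \<le> k \<Longrightarrow> leading_minor j > 0"
  shows "(\<Sum>j<k. (\<alpha> * y $ j)\<^sup>2 / (leading_minor j * leading_minor (Suc j))) =
    \<alpha> * (1 - 1 / leading_minor k)"
  using assms
proof (induction k)
  case 0
  then show ?case by (simp add: leading_minor_def)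
next
  case (Suc k)
  have s: "leading_minor (Suc k) = leading_minor k + \<alpha> * (y $ k)\<^sup>2"
    by (simp add: leading_minor_def algebra_simps)
  have pos: "leading_minor k > 0" "leading_minor (Suc k) > 0" using Suc.prems by auto
  have "(\<alpha> * y $ k)\<^sup>2 / (leading_minor k * leading_minor (Suc k)) =
      \<alpha> * (leading_minor (Suc k) - leading_minor k) / (leading_minor k * leading_minor (Suc k))"
    unfolding s by (simp add: power2_eq_square algebra_simps)
  also have "\<dots> = \<alpha> * (1 / leading_minor k - 1 / leading_minor (Suc k))"
    using pos by (simp add: field_simps)
  finally show ?case using Suc by (simp add: algebra_simps)
qed

text \<open>By symmetry it is enough to treat k \<le> i. There the inner product stops at column k:
  the columns before k telescope, and column k supplies the missing reciprocal of the minor and, on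
  the diagonal, the 1.\<close>

lemma rank_one_factor_mult_transpose:
  assumes "y \<in> carrier_vec n" "y \<bullet> y \<le> 1" "\<alpha> > -1"
  shows "rank_one_factor n * (rank_one_factor n)\<^sup>T = 1\<^sub>m n + \<alpha> \<cdot>\<^sub>m outer_prod y y"
proof -
  let ?M = "rank_one_factor n"
  let ?s = leading_minor
  note pos = leading_minor_pos[OF assms]
  have M: "?M \<in> carrier_mat n n" by (simp add: rank_one_factor_def)
  have lower: "(?M * ?M\<^sup>T) $$ (i, k) = of_bool (i = k) + \<alpha> * (y $ i * y $ k)"
    if "k \<le> i" "i < n" for i k
  proof -
    have "(?M * ?M\<^sup>T) $$ (i, k) = (\<Sum>j<n. ?M $$ (i, j) * ?M $$ (k, j))"
      using index_mult_transpose_sum[OF M] that by simp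
    also have "\<dots> = (\<Sum>j<Suc k. ?M $$ (i, j) * ?M $$ (k, j))"
      using that by (intro sum.mono_neutral_right) (auto simp: rank_one_factor_def)
    also have "\<dots> = (\<Sum>j<k. (y $ i * y $ k) * ((\<alpha> * y $ j)\<^sup>2 / (?s j * ?s (Suc j))))
        + ?M $$ (i, k) * ?M $$ (k, k)"
      unfolding sum.lessThan_Suc
    proof (intro arg_cong2[where f="(+)"] sum.cong refl)
      fix j assume "j \<in> {..<k}"
      then have "?M $$ (i, j) * ?M $$ (k, j) =
          (\<alpha> * y $ i * y $ j) * (\<alpha> * y $ k * y $ j) / (sqrt (?s j * ?s (Suc j)))\<^sup>2"
        using that by (simp add: rank_one_factor_def power2_eq_square)
      also have "(sqrt (?s j * ?s (Suc j)))\<^sup>2 = ?s j * ?s (Suc j)"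
        using pos[of j] pos[of "Suc j"] \<open>j \<in> {..<k}\<close> that by simp
      finally show "?M $$ (i, j) * ?M $$ (k, j) =
          (y $ i * y $ k) * ((\<alpha> * y $ j)\<^sup>2 / (?s j * ?s (Suc j)))"
        by (simp add: power2_eq_square mult_ac)
    qed
    also have "\<dots> = (y $ i * y $ k) * (\<alpha> * (1 - 1 / ?s k)) + ?M $$ (i, k) * ?M $$ (k, k)"
      unfolding sum_distrib_left[symmetric] using pos that by (subst sum_leading_minor) auto
    also have "?M $$ (i, k) * ?M $$ (k, k) = of_bool (i = k) + (y $ i * y $ k) * (\<alpha> / ?s k)"
    proof (cases "i = k")
      case True
      have "?M $$ (i, k) * ?M $$ (k, k) = ?s (Suc k) / ?s k"
        using True that pos[of k] pos[of "Suc k"] by (simp add: rank_one_factor_def)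
      also have "?s (Suc k) = ?s k + \<alpha> * (y $ k)\<^sup>2"
        by (simp add: leading_minor_def algebra_simps)
      finally show ?thesis
        using True that pos[of k] by (simp add: field_simps power2_eq_square)
    next
      case False
      have "sqrt (?s (Suc k) / ?s k) / sqrt (?s k * ?s (Suc k)) = 1 / ?s k"
        using that pos[of k] pos[of "Suc k"] by (simp add: real_sqrt_divide real_sqrt_mult)
      moreover have "?M $$ (i, k) * ?M $$ (k, k) =
          \<alpha> * y $ i * y $ k * (sqrt (?s (Suc k) / ?s k) / sqrt (?s k * ?s (Suc k)))"
        using False that by (simp add: rank_one_factor_def)
      ultimately show ?thesis using False by simp
    qed
    finally show ?thesis by (simp add: algebra_simps)
  qed
  show ?thesis
  proof (rule eq_matI)
    fix i k assume "i < dim_row (1\<^sub>m n + \<alpha> \<cdot>\<^sub>m outer_prod y y)"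
      "k < dim_col (1\<^sub>m n + \<alpha> \<cdot>\<^sub>m outer_prod y y)"
    then have ik: "i < n" "k < n" using assms(1) by (auto simp: outer_prod_def)
    have "(?M * ?M\<^sup>T) $$ (i, k) = (?M * ?M\<^sup>T) $$ (k, i)"
      using index_mult_transpose_sum[OF M] ik by (simp add: mult.commute)
    then have "(?M * ?M\<^sup>T) $$ (i, k) = of_bool (i = k) + \<alpha> * (y $ i * y $ k)"
      using lower[of k i] lower[of i k] ik by (cases "k \<le> i") (auto simp: mult.commute)
    then show "(?M * ?M\<^sup>T) $$ (i, k) = (1\<^sub>m n + \<alpha> \<cdot>\<^sub>m outer_prod y y) $$ (i, k)"
      using ik assms(1) by (auto simp: outer_prod_def)
  qed (use M assms(1) in \<open>auto simp: outer_prod_def\<close>)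
qed

end

lemma congruence_add_smult:
  fixes B :: "real mat"
  assumes "B \<in> carrier_mat n n" "E \<in> carrier_mat n n" "F \<in> carrier_mat n n"
  shows "B * (E + c \<cdot>\<^sub>m F) * B\<^sup>T = B * E * B\<^sup>T + c \<cdot>\<^sub>m (B * F * B\<^sup>T)"
proof -
  have "B * (E + c \<cdot>\<^sub>m F) = B * E + c \<cdot>\<^sub>m (B * F)"
    using assms mult_add_distrib_mat[of B n n E n "c \<cdot>\<^sub>m F"] mult_smult_distrib[of B n n F n c] by simp
  then show ?thesis
    using assms add_mult_distrib_mat[of "B * E" n n "c \<cdot>\<^sub>m (B * F)" "B\<^sup>T" n]
      mult_smult_assoc_mat[of "B * F" n n "B\<^sup>T" n c] by (simp del: assoc_mult_mat)
qed

lemma outer_prod_carrier: "y \<in> carrier_vec n \<Longrightarrow> outer_prod y y \<in> carrier_mat n n"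
  by (auto simp: outer_prod_def)

lemma mult_outer_prod:
  assumes "B \<in> carrier_mat n n" "y \<in> carrier_vec n"
  shows "B * outer_prod y y * B\<^sup>T = outer_prod (B *\<^sub>v y) (B *\<^sub>v y)"
proof (rule eq_matI)
  fix i j assume "i < dim_row (outer_prod (B *\<^sub>v y) (B *\<^sub>v y))" "j < dim_col (outer_prod (B *\<^sub>v y) (B *\<^sub>v y))"
  then have ij: "i < n" "j < n" using assms by (auto simp: outer_prod_def)
  note O = outer_prod_carrier[OF assms(2)]
  have "(B * outer_prod y y * B\<^sup>T) $$ (i, j) = (\<Sum>l<n. (B * outer_prod y y) $$ (i, l) * B\<^sup>T $$ (l, j))"
    using assms O ij by (intro index_mult_mat_sum[of _ n n _ n]) auto
  also have "\<dots> = (\<Sum>l<n. (\<Sum>k<n. B $$ (i, k) * (y $ k * y $ l)) * B $$ (j, l))"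
    using assms ij
    by (intro sum.cong refl, subst index_mult_mat_sum[OF assms(1) O]) (auto simp: outer_prod_def)
  also have "\<dots> = (\<Sum>k<n. B $$ (i, k) * y $ k) * (\<Sum>l<n. B $$ (j, l) * y $ l)"
    unfolding sum_product unfolding sum_distrib_right by (subst sum.swap) (simp add: mult_ac)
  also have "\<dots> = outer_prod (B *\<^sub>v y) (B *\<^sub>v y) $$ (i, j)"
    using assms ij by (simp add: outer_prod_def index_mult_vec_sum[of _ n n] del: index_mult_mat_vec)
  finally show "(B * outer_prod y y * B\<^sup>T) $$ (i, j) = outer_prod (B *\<^sub>v y) (B *\<^sub>v y) $$ (i, j)" .
qed (use assms in \<open>auto simp: outer_prod_def\<close>)

text \<open>Below its diagonal, column b of the factor is a multiple of y. An entry of the product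
  therefore needs one suffix sum of a row of B against y, and sharing these sums brings the cubic
  cost of a matrix product down to a quadratic one.\<close>

lemma index_mult_rank_one_factor:
  assumes "B \<in> carrier_mat n n" "lower_triangular B" "a < n" "b < n"
  shows "(B * rank_one_factor \<alpha> y n) $$ (a, b) = (if a < b then 0 else
    B $$ (a, b) * sqrt (leading_minor \<alpha> y (Suc b) / leading_minor \<alpha> y b) +
    \<alpha> * y $ b / sqrt (leading_minor \<alpha> y b * leading_minor \<alpha> y (Suc b)) *
      (\<Sum>j\<in>{Suc b..<n}. B $$ (a, j) * y $ j))"
proof -
  let ?M = "rank_one_factor \<alpha> y n" and ?s = "leading_minor \<alpha> y"
  have M: "?M \<in> carrier_mat n n" by (simp add: rank_one_factor_def)
  have "(B * ?M) $$ (a, b) = (\<Sum>j<n. B $$ (a, j) * ?M $$ (j, b))"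
    using index_mult_mat_sum[OF assms(1) M assms(3,4)] .
  also have "\<dots> = (\<Sum>j\<in>{b..<n}. B $$ (a, j) * ?M $$ (j, b))"
    using assms by (intro sum.mono_neutral_right) (auto simp: rank_one_factor_def)
  also have "{b..<n} = insert b {Suc b..<n}" using assms by auto
  also have "(\<Sum>j\<in>\<dots>. B $$ (a, j) * ?M $$ (j, b)) = B $$ (a, b) * ?M $$ (b, b) +
      (\<Sum>j\<in>{Suc b..<n}. B $$ (a, j) * ?M $$ (j, b))"
    by (subst sum.insert) auto
  also have "(\<Sum>j\<in>{Suc b..<n}. B $$ (a, j) * ?M $$ (j, b)) =
    \<alpha> * y $ b / sqrt (?s b * ?s (Suc b)) * (\<Sum>j\<in>{Suc b..<n}. B $$ (a, j) * y $ j)"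
    unfolding sum_distrib_left using assms(4) by (intro sum.cong) (auto simp: rank_one_factor_def)
  also have "?M $$ (b, b) = sqrt (?s (Suc b) / ?s b)" using assms by (simp add: rank_one_factor_def)
  finally have eq: "(B * ?M) $$ (a, b) = B $$ (a, b) * sqrt (?s (Suc b) / ?s b) +
    \<alpha> * y $ b / sqrt (?s b * ?s (Suc b)) * (\<Sum>j\<in>{Suc b..<n}. B $$ (a, j) * y $ j)" .
  have low: "B $$ (a, j) = 0" if "a < j" "j < n" for j
    using assms that by (auto simp: lower_triangular_iff)
  show ?thesis
  proof (cases "a < b")
    case True
    then have "(\<Sum>j\<in>{Suc b..<n}. B $$ (a, j) * y $ j) = 0" by (intro sum.neutral) (auto simp: low)
    then show ?thesis using eq True low assms by simp
  qed (use eq in simp)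
qed

text \<open>The modified matrix is B (I + \<alpha> y y^T) B^T, and products of lower triangular
  matrices with positive diagonal are of the same kind.\<close>

lemma cholesky_factor_rank_one:
  assumes B: "cholesky_factor n X B" and y: "y \<in> carrier_vec n" "y \<bullet> y \<le> 1" and a: "\<alpha> > -1"
  shows "cholesky_factor n (X + \<alpha> \<cdot>\<^sub>m (B * outer_prod y y * B\<^sup>T)) (B * rank_one_factor \<alpha> y n)"
  unfolding cholesky_factor_def
proof (intro conjI allI impI)
  let ?M = "rank_one_factor \<alpha> y n"
  have Bc: "B \<in> carrier_mat n n" "lower_triangular B" "B * B\<^sup>T = X" "\<And>i. i < n \<Longrightarrow> B $$ (i, i) > 0"
    using B by (auto simp: cholesky_factor_def)
  have M: "?M \<in> carrier_mat n n" by (simp add: rank_one_factor_def)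
  note O = outer_prod_carrier[OF y(1)]
  show BM: "B * ?M \<in> carrier_mat n n" using Bc M by simp
  show "lower_triangular (B * ?M)"
    using index_mult_rank_one_factor[OF Bc(1,2)] by (subst lower_triangular_iff[OF BM]) auto
  show "(B * ?M) $$ (i, i) > 0" if "i < n" for i
  proof -
    have "(\<Sum>j\<in>{Suc i..<n}. B $$ (i, j) * y $ j) = 0"
      using Bc that by (intro sum.neutral) (auto simp: lower_triangular_iff)
    then show ?thesis
      using index_mult_rank_one_factor[OF Bc(1,2) that that, of \<alpha> y] Bc(4)[OF that]
        leading_minor_pos[OF y a, of i] leading_minor_pos[OF y a, of "Suc i"] that by simp
  qed
  have "(B * ?M) * (B * ?M)\<^sup>T = B * (?M * ?M\<^sup>T) * B\<^sup>T"
    using Bc(1) M by (simp add: transpose_mult[of _ n n _ n] assoc_mult_mat[of _ n n _ n _ n])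
  also have "\<dots> = B * B\<^sup>T + \<alpha> \<cdot>\<^sub>m (B * outer_prod y y * B\<^sup>T)"
    unfolding rank_one_factor_mult_transpose[OF y a]
    using congruence_add_smult[OF Bc(1) one_carrier_mat O] Bc(1) by simp
  finally show "(B * ?M) * (B * ?M)\<^sup>T = X + \<alpha> \<cdot>\<^sub>m (B * outer_prod y y * B\<^sup>T)" using Bc by simp
qed

section \<open>Exponential of rank-one matrices\<close>

lemma smult_smult_mat: "a \<cdot>\<^sub>m (b \<cdot>\<^sub>m A) = (a * b) \<cdot>\<^sub>m A" for A :: "real mat"
  by (intro eq_matI) auto

lemma outer_prod_mult_self:
  assumes "y \<in> carrier_vec n" "y \<bullet> y = 1"
  shows "outer_prod y y * outer_prod y y = outer_prod y y"
proof (rule eq_matI)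
  fix i j assume "i < dim_row (outer_prod y y)" "j < dim_col (outer_prod y y)"
  then have ij: "i < n" "j < n" using assms by (auto simp: outer_prod_def)
  have "(outer_prod y y * outer_prod y y) $$ (i, j) = (\<Sum>k<n. y $ i * y $ j * (y $ k)\<^sup>2)"
    using assms(1) ij
    by (subst index_mult_mat_sum[of _ n n _ n]) (auto simp: outer_prod_def power2_eq_square mult_ac)
  also have "\<dots> = y $ i * y $ j"
    using assms scalar_prod_self[OF assms(1)] by (simp flip: sum_distrib_left)
  finally show "(outer_prod y y * outer_prod y y) $$ (i, j) = outer_prod y y $$ (i, j)"
    using ij assms by (simp add: outer_prod_def)
qed (use assms in \<open>auto simp: outer_prod_def\<close>)

text \<open>For a unit vector, y y^T is idempotent, so the exponential series collapses to a scalar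
  one. This is the origin of the factor exp - 1 in the algorithm's update.\<close>

lemma mat_exp_outer_prod:
  assumes "y \<in> carrier_vec n" "y \<bullet> y = 1"
  shows "mat_exp (c \<cdot>\<^sub>m outer_prod y y) = 1\<^sub>m n + (exp c - 1) \<cdot>\<^sub>m outer_prod y y"
proof -
  let ?O = "outer_prod y y"
  note O = outer_prod_carrier[OF assms(1)]
  have pow: "(c \<cdot>\<^sub>m ?O) ^\<^sub>m Suc k = c ^ Suc k \<cdot>\<^sub>m ?O" for k
  proof (induction k)
    case 0
    show ?case using O by (simp add: left_mult_one_mat[of _ n n])
  next
    case (Suc k)
    have "(c \<cdot>\<^sub>m ?O) ^\<^sub>m Suc (Suc k) = (c ^ Suc k \<cdot>\<^sub>m ?O) * (c \<cdot>\<^sub>m ?O)" using Suc by simp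
    also have "\<dots> = (c ^ Suc k * c) \<cdot>\<^sub>m (?O * ?O)"
      using O by (simp add: mult_smult_distrib[of _ n n _ n] mult_smult_assoc_mat[of _ n n _ n])
        (simp add: smult_smult_mat mult_ac)
    finally show ?case unfolding outer_prod_mult_self[OF assms] by (simp add: mult_ac)
  qed
  show ?thesis
  proof (rule eq_matI)
    fix i j assume "i < dim_row (1\<^sub>m n + (exp c - 1) \<cdot>\<^sub>m ?O)" "j < dim_col (1\<^sub>m n + (exp c - 1) \<cdot>\<^sub>m ?O)"
    then have ij: "i < n" "j < n" using O by auto
    \<comment> \<open>Correction of the term of order 0, where the power is the identity and not y
      y^T.\<close>
    define d where "d = of_bool (i = j) - y $ i * y $ j"
    have "((c \<cdot>\<^sub>m ?O) ^\<^sub>m k) $$ (i, j) / fact k =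
        c ^ k / fact k * (y $ i * y $ j) + (if k = 0 then d else 0)" for k
    proof (cases k)
      case 0
      then show ?thesis using ij O by (auto simp: d_def)
    next
      case (Suc k')
      then show ?thesis unfolding Suc pow using ij assms(1) by (simp add: outer_prod_def)
    qed
    moreover have "(\<lambda>k. c ^ k / fact k * (y $ i * y $ j) + (if k = 0 then d else 0)) sums
        (exp c * (y $ i * y $ j) + d)"
      using exp_converges[of c]
      by (intro sums_add sums_mult2 sums_If_finite_set[of "{0}", simplified])
        (auto simp: divide_inverse mult.commute scaleR_conv_of_real sums_single)
    ultimately have "(\<Sum>k. ((c \<cdot>\<^sub>m ?O) ^\<^sub>m k) $$ (i, j) / fact k) = exp c * (y $ i * y $ j) + d"
      by (simp add: sums_iff)
    then show "mat_exp (c \<cdot>\<^sub>m ?O) $$ (i, j) = (1\<^sub>m n + (exp c - 1) \<cdot>\<^sub>m ?O) $$ (i, j)"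
      using ij assms(1) O by (auto simp: mat_exp_def d_def outer_prod_def algebra_simps)
  qed (use O in \<open>auto simp: mat_exp_def\<close>)
qed

section \<open>Descent of one step\<close>

text \<open>The inverse of X is B^(-T) B^(-1), so E \<mapsto> B E B^T carries the trace form
  isometrically to the metric at X. All computations in the metric are thereby moved to the identity
  matrix.\<close>

lemma rinner_congruence:
  assumes B: "cholesky_factor n X B" and E: "E \<in> carrier_mat n n" and F: "F \<in> carrier_mat n n"
  shows "rinner X (B * E * B\<^sup>T) (B * F * B\<^sup>T) = mat_tr (E * F)"
proof -
  define C where "C = minv B"
  have Bc: "B \<in> carrier_mat n n" "B * B\<^sup>T = X" using B by (auto simp: cholesky_factor_def)
  have C: "C \<in> carrier_mat n n" "B * C = 1\<^sub>m n" "C * B = 1\<^sub>m n"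
    using cholesky_factor_minv[OF B] by (auto simp: C_def)
  have T: "B\<^sup>T * C\<^sup>T = 1\<^sub>m n"
    using transpose_mult[OF C(1) Bc(1)] C(3) by simp
  have mi: "minv X = C\<^sup>T * C"
  proof (rule minv_eqI)
    have "X * (C\<^sup>T * C) = B * (B\<^sup>T * C\<^sup>T) * C"
      unfolding Bc(2)[symmetric] using Bc(1) C(1) by (simp add: assoc_mult_mat[of _ n n _ n _ n] del: T)
    then show "X * (C\<^sup>T * C) = 1\<^sub>m n" using Bc(1) C by (simp add: T)
  qed (use Bc C in auto)
  have cong: "minv X * (B * E * B\<^sup>T) = C\<^sup>T * E * B\<^sup>T" if "E \<in> carrier_mat n n" for E
  proof -
    have "minv X * (B * E * B\<^sup>T) = C\<^sup>T * (C * B) * E * B\<^sup>T"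
      unfolding mi using Bc(1) C(1) that by (simp add: assoc_mult_mat[of _ n n _ n _ n])
    then show ?thesis using C by simp
  qed
  have mX: "minv X \<in> carrier_mat n n" unfolding mi using C by simp
  have "rinner X (B * E * B\<^sup>T) (B * F * B\<^sup>T) = mat_tr ((minv X * (B * E * B\<^sup>T)) * (minv X * (B * F * B\<^sup>T)))"
    unfolding rinner_def using mX Bc(1) E F by (simp add: assoc_mult_mat[of _ n n _ n _ n])
  also have "\<dots> = mat_tr (C\<^sup>T * (E * (B\<^sup>T * C\<^sup>T) * F * B\<^sup>T))"
    unfolding cong[OF E] cong[OF F] using Bc(1) C(1) E F
    by (simp add: assoc_mult_mat[of _ n n _ n _ n])
  also have "\<dots> = mat_tr (C\<^sup>T * (E * F * B\<^sup>T))" unfolding T using E by simp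
  also have "\<dots> = mat_tr ((E * F * B\<^sup>T) * C\<^sup>T)"
    using Bc(1) C(1) E F by (intro mat_tr_comm[of _ n n]) auto
  also have "(E * F * B\<^sup>T) * C\<^sup>T = E * F * (B\<^sup>T * C\<^sup>T)"
    using Bc(1) C(1) E F by (simp add: assoc_mult_mat[of _ n n _ n _ n])
  also have "\<dots> = E * F" unfolding T using E F by simp
  finally show ?thesis .
qed

text \<open>Conjugating the velocity back by the inverse of B leaves a multiple of y y^T, whose
  exponential is known in closed form.\<close>

lemma geodesic_velocity_rank_one:
  assumes B: "cholesky_factor n X B" and y: "y \<in> carrier_vec n" "y \<bullet> y = 1"
  shows "geodesic_velocity n X (X + (exp c - 1) \<cdot>\<^sub>m (B * outer_prod y y * B\<^sup>T))
    (B * (c \<cdot>\<^sub>m outer_prod y y) * B\<^sup>T)"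
proof -
  let ?E = "c \<cdot>\<^sub>m outer_prod y y"
  note O = outer_prod_carrier[OF y(1)]
  have E: "?E \<in> carrier_mat n n" "?E\<^sup>T = ?E" using O by (auto simp: outer_prod_def)
  define C where "C = minv B"
  have Bc: "B \<in> carrier_mat n n" "B * B\<^sup>T = X" using B by (auto simp: cholesky_factor_def)
  have C: "C \<in> carrier_mat n n" "B * C = 1\<^sub>m n" "C * B = 1\<^sub>m n"
    using cholesky_factor_minv[OF B] by (auto simp: C_def)
  have T: "B\<^sup>T * C\<^sup>T = 1\<^sub>m n"
    using transpose_mult[OF C(1) Bc(1)] C(3) by simp
  have "(B * ?E * B\<^sup>T)\<^sup>T = B * ?E * B\<^sup>T"
    using Bc(1) E by (simp add: transpose_mult[of _ n n _ n] assoc_mult_mat[of _ n n _ n _ n])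
  moreover have "C * (B * ?E * B\<^sup>T) * C\<^sup>T = ?E"
  proof -
    have "C * (B * ?E * B\<^sup>T) * C\<^sup>T = (C * B) * ?E * (B\<^sup>T * C\<^sup>T)"
      using Bc(1) C(1) E(1) by (simp add: assoc_mult_mat[of _ n n _ n _ n])
    then show ?thesis unfolding T C using E O by simp
  qed
  moreover have "1 \<cdot>\<^sub>m ?E = ?E" using E by (auto intro!: eq_matI)
  moreover have "B * (1\<^sub>m n + (exp c - 1) \<cdot>\<^sub>m outer_prod y y) * B\<^sup>T =
      X + (exp c - 1) \<cdot>\<^sub>m (B * outer_prod y y * B\<^sup>T)"
    unfolding Bc(2)[symmetric]
    using congruence_add_smult[OF Bc(1) one_carrier_mat O] Bc(1) by simp
  ultimately show ?thesis
    unfolding geodesic_velocity_def geodesic_def Let_def cholesky_eqI[OF B] C_def[symmetric]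
    using Bc(1) E by (auto simp: symmetric_mats_def mat_exp_outer_prod[OF y])
qed

section \<open>Normalised iterates and the gradient in Cholesky coordinates\<close>

lemma normalize_vec_carrier: "v \<in> carrier_vec n \<Longrightarrow> normalize_vec v \<in> carrier_vec n"
  by (simp add: normalize_vec_def)

lemma normalize_vec_unit:
  assumes "v \<in> carrier_vec n" "v \<noteq> 0\<^sub>v n"
  shows "normalize_vec v \<bullet> normalize_vec v = 1"
proof -
  have "v \<bullet> v > 0" using scalar_prod_self_pos assms .
  then show ?thesis using assms(1)
    by (simp add: normalize_vec_def vec_norm2_def smult_scalar_prod_distrib[of _ n]
        scalar_prod_smult_distrib[of _ n])
qed

lemma normalize_vec_zero: "normalize_vec (0\<^sub>v n) = 0\<^sub>v n"
  by (auto simp: normalize_vec_def intro!: eq_vecI)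

lemma rgrad_congruence:
  assumes B: "cholesky_factor n X B" and G: "grad X \<in> carrier_mat n n"
  shows "rgrad grad X = B * pmat n grad X * B\<^sup>T"
proof -
  have Bc: "B \<in> carrier_mat n n" "B * B\<^sup>T = X" using B by (auto simp: cholesky_factor_def)
  show ?thesis
    unfolding rgrad_def pmat_def cholesky_eqI[OF B] using Bc(1) G
    by (simp add: assoc_mult_mat[of _ n n _ n _ n] flip: Bc(2)[THEN arg_cong[where f="\<lambda>Y. Y * grad X * Y"]])
qed

lemma pmat_symmetric:
  assumes "X \<in> spd n" "grad X \<in> symmetric_mats n"
  shows "pmat n grad X \<in> symmetric_mats n"
  using cholesky_factor_cholesky[OF assms(1)] assms(2)
  by (auto simp: pmat_def cholesky_factor_def symmetric_mats_def transpose_mult[of _ n n _ n]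
      assoc_mult_mat[of _ n n _ n _ n])

lemma power_iterate_carrier:
  assumes "X \<in> spd n" "grad X \<in> symmetric_mats n" "u \<in> carrier_vec n"
  shows "power_iterate n grad X u i \<in> carrier_vec n"
proof -
  have "pmat n grad X \<in> carrier_mat n n"
    using pmat_symmetric[where grad=grad, OF assms(1,2)] by (simp add: symmetric_mats_def)
  then show ?thesis using assms(3) by (induction i) (auto intro: normalize_vec_carrier)
qed

text \<open>The zero vector arises from a zero draw or from an iterate in the kernel of P, because 1
  / 0 = 0 in \<open>normalize_vec\<close>. Keeping this case avoids any almost-sure argument about
  the draws.\<close>

lemma power_iterate_unit_or_zero:
  assumes "X \<in> spd n" "grad X \<in> symmetric_mats n" "u \<in> carrier_vec n"
  shows "power_iterate n grad X u i = 0\<^sub>v n \<or>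
    power_iterate n grad X u i \<bullet> power_iterate n grad X u i = 1"
proof -
  have P: "pmat n grad X \<in> carrier_mat n n"
    using pmat_symmetric[where grad=grad, OF assms(1,2)] by (simp add: symmetric_mats_def)
  have "\<exists>v\<in>carrier_vec n. power_iterate n grad X u i = normalize_vec v"
    using power_iterate_carrier[where grad=grad, OF assms] P assms(3) by (cases i) auto
  then show ?thesis using normalize_vec_unit[of _ n] normalize_vec_zero by metis
qed

lemma power_iterate_norm_le:
  assumes "X \<in> spd n" "grad X \<in> symmetric_mats n" "u \<in> carrier_vec n"
  shows "power_iterate n grad X u i \<bullet> power_iterate n grad X u i \<le> 1"
  using power_iterate_unit_or_zero[where grad=grad, OF assms, of i] by auto

text \<open>The coefficient exp - 1 exceeds -1 for every real exponent, so no step size leads out of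
  the positive definite cone.\<close>

lemma r1rsd_step_cholesky_factor:
  assumes "X \<in> spd n" "grad X \<in> symmetric_mats n" "u \<in> carrier_vec n"
  shows "cholesky_factor n (r1rsd_step n grad r \<beta> X u)
    (cholesky n X * rank_one_factor (exp (- rayleigh n grad r X u * \<beta>) - 1) (power_iterate n grad X u r) n)"
  unfolding r1rsd_step_def Let_def
  by (intro cholesky_factor_rank_one cholesky_factor_cholesky assms power_iterate_carrier
      power_iterate_norm_le) auto

lemma r1rsd_step_spd:
  assumes "X \<in> spd n" "grad X \<in> symmetric_mats n" "u \<in> carrier_vec n"
  shows "r1rsd_step n grad r \<beta> X u \<in> spd n"
  using cholesky_factor_spd[OF r1rsd_step_cholesky_factor[where grad=grad, OF assms]] .

text \<open>With l the Rayleigh quotient, the smoothness bound changes f by at most - \<beta> l^2 +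
  L \<beta>^2 l^2 / 2, which is least at \<beta> = 1 / L. If the power iterate is zero, the step
  stands still and l = 0.\<close>

lemma r1rsd_step_descent:
  assumes X: "X \<in> spd n" and G: "grad X \<in> symmetric_mats n" and u: "u \<in> carrier_vec n"
    and L: "L > 0" and smooth: "geodesically_smooth n L f grad"
  shows "f (r1rsd_step n grad r (1 / L) X u) \<le> f X - (rayleigh n grad r X u)\<^sup>2 / (2 * L)"
proof -
  define B where "B = cholesky n X"
  define y where "y = power_iterate n grad X u r"
  define l where "l = rayleigh n grad r X u"
  define P where "P = pmat n grad X"
  have B: "cholesky_factor n X B" unfolding B_def by (rule cholesky_factor_cholesky[OF X])
  have y: "y \<in> carrier_vec n" unfolding y_def by (rule power_iterate_carrier[where grad=grad, OF X G u])
  have P: "P \<in> carrier_mat n n" using pmat_symmetric[where grad=grad, OF X G] by (simp add: P_def symmetric_mats_def)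
  have l: "l = y \<bullet> (P *\<^sub>v y)" by (simp add: l_def rayleigh_def y_def P_def Let_def)
  note O = outer_prod_carrier[OF y]
  have step: "r1rsd_step n grad r (1 / L) X u = X + (exp (- l / L) - 1) \<cdot>\<^sub>m (B * outer_prod y y * B\<^sup>T)"
    by (simp add: r1rsd_step_def B_def y_def l_def Let_def)
  show ?thesis
  proof (cases "y = 0\<^sub>v n")
    case True
    have "B \<in> carrier_mat n n" using B by (simp add: cholesky_factor_def)
    moreover have "outer_prod y y = 0\<^sub>m n n" using True by (auto simp: outer_prod_def)
    ultimately have "r1rsd_step n grad r (1 / L) X u = X"
      unfolding step using spd_carrier[OF X] by (auto intro!: eq_matI)
    moreover have "l = 0" unfolding l using True P by simp
    ultimately show ?thesis by (simp add: l_def)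
  next
    case False
    then have unit: "y \<bullet> y = 1"
      using power_iterate_unit_or_zero[where grad=grad, OF X G u, of r] by (simp add: y_def)
    define E where "E = (- l / L) \<cdot>\<^sub>m outer_prod y y"
    have E: "E \<in> carrier_mat n n" using O by (simp add: E_def)
    have "geodesic_velocity n X (r1rsd_step n grad r (1 / L) X u) (B * E * B\<^sup>T)"
      unfolding step E_def by (rule geodesic_velocity_rank_one[OF B y unit])
    then have "f (r1rsd_step n grad r (1 / L) X u) \<le>
        f X + rinner X (rgrad grad X) (B * E * B\<^sup>T) + L / 2 * (rnorm X (B * E * B\<^sup>T))\<^sup>2"
      using smooth r1rsd_step_spd[where grad=grad, OF X G u] X unfolding geodesically_smooth_def by blast
    also have "rinner X (rgrad grad X) (B * E * B\<^sup>T) = mat_tr (P * E)"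
      using G rinner_congruence[OF B P E] unfolding P_def
      by (subst rgrad_congruence[OF B]) (auto simp: symmetric_mats_def)
    also have "\<dots> = - l\<^sup>2 / L" unfolding E_def mat_tr_mult_outer_prod[OF P y] l[symmetric]
      by (simp add: power2_eq_square)
    also have "(rnorm X (B * E * B\<^sup>T))\<^sup>2 = l\<^sup>2 / L\<^sup>2"
    proof -
      \<comment> \<open>E is rank-one with eigenvector y, so the trace of E E is again a quadratic
        form at y.\<close>
      have "E *\<^sub>v y = (- l / L) \<cdot>\<^sub>v y"
      proof (rule eq_vecI)
        fix i assume "i < dim_vec ((- l / L) \<cdot>\<^sub>v y)"
        then have i: "i < n" using y by simp
        have "(E *\<^sub>v y) $ i = (\<Sum>k<n. (- l / L) * y $ i * (y $ k)\<^sup>2)"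
          using i y E by (subst index_mult_vec_sum[of _ n n])
            (auto simp: E_def outer_prod_def power2_eq_square mult_ac)
        also have "\<dots> = (- l / L) * y $ i"
          unfolding sum_distrib_left[symmetric] using unit scalar_prod_self[OF y] by simp
        finally show "(E *\<^sub>v y) $ i = ((- l / L) \<cdot>\<^sub>v y) $ i" using i y by simp
      qed (use y E in auto)
      then have "mat_tr (E * E) = l\<^sup>2 / L\<^sup>2"
        using mat_tr_mult_outer_prod[OF E y, of "- l / L", folded E_def] y unit
        by (simp add: scalar_prod_smult_distrib[of _ n] power2_eq_square)
      then show ?thesis by (simp add: rnorm_def rinner_congruence[OF B E E])
    qed
    also have "f X + - l\<^sup>2 / L + L / 2 * (l\<^sup>2 / L\<^sup>2) = f X - l\<^sup>2 / (2 * L)"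
      using L by (simp add: field_simps power2_eq_square)
    finally show ?thesis unfolding l_def .
  qed
qed

section \<open>Diagonalisation of real symmetric matrices\<close>

text \<open>The reflection I - 2 w w^T / |w|^2 with w = v - e_0 exchanges e_0 and v. If w = 0 the
  identity serves instead.\<close>

lemma householder:
  fixes v :: "real vec"
  assumes v: "v \<in> carrier_vec (Suc m)" "v \<bullet> v = 1"
  shows "\<exists>H \<in> carrier_mat (Suc m) (Suc m). H\<^sup>T * H = 1\<^sub>m (Suc m) \<and> col H 0 = v"
proof -
  let ?n = "Suc m"
  define w where "w = v - unit_vec ?n 0"
  have w: "w \<in> carrier_vec ?n" using v by (simp add: w_def)
  have wi: "w $ i = v $ i - of_bool (i = 0)" if "i < ?n" for i
    using that v by (auto simp: w_def unit_vec_def)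
  show ?thesis
  proof (cases "w = 0\<^sub>v ?n")
    case True
    have "v = unit_vec ?n 0"
    proof (rule eq_vecI)
      fix i assume "i < dim_vec (unit_vec ?n 0)"
      then show "v $ i = unit_vec ?n 0 $ i" using wi[of i] True by (auto simp: unit_vec_def)
    qed (use v in auto)
    then show ?thesis by (intro bexI[of _ "1\<^sub>m ?n"]) auto
  next
    case False
    define N where "N = w \<bullet> w"
    have N: "N > 0" using scalar_prod_self_pos[OF w False] by (simp add: N_def)
    have "N = (v $ 0 - 1)\<^sup>2 + (\<Sum>i<m. (v $ Suc i)\<^sup>2)"
      unfolding N_def scalar_prod_self[OF w] sum.lessThan_Suc_shift by (simp add: wi)
    moreover have "(v $ 0)\<^sup>2 + (\<Sum>i<m. (v $ Suc i)\<^sup>2) = 1"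
      using v(2) unfolding scalar_prod_self[OF v(1)] sum.lessThan_Suc_shift by simp
    \<comment> \<open>For a unit vector, |v - e_0|^2 = 2 - 2 v_0; this makes column 0 of the
      reflection equal to v.\<close>
    ultimately have Nw: "N = - 2 * w $ 0" by (simp add: wi power2_eq_square algebra_simps)
    define H where "H = mat ?n ?n (\<lambda>(i, j). of_bool (i = j) - 2 / N * (w $ i * w $ j))"
    have H: "H \<in> carrier_mat ?n ?n" by (simp add: H_def)
    have "H\<^sup>T * H = 1\<^sub>m ?n"
    proof (rule eq_matI)
      fix i j assume "i < dim_row (1\<^sub>m ?n)" "j < dim_col (1\<^sub>m ?n)"
      then have ij: "i < ?n" "j < ?n" by auto
      have "(H\<^sup>T * H) $$ (i, j) = (\<Sum>k<?n. H\<^sup>T $$ (i, k) * H $$ (k, j))"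
        using H ij by (intro index_mult_mat_sum[of _ ?n ?n _ ?n]) auto
      also have "\<dots> = (\<Sum>k<?n. of_bool (k = i) * of_bool (i = j) - 2 / N * (w $ i * w $ j) * of_bool (k = i)
          - 2 / N * (w $ i * w $ j) * of_bool (k = j) + (2 / N)\<^sup>2 * (w $ i * w $ j) * (w $ k)\<^sup>2)"
        using ij by (intro sum.cong refl) (auto simp: H_def power2_eq_square algebra_simps)
      also have "\<dots> = of_bool (i = j) - 2 / N * (w $ i * w $ j) - 2 / N * (w $ i * w $ j)
          + (2 / N)\<^sup>2 * (w $ i * w $ j) * N"
      proof -
        have d: "(\<Sum>k<?n. c * of_bool (k = l)) = c" if "l < ?n" for c :: real and l
          using that by (simp add: of_bool_def sum.delta if_distrib[where f="\<lambda>x. c * x"] del: sum.lessThan_Suc cong: if_cong)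
        have d': "(\<Sum>k<?n. of_bool (k = i) * of_bool (i = j)) = (of_bool (i = j) :: real)"
          using d[of i "of_bool (i = j)"] ij by (simp only: mult.commute)
        have "(\<Sum>k<?n. (2 / N)\<^sup>2 * (w $ i * w $ j) * (w $ k)\<^sup>2) = (2 / N)\<^sup>2 * (w $ i * w $ j) * N"
          unfolding N_def scalar_prod_self[OF w] sum_distrib_left[symmetric] ..
        then show ?thesis by (simp only: sum.distrib sum_subtractf d d' ij)
      qed
      also have "\<dots> = 1\<^sub>m ?n $$ (i, j)" using N ij by (simp add: power2_eq_square field_simps)
      finally show "(H\<^sup>T * H) $$ (i, j) = 1\<^sub>m ?n $$ (i, j)" .
    qed (use H in auto)
    moreover have "col H 0 = v"
    proof (rule eq_vecI)
      fix i assume "i < dim_vec v"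
      then have i: "i < ?n" using v by simp
      have "2 / N * w $ 0 = - 1" using N Nw by (simp add: field_simps)
      then have "2 / N * (w $ i * w $ 0) = - w $ i" by (metis mult.left_commute mult_minus1_right)
      then show "col H 0 $ i = v $ i" using i wi[OF i] H by (auto simp: H_def)
    qed (use v H in auto)
    ultimately show ?thesis using H by blast
  qed
qed

lemma orthogonal_mult_transpose:
  "Q \<in> carrier_mat n n \<Longrightarrow> Q\<^sup>T * Q = 1\<^sub>m n \<Longrightarrow> Q * Q\<^sup>T = 1\<^sub>m n" for Q :: "real mat"
  using mat_mult_left_right_inverse[of "Q\<^sup>T" n Q] by simp

lemma char_poly_1x1: "char_poly (mat 1 1 (\<lambda>_. e)) = [:- e, 1:]" for e :: real
  by (subst char_poly_upper_triangular[of _ 1]) (auto simp: diag_mat_def upper_triangular_def)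

text \<open>Deflation along the given list: a reflection moves a unit eigenvector to e_0, and
  symmetry clears the first row along with the first column. Following the list fixes the order of
  the diagonal, so that a dominant eigenvalue listed first ends up in position 0.\<close>

theorem symmetric_diagonalization:
  fixes A :: "real mat"
  assumes "A \<in> symmetric_mats n" "length es = n" "char_poly A = (\<Prod>e\<leftarrow>es. [:- e, 1:])"
  shows "\<exists>Q \<in> carrier_mat n n. Q\<^sup>T * Q = 1\<^sub>m n \<and> A = Q * mat_diag n (\<lambda>i. es ! i) * Q\<^sup>T"
  using assms
proof (induction es arbitrary: n A)
  case Nil
  then show ?case by (intro bexI[of _ "1\<^sub>m 0"]) (auto simp: symmetric_mats_def)
next
  case (Cons e es)
  then obtain m where n: "n = Suc m" and m: "length es = m" by auto
  have A: "A \<in> carrier_mat n n" "A\<^sup>T = A" using Cons.prems by (auto simp: symmetric_mats_def)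
  have "eigenvalue A e" using Cons.prems(3) eigenvalue_root_char_poly[OF A(1)] by simp
  then obtain v0 where v0: "v0 \<in> carrier_vec n" "v0 \<noteq> 0\<^sub>v n" "A *\<^sub>v v0 = e \<cdot>\<^sub>v v0"
    using A by (auto simp: eigenvalue_def eigenvector_def)
  define v where "v = normalize_vec v0"
  have v: "v \<in> carrier_vec n" "v \<bullet> v = 1" "A *\<^sub>v v = e \<cdot>\<^sub>v v"
    using normalize_vec_unit[OF v0(1,2)] v0 A
    by (auto simp: v_def normalize_vec_def mult_mat_vec[of A n n] smult_smult_assoc mult.commute)
  obtain H where H: "H \<in> carrier_mat n n" "H\<^sup>T * H = 1\<^sub>m n" "col H 0 = v"
    using householder[of v m] v n by auto
  have H': "H * H\<^sup>T = 1\<^sub>m n" using orthogonal_mult_transpose[OF H(1,2)] .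
  define A' where "A' = H\<^sup>T * A * H"
  have A': "A' \<in> carrier_mat n n" using H A by (simp add: A'_def)
  have symA': "A'\<^sup>T = A'"
    using A H(1) by (simp add: A'_def transpose_mult[of _ n n _ n] assoc_mult_mat[of _ n n _ n _ n])
  have AH: "A = H * A' * H\<^sup>T"
  proof -
    have "H * A' * H\<^sup>T = (H * H\<^sup>T) * A * (H * H\<^sup>T)"
      unfolding A'_def using A(1) H(1) by (simp add: assoc_mult_mat[of _ n n _ n _ n])
    then show ?thesis unfolding H' using A by simp
  qed
  have col0: "A' $$ (i, 0) = (if i = 0 then e else 0)" if "i < n" for i
  proof -
    have "A' $$ (i, 0) = (H\<^sup>T * (A * H)) $$ (i, 0)"
      unfolding A'_def using A H by (simp add: assoc_mult_mat[of _ n n _ n _ n])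
    also have "\<dots> = row (H\<^sup>T) i \<bullet> col (A * H) 0"
      using that n H A by (subst index_mult_mat) auto
    also have "col (A * H) 0 = e \<cdot>\<^sub>v col H 0"
      using col_mult2[OF A(1) H(1), of 0] n v(3) H(3) by simp
    also have "row (H\<^sup>T) i \<bullet> (e \<cdot>\<^sub>v col H 0) = e * (row (H\<^sup>T) i \<bullet> col H 0)"
      using H(1) by simp
    also have "row (H\<^sup>T) i \<bullet> col H 0 = (H\<^sup>T * H) $$ (i, 0)" using H(1) that n by simp
    finally show ?thesis unfolding H(2) using that n by simp
  qed
  have row0: "A' $$ (0, j) = (if j = 0 then e else 0)" if "j < n" for j
  proof -
    have "A' $$ (0, j) = A'\<^sup>T $$ (j, 0)" using A' that n by simp
    then show ?thesis using col0[OF that] symA' by simp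
  qed
  define A3 where "A3 = mat m m (\<lambda>(i, j). A' $$ (Suc i, Suc j))"
  have A3: "A3 \<in> symmetric_mats m"
    using index_transpose_mat(1)[of _ A'] A' symA' n
    by (auto simp: A3_def symmetric_mats_def intro!: eq_matI)
  have A3c: "A3 \<in> carrier_mat m m" by (simp add: A3_def)
  have blk: "A' = four_block_mat (mat 1 1 (\<lambda>_. e)) (0\<^sub>m 1 m) (0\<^sub>m m 1) A3"
  proof (rule eq_matI)
    fix i j assume "i < dim_row (four_block_mat (mat 1 1 (\<lambda>_. e)) (0\<^sub>m 1 m) (0\<^sub>m m 1) A3)"
      "j < dim_col (four_block_mat (mat 1 1 (\<lambda>_. e)) (0\<^sub>m 1 m) (0\<^sub>m m 1) A3)"
    then have "i < Suc m" "j < Suc m" using A3c by auto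
    then show "A' $$ (i, j) = four_block_mat (mat 1 1 (\<lambda>_. e)) (0\<^sub>m 1 m) (0\<^sub>m m 1) A3 $$ (i, j)"
      using col0[of i] row0[of j] A3c n by (auto simp: A3_def)
  qed (use A' n A3c in auto)
  have "similar_mat A A'"
    by (rule similar_matI[of _ _ H "H\<^sup>T" n]) (use A H H' A' AH in auto)
  then have "char_poly A' = char_poly A" by (simp add: char_poly_similar)
  moreover have "char_poly A' = [:- e, 1:] * char_poly A3"
    unfolding blk char_poly_1x1[symmetric] by (rule char_poly_four_block_zeros_col) (use A3c in auto)
  ultimately have "[:- e, 1:] * char_poly A3 = [:- e, 1:] * (\<Prod>e\<leftarrow>es. [:- e, 1:])"
    using Cons.prems(3) by simp
  \<comment> \<open>Similarity and the block form split off one linear factor; cancelling it leaves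
    the tail of the list for the smaller block.\<close>
  then have "char_poly A3 = (\<Prod>e\<leftarrow>es. [:- e, 1:])" by (subst (asm) mult_left_cancel) auto
  from Cons.IH[OF A3 m this] obtain Q3 where Q3: "Q3 \<in> carrier_mat m m" "Q3\<^sup>T * Q3 = 1\<^sub>m m"
    "A3 = Q3 * mat_diag m (\<lambda>i. es ! i) * Q3\<^sup>T" by auto
  define K where "K = four_block_mat (1\<^sub>m 1) (0\<^sub>m 1 m) (0\<^sub>m m 1) Q3"
  have KT: "K\<^sup>T = four_block_mat (1\<^sub>m 1) (0\<^sub>m 1 m) (0\<^sub>m m 1) (Q3\<^sup>T)"
    unfolding K_def using Q3 by (subst transpose_four_block_mat[of _ 1 1 _ m _ m]) auto
  have K: "K \<in> carrier_mat n n" using Q3(1) n by (intro carrier_matI) (auto simp: K_def)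
  have KK: "K\<^sup>T * K = 1\<^sub>m n"
    unfolding KT unfolding K_def using Q3 n
    by (subst mult_four_block_mat[of _ 1 1 _ m _ m _ _ 1 _ m]) auto
  let ?D = "mat_diag n (\<lambda>i. (e # es) ! i)"
  have D: "?D = four_block_mat (mat 1 1 (\<lambda>_. e)) (0\<^sub>m 1 m) (0\<^sub>m m 1) (mat_diag m (\<lambda>i. es ! i))"
    using n by (intro eq_matI) (auto simp: mat_diag_def less_Suc_eq_0_disj)
  have "K * ?D * K\<^sup>T = A'"
  proof -
    have "K * ?D = four_block_mat (mat 1 1 (\<lambda>_. e)) (0\<^sub>m 1 m) (0\<^sub>m m 1) (Q3 * mat_diag m (\<lambda>i. es ! i))"
      unfolding K_def D using Q3(1)
      by (subst mult_four_block_mat[of _ 1 1 _ m _ m _ _ 1 _ m])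
        (auto simp: left_mult_zero_mat[OF mat_diag_dim])
    moreover have R: "Q3 * mat_diag m (\<lambda>i. es ! i) \<in> carrier_mat m m"
      using Q3(1) by (intro mult_carrier_mat[of _ m m]) auto
    moreover have "Q3 * mat_diag m (\<lambda>i. es ! i) * Q3\<^sup>T \<in> carrier_mat m m"
      using Q3(1) by (intro mult_carrier_mat[OF R]) auto
    ultimately show ?thesis unfolding KT blk Q3(3) using Q3(1)
      by (simp, subst mult_four_block_mat[of _ 1 1 _ m _ m _ _ 1 _ m])
        (auto simp: right_mult_zero_mat[OF R])
  qed
  moreover have "(H * K) * D * (H * K)\<^sup>T = H * (K * D * K\<^sup>T) * H\<^sup>T" if "D \<in> carrier_mat n n" for D
    using H(1) K that by (simp add: transpose_mult[of _ n n _ n] assoc_mult_mat[of _ n n _ n _ n])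
  ultimately have "A = (H * K) * ?D * (H * K)\<^sup>T" unfolding AH by simp
  moreover have "(H * K)\<^sup>T * (H * K) = K\<^sup>T * (H\<^sup>T * H) * K"
    using H(1) K by (simp add: transpose_mult[of _ n n _ n] assoc_mult_mat[of _ n n _ n _ n])
  then have "(H * K)\<^sup>T * (H * K) = 1\<^sub>m n" unfolding H(2) using K KK by simp
  ultimately show ?case using H K by (intro bexI[of _ "H * K"]) auto
qed

section \<open>Power iteration\<close>

lemma normalize_vec_smult:
  assumes "v \<in> carrier_vec n" "k > 0"
  shows "normalize_vec (k \<cdot>\<^sub>v v) = normalize_vec v"
proof -
  have "vec_norm2 (k \<cdot>\<^sub>v v) = k * vec_norm2 v"
    using assms by (simp add: vec_norm2_def smult_scalar_prod_distrib[of _ n]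
        scalar_prod_smult_distrib[of _ n] real_sqrt_mult mult.assoc[symmetric])
  then show ?thesis using assms by (simp add: normalize_vec_def smult_smult_assoc)
qed

text \<open>Normalisation rescales by a positive factor, so it can be deferred: r rounds amount to
  one normalisation of P^r u.\<close>

lemma normalize_vec_mult_normalize_vec:
  assumes "P \<in> carrier_mat n n" "v \<in> carrier_vec n"
  shows "normalize_vec (P *\<^sub>v normalize_vec v) = normalize_vec (P *\<^sub>v v)"
proof (cases "v = 0\<^sub>v n")
  case True
  then show ?thesis by (simp add: normalize_vec_zero)
next
  case False
  then have "v \<bullet> v > 0" using scalar_prod_self_pos[OF assms(2)] by simp
  then have "1 / vec_norm2 v > 0" by (simp add: vec_norm2_def)
  moreover have "P *\<^sub>v normalize_vec v = (1 / vec_norm2 v) \<cdot>\<^sub>v (P *\<^sub>v v)"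
    unfolding normalize_vec_def using assms by (simp add: mult_mat_vec[of P n n])
  ultimately show ?thesis using normalize_vec_smult[of "P *\<^sub>v v" n] assms by simp
qed

lemma power_iterate_eq:
  assumes "pmat n grad X \<in> carrier_mat n n" "u \<in> carrier_vec n"
  shows "((*\<^sub>v) (pmat n grad X) ^^ i) u \<in> carrier_vec n \<and>
    power_iterate n grad X u i = normalize_vec (((*\<^sub>v) (pmat n grad X) ^^ i) u)"
  by (induction i) (use assms normalize_vec_mult_normalize_vec[OF assms(1)] in auto)

text \<open>If the power iteration hits 0, both sides are 0 because of \<open>x / 0 = 0\<close>.\<close>

lemma rayleigh_eq:
  fixes r :: nat
  assumes "pmat n grad X \<in> carrier_mat n n" "u \<in> carrier_vec n"
  defines "w \<equiv> ((*\<^sub>v) (pmat n grad X) ^^ r) u"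
  shows "rayleigh n grad r X u = (w \<bullet> (pmat n grad X *\<^sub>v w)) / (w \<bullet> w)"
proof -
  have w: "w \<in> carrier_vec n" "power_iterate n grad X u r = normalize_vec w"
    using power_iterate_eq[OF assms(1,2)] by (auto simp: w_def)
  have "(1 / vec_norm2 w) * (1 / vec_norm2 w) = 1 / (w \<bullet> w)"
    using scalar_prod_self_nonneg[of w] by (simp add: vec_norm2_def)
  then show ?thesis unfolding rayleigh_def w(2) Let_def normalize_vec_def using w(1) assms(1)
    by (simp add: mult_mat_vec[of _ n n] smult_scalar_prod_distrib[of _ n]
        scalar_prod_smult_distrib[of _ n])
qed

text \<open>With A the dominant term of the denominator and B the rest, the gap gives B \<le> A / 2.
  The other eigenvalues may have any sign, so they can take |e 0| A / 2 off the numerator, while the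
  denominator is at most 3 A / 2: the quotient keeps a third of |e 0|.\<close>

lemma dominated_quotient_bound:
  fixes e c :: "nat \<Rightarrow> real"
  assumes "n > 0" and e: "\<And>i. 0 < i \<Longrightarrow> i < n \<Longrightarrow> \<bar>e i\<bar> \<le> \<rho> * \<bar>e 0\<bar>" "e 0 \<noteq> 0"
    and \<rho>: "0 \<le> \<rho>" "\<rho> \<le> 1" and c: "c 0 \<noteq> 0" "2 * (\<rho> ^ (2 * r) * (\<Sum>i<n. (c i)\<^sup>2)) \<le> (c 0)\<^sup>2"
  shows "(e 0)\<^sup>2 / 9 \<le> ((\<Sum>i<n. e i * (e i ^ r * c i)\<^sup>2) / (\<Sum>i<n. (e i ^ r * c i)\<^sup>2))\<^sup>2"
proof -
  define A where "A = (e 0 ^ r * c 0)\<^sup>2"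
  define B where "B = (\<Sum>i\<in>{1..<n}. (e i ^ r * c i)\<^sup>2)"
  define R where "R = (\<Sum>i\<in>{1..<n}. e i * (e i ^ r * c i)\<^sup>2)"
  have A: "A > 0" using e(2) c(1) by (simp add: A_def)
  have split: "(\<Sum>i<n. g i) = g 0 + (\<Sum>i\<in>{1..<n}. g i)" for g :: "nat \<Rightarrow> real"
    using assms(1) by (simp add: lessThan_atLeast0 sum.atLeast_Suc_lessThan)
  have B: "B \<le> A / 2"
  proof -
    have "B \<le> (\<Sum>i\<in>{1..<n}. (e 0)^(2 * r) * \<rho> ^ (2 * r) * (c i)\<^sup>2)"
      unfolding B_def
    proof (rule sum_mono)
      fix i assume "i \<in> {1..<n}"
      then have "\<bar>e i\<bar> ^ (2 * r) \<le> (\<rho> * \<bar>e 0\<bar>) ^ (2 * r)" using e(1)[of i] by (intro power_mono) auto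
      then have "e i ^ (2 * r) \<le> \<rho> ^ (2 * r) * e 0 ^ (2 * r)"
        by (simp add: power_mult_distrib power_even_abs)
      then show "(e i ^ r * c i)\<^sup>2 \<le> (e 0)^(2 * r) * \<rho> ^ (2 * r) * (c i)\<^sup>2"
        by (simp add: power_mult_distrib power_mult[symmetric] mult.commute mult_left_mono)
    qed
    also have "\<dots> = (e 0)^(2 * r) * (\<rho> ^ (2 * r) * (\<Sum>i\<in>{1..<n}. (c i)\<^sup>2))"
      by (simp add: sum_distrib_left mult.assoc)
    also have "\<dots> \<le> (e 0)^(2 * r) * (\<rho> ^ (2 * r) * (\<Sum>i<n. (c i)\<^sup>2))"
      unfolding split[of "\<lambda>i. (c i)\<^sup>2"] using \<rho> by (intro mult_left_mono) auto
    also have "\<dots> \<le> (e 0)^(2 * r) * ((c 0)\<^sup>2 / 2)"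
      using c(2) by (intro mult_left_mono) auto
    also have "\<dots> = A / 2" by (simp add: A_def power_mult_distrib power_mult[symmetric] mult.commute)
    finally show ?thesis .
  qed
  have "B \<ge> 0" unfolding B_def by (intro sum_nonneg) auto
  have "\<bar>R\<bar> \<le> (\<Sum>i\<in>{1..<n}. \<bar>e i * (e i ^ r * c i)\<^sup>2\<bar>)" unfolding R_def by (rule sum_abs)
  also have "\<dots> \<le> (\<Sum>i\<in>{1..<n}. \<bar>e 0\<bar> * (e i ^ r * c i)\<^sup>2)"
  proof (rule sum_mono)
    fix i assume "i \<in> {1..<n}"
    then have "\<bar>e i\<bar> \<le> \<bar>e 0\<bar>" using e(1)[of i] \<rho> mult_right_mono[OF \<rho>(2), of "\<bar>e 0\<bar>"] by simp
    then show "\<bar>e i * (e i ^ r * c i)\<^sup>2\<bar> \<le> \<bar>e 0\<bar> * (e i ^ r * c i)\<^sup>2"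
      by (simp add: abs_mult mult_right_mono)
  qed
  also have "\<dots> = \<bar>e 0\<bar> * B" by (simp add: B_def sum_distrib_left)
  also have "\<dots> \<le> \<bar>e 0\<bar> * (A / 2)" using B by (intro mult_left_mono) auto
  finally have "\<bar>R\<bar> \<le> \<bar>e 0\<bar> * A / 2" by simp
  moreover have "\<bar>e 0 * A\<bar> = \<bar>e 0\<bar> * A" using A by (simp add: abs_mult)
  ultimately have num: "\<bar>e 0 * A + R\<bar> \<ge> \<bar>e 0\<bar> * A / 2" by linarith
  have "\<bar>e 0\<bar> / 3 = (\<bar>e 0\<bar> * A / 2) / (3 / 2 * A)" using A by simp
  also have "\<dots> \<le> \<bar>e 0 * A + R\<bar> / (A + B)"
    using num A B \<open>B \<ge> 0\<close> by (intro frac_le) auto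
  also have "\<dots> = \<bar>(e 0 * A + R) / (A + B)\<bar>" using A \<open>B \<ge> 0\<close> by (simp add: abs_divide)
  finally have "(\<bar>e 0\<bar> / 3)\<^sup>2 \<le> \<bar>(e 0 * A + R) / (A + B)\<bar>\<^sup>2" by (intro power_mono) auto
  then show ?thesis unfolding split A_def[symmetric] B_def[symmetric] R_def[symmetric]
    by (simp add: power_divide)
qed

text \<open>The strict inequality makes the dominant eigenvalue nonzero, so the gap can be
  multiplied out; \<rho> is nonnegative as an upper bound of a ratio of absolute values.\<close>

lemma spectral_gap_diagonalization:
  assumes "X \<in> spd n" "grad X \<in> symmetric_mats n" "spectral_gap n \<rho> grad" "n \<ge> 2"
  obtains Q and e :: "nat \<Rightarrow> real" where "Q \<in> carrier_mat n n" "Q\<^sup>T * Q = 1\<^sub>m n"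
    "pmat n grad X = Q * mat_diag n e * Q\<^sup>T" "e 0 \<noteq> 0" "0 \<le> \<rho>"
    "\<And>i. 0 < i \<Longrightarrow> i < n \<Longrightarrow> \<bar>e i\<bar> \<le> \<rho> * \<bar>e 0\<bar>"
proof -
  obtain es where es: "length es = n" "char_poly (pmat n grad X) = (\<Prod>e\<leftarrow>es. [:- e, 1:])"
    "sorted_wrt (\<lambda>a b. \<bar>a\<bar> \<ge> \<bar>b\<bar>) es" "\<bar>es ! 0\<bar> > \<bar>es ! 1\<bar>" "\<bar>es ! 1\<bar> / \<bar>es ! 0\<bar> \<le> \<rho>"
    using assms(1,3) unfolding spectral_gap_def by blast
  obtain Q where Q: "Q \<in> carrier_mat n n" "Q\<^sup>T * Q = 1\<^sub>m n"
    "pmat n grad X = Q * mat_diag n (\<lambda>i. es ! i) * Q\<^sup>T"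
    using symmetric_diagonalization[OF pmat_symmetric[where grad=grad, OF assms(1,2)] es(1,2)] by auto
  have pos: "\<bar>es ! 0\<bar> > 0" using es(4) by linarith
  have one: "\<bar>es ! 1\<bar> \<le> \<rho> * \<bar>es ! 0\<bar>" using es(5) pos by (simp add: divide_le_eq)
  have "\<bar>es ! i\<bar> \<le> \<rho> * \<bar>es ! 0\<bar>" if "0 < i" "i < n" for i
  proof (cases "i = 1")
    case False
    then have "\<bar>es ! i\<bar> \<le> \<bar>es ! 1\<bar>" using sorted_wrt_nth_less[OF es(3), of 1 i] that es(1) by auto
    then show ?thesis using one by simp
  qed (use one in simp)
  moreover have "0 \<le> \<rho>" by (rule order_trans[OF _ es(5)]) simp
  ultimately show ?thesis using that[of Q "\<lambda>i. es ! i"] Q pos by auto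
qed

lemma rinner_rgrad:
  assumes "X \<in> spd n" "grad X \<in> symmetric_mats n"
  shows "rinner X (rgrad grad X) (rgrad grad X) = mat_tr (pmat n grad X * pmat n grad X)"
proof -
  have B: "cholesky_factor n X (cholesky n X)" by (rule cholesky_factor_cholesky[OF assms(1)])
  have P: "pmat n grad X \<in> carrier_mat n n" "grad X \<in> carrier_mat n n"
    using pmat_symmetric[where grad=grad, OF assms] assms(2) by (auto simp: symmetric_mats_def)
  show ?thesis unfolding rgrad_congruence[OF B, where grad=grad, OF P(2)] by (rule rinner_congruence[OF B P(1,1)])
qed

lemma rinner_rgrad_nonneg:
  assumes "X \<in> spd n" "grad X \<in> symmetric_mats n"
  shows "rinner X (rgrad grad X) (rgrad grad X) \<ge> 0"
proof -
  let ?P = "pmat n grad X"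
  have P: "?P \<in> carrier_mat n n" "?P\<^sup>T = ?P"
    using pmat_symmetric[where grad=grad, OF assms] by (auto simp: symmetric_mats_def)
  have "?P $$ (i, k) * ?P $$ (k, i) \<ge> 0" if "i < n" "k < n" for i k
    using index_transpose_mat(1)[of i ?P k] P that by simp
  then show ?thesis unfolding rinner_rgrad[where grad=grad, OF assms] mat_tr_mult[OF P(1,1)]
    by (intro sum_nonneg) auto
qed

text \<open>The witness v is the eigenvector in column 0 of Q and depends on X alone. That it
  precedes u in the quantifier order is what allows u to be integrated afterwards.\<close>

theorem power_iteration_estimate:
  assumes X: "X \<in> spd n" and G: "grad X \<in> symmetric_mats n" and gap: "spectral_gap n \<rho> grad"
    and n: "n \<ge> 2" and \<rho>: "\<rho> \<le> 1" and r: "\<rho> ^ (2 * r) * (128 * real n) \<le> 1"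
  shows "\<exists>v \<in> carrier_vec n. v \<bullet> v = 1 \<and> (\<forall>u \<in> carrier_vec n. (v \<bullet> u)\<^sup>2 \<ge> 1 / 16 \<longrightarrow> u \<bullet> u \<le> 4 * real n \<longrightarrow>
    rinner X (rgrad grad X) (rgrad grad X) \<le> 9 * real n * (rayleigh n grad r X u)\<^sup>2)"
proof -
  let ?P = "pmat n grad X"
  obtain Q e where Q: "Q \<in> carrier_mat n n" "Q\<^sup>T * Q = 1\<^sub>m n" "?P = Q * mat_diag n e * Q\<^sup>T"
    and e: "e 0 \<noteq> 0" "\<And>i. 0 < i \<Longrightarrow> i < n \<Longrightarrow> \<bar>e i\<bar> \<le> \<rho> * \<bar>e 0\<bar>" and \<rho>0: "0 \<le> \<rho>"
    using spectral_gap_diagonalization[where grad=grad, OF X G gap n] by metis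
  define D where "D = mat_diag n e"
  have D: "D \<in> carrier_mat n n" by (simp add: D_def)
  note Q3 = Q(3)[folded D_def]
  have Q': "Q * Q\<^sup>T = 1\<^sub>m n" using orthogonal_mult_transpose[OF Q(1,2)] .
  have P: "?P \<in> carrier_mat n n"
    unfolding Q3 using Q(1) D by (intro mult_carrier_mat[of _ n n]) auto
  have trPP: "mat_tr (?P * ?P) \<le> real n * (e 0)\<^sup>2"
  proof -
    have "?P * ?P = Q * (D * (Q\<^sup>T * Q) * D * Q\<^sup>T)"
      unfolding Q3 using Q(1) D by (simp add: assoc_mult_mat[of _ n n _ n _ n])
    also have "\<dots> = Q * (D * D * Q\<^sup>T)" unfolding Q(2) using D by simp
    finally have "mat_tr (?P * ?P) = mat_tr ((D * D * Q\<^sup>T) * Q)"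
      using Q(1) D mat_tr_comm[of Q n n "D * D * Q\<^sup>T"] by simp
    also have "(D * D * Q\<^sup>T) * Q = D * D * (Q\<^sup>T * Q)"
      using Q(1) D by (simp add: assoc_mult_mat[of _ n n _ n _ n])
    also have "mat_tr \<dots> = (\<Sum>i<n. e i * e i)" unfolding Q(2)
      using D by (simp add: mat_tr_def D_def) (simp add: mat_diag_def)
    also have "\<dots> \<le> (\<Sum>i<n. (e 0)\<^sup>2)"
    proof (rule sum_mono)
      fix i assume "i \<in> {..<n}"
      then have "\<bar>e i\<bar> \<le> \<bar>e 0\<bar>"
        using e(2)[of i] mult_right_mono[OF \<rho>, of "\<bar>e 0\<bar>"] by (cases "i = 0") auto
      then show "e i * e i \<le> (e 0)\<^sup>2" by (simp add: abs_le_square_iff flip: power2_eq_square)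
    qed
    finally show ?thesis by simp
  qed
  \<comment> \<open>In the coordinates given by Q, multiplication by P scales coordinate i by e i;
    iterating gives the powers in the quotient.\<close>
  have coord: "(Q\<^sup>T *\<^sub>v (?P *\<^sub>v w)) $ i = e i * (Q\<^sup>T *\<^sub>v w) $ i"
    if "w \<in> carrier_vec n" "i < n" for w i
  proof -
    have c: "Q\<^sup>T *\<^sub>v w \<in> carrier_vec n" using Q(1) that by simp
    have "Q\<^sup>T *\<^sub>v (?P *\<^sub>v w) = (Q\<^sup>T * Q) *\<^sub>v (D *\<^sub>v (Q\<^sup>T *\<^sub>v w))"
      unfolding Q3 using Q(1) D that(1) by (simp add: assoc_mult_mat_vec[of _ n n _ n])
    also have "\<dots> = D *\<^sub>v (Q\<^sup>T *\<^sub>v w)" unfolding Q(2) using c D by simp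
    also have "\<dots> $ i = (\<Sum>k<n. D $$ (i, k) * (Q\<^sup>T *\<^sub>v w) $ k)"
      by (rule index_mult_vec_sum[OF D c that(2)])
    also have "\<dots> = (\<Sum>k\<in>{i}. D $$ (i, k) * (Q\<^sup>T *\<^sub>v w) $ k)"
      using that(2) by (intro sum.mono_neutral_right) (auto simp: D_def mat_diag_def)
    finally show ?thesis using that(2) by (simp add: D_def mat_diag_def)
  qed
  have scal: "w \<bullet> z = (\<Sum>i<n. (Q\<^sup>T *\<^sub>v w) $ i * (Q\<^sup>T *\<^sub>v z) $ i)"
    if "w \<in> carrier_vec n" "z \<in> carrier_vec n" for w z
  proof -
    have "(Q\<^sup>T *\<^sub>v w) \<bullet> (Q\<^sup>T *\<^sub>v z) = (Q *\<^sub>v (Q\<^sup>T *\<^sub>v w)) \<bullet> z"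
      using scalar_prod_mult_mat_vec[of "Q\<^sup>T" n n "Q\<^sup>T *\<^sub>v w" z] Q(1) that by simp
    also have "Q *\<^sub>v (Q\<^sup>T *\<^sub>v w) = w"
      using Q' Q(1) that by (simp flip: assoc_mult_mat_vec[of Q n n "Q\<^sup>T" n])
    finally show ?thesis using that Q(1) by (simp add: scalar_prod_sum[of _ n])
  qed
  show ?thesis
  proof (intro bexI[of _ "col Q 0"] conjI ballI impI)
    show "col Q 0 \<in> carrier_vec n" using Q(1) by (simp add: carrier_vecI)
    have "(Q\<^sup>T * Q) $$ (0, 0) = 1" using Q(2) n by simp
    then show "col Q 0 \<bullet> col Q 0 = 1" using Q(1) n by simp
    fix u assume u: "u \<in> carrier_vec n" "1 / 16 \<le> (col Q 0 \<bullet> u)\<^sup>2" "u \<bullet> u \<le> 4 * real n"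
    define c where "c = (\<lambda>i. (Q\<^sup>T *\<^sub>v u) $ i)"
    define w where "w = ((*\<^sub>v) ?P ^^ r) u"
    have w: "((*\<^sub>v) ?P ^^ r) u \<in> carrier_vec n \<and> (\<forall>i<n. (Q\<^sup>T *\<^sub>v (((*\<^sub>v) ?P ^^ r) u)) $ i = e i ^ r * c i)" for r
    proof (induction r)
      case 0
      then show ?case using u by (simp add: c_def)
    next
      case (Suc r)
      then show ?case using P coord by auto
    qed
    have wc: "w \<in> carrier_vec n" and wi: "\<And>i. i < n \<Longrightarrow> (Q\<^sup>T *\<^sub>v w) $ i = e i ^ r * c i"
      using w[of r] by (auto simp: w_def)
    have c0: "c 0 = col Q 0 \<bullet> u" using Q(1) n by (simp add: c_def)
    have S: "(\<Sum>i<n. (c i)\<^sup>2) = u \<bullet> u"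
      using scal[OF u(1,1)] by (simp add: c_def power2_eq_square)
    have "2 * (\<rho> ^ (2 * r) * (\<Sum>i<n. (c i)\<^sup>2)) \<le> 2 * (\<rho> ^ (2 * r) * (4 * real n))"
      unfolding S using u(3) \<rho>0 by (intro mult_left_mono) auto
    also have "\<dots> \<le> 1 / 16" using r by simp
    also have "\<dots> \<le> (c 0)\<^sup>2" unfolding c0 by (rule u(2))
    finally have small: "2 * (\<rho> ^ (2 * r) * (\<Sum>i<n. (c i)\<^sup>2)) \<le> (c 0)\<^sup>2" .
    have "c 0 \<noteq> 0" using u(2) unfolding c0 by auto
    then have "(e 0)\<^sup>2 / 9 \<le> ((\<Sum>i<n. e i * (e i ^ r * c i)\<^sup>2) / (\<Sum>i<n. (e i ^ r * c i)\<^sup>2))\<^sup>2"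
      using n e \<rho> \<rho>0 small by (intro dominated_quotient_bound) auto
    also have "(\<Sum>i<n. (e i ^ r * c i)\<^sup>2) = w \<bullet> w"
      using scal[OF wc wc] wi by (simp add: power2_eq_square)
    also have "(\<Sum>i<n. e i * (e i ^ r * c i)\<^sup>2) = w \<bullet> (?P *\<^sub>v w)"
      using scal[OF wc, of "?P *\<^sub>v w"] P wc coord wi by (simp add: power2_eq_square mult_ac)
    also have "(w \<bullet> (?P *\<^sub>v w)) / (w \<bullet> w) = rayleigh n grad r X u"
      using rayleigh_eq[OF P u(1), of r] by (simp add: w_def)
    finally have "real n * (e 0)\<^sup>2 \<le> 9 * real n * (rayleigh n grad r X u)\<^sup>2"
      using mult_left_mono[of "(e 0)\<^sup>2" "9 * (rayleigh n grad r X u)\<^sup>2" "real n"] by simp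
    then show "rinner X (rgrad grad X) (rgrad grad X) \<le> 9 * real n * (rayleigh n grad r X u)\<^sup>2"
      using trPP unfolding rinner_rgrad[where grad=grad, OF X G] by simp
  qed
qed

section \<open>Flop count of one iteration\<close>

lemma vec_entriesI: "i < n \<Longrightarrow> (\<lambda>s. F s $ i) \<in> vec_entries n F"
  by (auto simp: vec_entries_def)

lemma mat_entriesI: "i < n \<Longrightarrow> j < m \<Longrightarrow> (\<lambda>s. F s $$ (i, j)) \<in> mat_entries (n, m) F"
  by (auto simp: mat_entries_def)

lemma vec_entries_comp: "(\<lambda>q s. q (h s)) ` vec_entries n F = vec_entries n (\<lambda>s. F (h s))"
  by (auto simp: vec_entries_def)

lemma mat_entries_comp: "(\<lambda>q s. q (h s)) ` mat_entries d F = mat_entries d (\<lambda>s. F (h s))"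
proof -
  have eq: "mat_entries d F = (\<Union>i<fst d. \<Union>j<snd d. {\<lambda>s. F s $$ (i, j)})" for F :: "'s \<Rightarrow> real mat"
    by (auto simp: mat_entries_def)
  show ?thesis unfolding eq by (simp add: image_UN)
qed

lemma inverse_entries_comp:
  "(\<lambda>q s. q (h s)) ` inverse_entries n R F = inverse_entries n R (\<lambda>s. F (h s))"
  by (simp add: inverse_entries_def image_UN mat_entries_comp)

lemma flops_within_cong_single:
  "flops_within D A k {g} \<Longrightarrow> (\<And>s. s \<in> D \<Longrightarrow> f s = g s) \<Longrightarrow> flops_within D A k {f}"
  by (erule flops_within_cong) auto

lemma flops_within_vec_entries:
  assumes "\<And>i. i < n \<Longrightarrow> flops_within D A k {\<lambda>s. F s $ i}"
  shows "flops_within D A (n * k) (vec_entries n F)"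
proof -
  have "vec_entries n F = (\<Union>i<n. {\<lambda>s. F s $ i})" by (auto simp: vec_entries_def)
  then show ?thesis using flops_within_UN[of "{..<n}" D A k "\<lambda>i. {\<lambda>s. F s $ i}"] assms by simp
qed

lemma flops_within_mat_entries:
  assumes "\<And>i j. i < n \<Longrightarrow> j < n \<Longrightarrow> flops_within D A k {\<lambda>s. F s $$ (i, j)}"
  shows "flops_within D A (n * (n * k)) (mat_entries (n, n) F)"
proof -
  have "mat_entries (n, n) F = (\<Union>i<n. \<Union>j<n. {\<lambda>s. F s $$ (i, j)})" by (auto simp: mat_entries_def)
  moreover have "flops_within D A (card {..<n} * k) (\<Union>j<n. {\<lambda>s. F s $$ (i, j)})" if "i < n" for i
    using assms that by (intro flops_within_UN) auto
  ultimately show ?thesis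
    using flops_within_UN[of "{..<n}" D A "n * k" "\<lambda>i. \<Union>j<n. {\<lambda>s. F s $$ (i, j)}"] by simp
qed

lemma flops_within_mult_mat_vec:
  assumes "\<And>s. s \<in> D \<Longrightarrow> M s \<in> carrier_mat n n" "\<And>s. s \<in> D \<Longrightarrow> v s \<in> carrier_vec n"
    and "mat_entries (n, n) M \<subseteq> A" "vec_entries n v \<subseteq> A"
  shows "flops_within D A (n * (2 * n)) (vec_entries n (\<lambda>s. M s *\<^sub>v v s))"
proof (rule flops_within_vec_entries)
  fix i assume i: "i < n"
  have "flops_within D A (2 * n) {\<lambda>s. \<Sum>k<n. M s $$ (i, k) * v s $ k}"
    using assms(3,4) i by (intro flops_within_dot) (auto intro: vec_entriesI mat_entriesI)
  then show "flops_within D A (2 * n) {\<lambda>s. (M s *\<^sub>v v s) $ i}"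
    by (rule flops_within_cong_single) (rule index_mult_vec_sum[OF assms(1,2) i])
qed

lemma flops_within_transpose_mult_mat_vec:
  assumes "\<And>s. s \<in> D \<Longrightarrow> M s \<in> carrier_mat n n" "\<And>s. s \<in> D \<Longrightarrow> v s \<in> carrier_vec n"
    and "mat_entries (n, n) M \<subseteq> A" "vec_entries n v \<subseteq> A"
  shows "flops_within D A (n * (2 * n)) (vec_entries n (\<lambda>s. (M s)\<^sup>T *\<^sub>v v s))"
proof (rule flops_within_vec_entries)
  fix i assume i: "i < n"
  have "flops_within D A (2 * n) {\<lambda>s. \<Sum>k<n. M s $$ (k, i) * v s $ k}"
    using assms(3,4) i by (intro flops_within_dot) (auto intro: vec_entriesI mat_entriesI)
  then show "flops_within D A (2 * n) {\<lambda>s. ((M s)\<^sup>T *\<^sub>v v s) $ i}"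
  proof (rule flops_within_cong_single)
    fix s assume s: "s \<in> D"
    have "((M s)\<^sup>T *\<^sub>v v s) $ i = (\<Sum>k<n. (M s)\<^sup>T $$ (i, k) * v s $ k)"
      using assms(1,2)[OF s] i by (intro index_mult_vec_sum) auto
    also have "\<dots> = (\<Sum>k<n. M s $$ (k, i) * v s $ k)"
      using assms(1)[OF s] i by (intro sum.cong) auto
    finally show "((M s)\<^sup>T *\<^sub>v v s) $ i = (\<Sum>k<n. M s $$ (k, i) * v s $ k)" .
  qed
qed

lemma flops_within_scalar_prod:
  assumes "\<And>s. s \<in> D \<Longrightarrow> w s \<in> carrier_vec n" "vec_entries n v \<subseteq> A" "vec_entries n w \<subseteq> A"
  shows "flops_within D A (2 * n) {\<lambda>s. v s \<bullet> w s}"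
proof -
  have "flops_within D A (2 * n) {\<lambda>s. \<Sum>k<n. v s $ k * w s $ k}"
    using assms(2,3) by (intro flops_within_dot) (auto intro: vec_entriesI)
  then show ?thesis
    by (rule flops_within_cong_single) (rule scalar_prod_sum[OF assms(1)])
qed

lemma flops_within_normalize_vec:
  assumes "\<And>s. s \<in> D \<Longrightarrow> v s \<in> carrier_vec n" "vec_entries n v \<subseteq> A"
  shows "flops_within D A (3 * n + 2) (vec_entries n (\<lambda>s. normalize_vec (v s)))"
proof -
  let ?c = "\<lambda>s. 1 / vec_norm2 (v s)"
  have "flops_within D A (2 * n) {\<lambda>s. v s \<bullet> v s}"
    by (rule flops_within_scalar_prod[OF assms(1,2,2)])
  then have c: "flops_within D A (Suc (0 + Suc (2 * n))) {?c}"
    unfolding vec_norm2_def by (intro flops_within_divide flops_within_const flops_within_sqrt)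
  have "flops_within D (A \<union> {?c}) (n * Suc (0 + 0)) (vec_entries n (\<lambda>s. normalize_vec (v s)))"
  proof (rule flops_within_vec_entries)
    fix i assume i: "i < n"
    have "flops_within D (A \<union> {?c}) (Suc (0 + 0)) {\<lambda>s. ?c s * v s $ i}"
      using assms(2) vec_entriesI[OF i, of v] by (intro flops_within_mult flops_within_input) auto
    then show "flops_within D (A \<union> {?c}) (Suc (0 + 0)) {\<lambda>s. normalize_vec (v s) $ i}"
      using i assms(1) by (elim flops_within_cong_single) (auto simp: normalize_vec_def carrier_vecD[OF assms(1)])
  qed
  from flops_within_seq[OF c this] show ?thesis by (rule flops_within_mono) auto
qed

lemma has_euclidean_gradient_symmetric: "has_euclidean_gradient n f G X \<Longrightarrow> G \<in> symmetric_mats n"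
  by (simp add: has_euclidean_gradient_def)

text \<open>P is never formed: the vector passes through B, the gradient and B^T in turn, with two
  quadratic products around one granted gradient product.\<close>

lemma flops_within_pmat_mult:
  assumes G: "\<And>X. X \<in> spd n \<Longrightarrow> grad X \<in> symmetric_mats n"
    and q: "gradient_product_flops n R grad q"
    and D: "\<And>s. s \<in> D \<Longrightarrow> Y s \<in> spd n" "\<And>s. s \<in> D \<Longrightarrow> y s \<in> carrier_vec n"
    and A: "mat_entries (n, n) Y \<subseteq> A" "mat_entries (n, n) (\<lambda>s. cholesky n (Y s)) \<subseteq> A"
      "inverse_entries n R Y \<subseteq> A" "vec_entries n y \<subseteq> A"
  shows "flops_within D A (4 * n\<^sup>2 + q) (vec_entries n (\<lambda>s. pmat n grad (Y s) *\<^sub>v y s))"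
proof -
  let ?B = "\<lambda>s. cholesky n (Y s)"
  let ?w = "\<lambda>s. ?B s *\<^sub>v y s"
  let ?g = "\<lambda>s. grad (Y s) *\<^sub>v ?w s"
  have B: "?B s \<in> carrier_mat n n" if "s \<in> D" for s
    using cholesky_factor_cholesky[OF D(1)[OF that]] by (simp add: cholesky_factor_def)
  have Gc: "grad (Y s) \<in> carrier_mat n n" if "s \<in> D" for s
    using G[OF D(1)[OF that]] by (simp add: symmetric_mats_def)
  have w: "?w s \<in> carrier_vec n" if "s \<in> D" for s
    using mult_mat_vec_carrier[OF B[OF that] D(2)[OF that]] .
  have g: "?g s \<in> carrier_vec n" if "s \<in> D" for s
    using mult_mat_vec_carrier[OF Gc[OF that] w[OF that]] .
  have 1: "flops_within D A (n * (2 * n)) (vec_entries n ?w)"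
    by (rule flops_within_mult_mat_vec[OF B D(2) A(2,4)])
  have "flops_within D (A \<union> vec_entries n ?w) (0 + q)
      ((\<lambda>q s. q (Y s, ?w s)) ` vec_entries n (\<lambda>(X, v). grad X *\<^sub>v v))"
    by (rule flops_within_subst[OF q[unfolded gradient_product_flops_def, THEN conjunct1]])
      (use D(1) w A in \<open>auto simp: image_Un vec_entries_comp mat_entries_comp inverse_entries_comp
        intro!: flops_within_inputs\<close>)
  then have 2: "flops_within D (A \<union> vec_entries n ?w) q (vec_entries n ?g)"
    by (simp add: vec_entries_comp)
  have 3: "flops_within D (A \<union> (vec_entries n ?w \<union> vec_entries n ?g)) (n * (2 * n))
      (vec_entries n (\<lambda>s. (?B s)\<^sup>T *\<^sub>v ?g s))"
    by (rule flops_within_transpose_mult_mat_vec) (use B g A in auto)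
  from flops_within_seq[OF flops_within_seq[OF 1 2] 3]
  have "flops_within D A (n * (2 * n) + q + n * (2 * n)) (vec_entries n (\<lambda>s. (?B s)\<^sup>T *\<^sub>v ?g s))"
    by (rule flops_within_mono) auto
  then have "flops_within D A (4 * n\<^sup>2 + q) (vec_entries n (\<lambda>s. (?B s)\<^sup>T *\<^sub>v ?g s))"
    by (rule flops_within_mono) (auto simp: power2_eq_square)
  then show ?thesis
  proof (rule flops_within_cong)
    fix q' assume "q' \<in> vec_entries n (\<lambda>s. pmat n grad (Y s) *\<^sub>v y s)"
    then obtain i where i: "i < n" "q' = (\<lambda>s. (pmat n grad (Y s) *\<^sub>v y s) $ i)"
      by (auto simp: vec_entries_def)
    have "pmat n grad (Y s) *\<^sub>v y s = (?B s)\<^sup>T *\<^sub>v ?g s" if "s \<in> D" for s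
      unfolding pmat_def using B[OF that] Gc[OF that] D(2)[OF that]
      by (simp add: assoc_mult_mat_vec[of _ n n _ n] assoc_mult_mat[of _ n n _ n _ n])
    then show "\<exists>q\<in>vec_entries n (\<lambda>s. (?B s)\<^sup>T *\<^sub>v ?g s). \<forall>s\<in>D. q' s = q s"
      using i(2) by (intro bexI[OF _ vec_entriesI[OF i(1)]]) auto
  qed
qed

text \<open>The term 11 n^2 consists of 2 flops for each suffix sum and 9 for each entry; the
  remaining term pays for the minors.\<close>

lemma flops_within_rank_one_factor:
  assumes D: "\<And>s. s \<in> D \<Longrightarrow> B s \<in> carrier_mat n n" "\<And>s. s \<in> D \<Longrightarrow> lower_triangular (B s)"
    "\<And>s. s \<in> D \<Longrightarrow> y s \<in> carrier_vec n"
    and A: "mat_entries (n, n) B \<subseteq> A" "\<alpha> \<in> A" "vec_entries n y \<subseteq> A"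
  shows "flops_within D A ((n + 1) * (2 * n + 2) + 11 * n\<^sup>2)
    (mat_entries (n, n) (\<lambda>s. B s * rank_one_factor (\<alpha> s) (y s) n))"
proof -
  define S where "S = (\<Union>j\<in>{..n}. {\<lambda>s. leading_minor (\<alpha> s) (y s) j})"
  \<comment> \<open>Suffix sums of the rows of B scaled by y, shared between the columns of the product.\<close>
  define Z where "Z = (\<lambda>b. (\<Union>a<n. {\<lambda>s. \<Sum>j\<in>{n - b..<n}. B s $$ (a, j) * y s $ j}))"
  have yA: "(\<lambda>s. y s $ i) \<in> A" if "i < n" for i using A(3) vec_entriesI[OF that] by blast
  have BA: "(\<lambda>s. B s $$ (i, j)) \<in> A" if "i < n" "j < n" for i j
    using A(1) mat_entriesI[OF that] by blast
  \<comment> \<open>Each of the n + 1 minors is computed from scratch; the total remains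
    quadratic.\<close>
  have "flops_within D A (card {..n} * (2 * n + 2)) S"
    unfolding S_def
  proof (rule flops_within_UN)
    fix j assume "j \<in> {..n}"
    then have "flops_within D A (Suc (0 + Suc (0 + 2 * j)))
        {\<lambda>s. 1 + \<alpha> s * (\<Sum>i<j. y s $ i * y s $ i)}"
      by (intro flops_within_add flops_within_const flops_within_mult flops_within_input A
          flops_within_dot yA) auto
    then have "flops_within D A (Suc (0 + Suc (0 + 2 * j))) {\<lambda>s. leading_minor (\<alpha> s) (y s) j}"
      by (simp add: leading_minor_def power2_eq_square)
    then show "flops_within D A (2 * n + 2) {\<lambda>s. leading_minor (\<alpha> s) (y s) j}"
      using \<open>j \<in> {..n}\<close> by (elim flops_within_mono) auto
  qed simp
  then have 1: "flops_within D A ((n + 1) * (2 * n + 2)) S" by simp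
  have 2: "flops_within D (A \<union> S) (0 + n * (n * 2)) (\<Union>b\<le>n. Z b)"
  proof (rule flops_within_iterate)
    show "flops_within D (A \<union> S) 0 (Z 0)"
      by (rule flops_within_inputs) (auto simp: Z_def)
    fix b assume b: "b < n"
    have "flops_within D (A \<union> S \<union> Z b) (card {..<n} * 2) (Z (Suc b))"
      unfolding Z_def[THEN fun_cong, of "Suc b"]
    proof (rule flops_within_UN)
      fix a assume "a \<in> {..<n}"
      then have a: "a < n" by simp
      let ?g = "\<lambda>s. B s $$ (a, n - Suc b) * y s $ (n - Suc b) + (\<Sum>j\<in>{n - b..<n}. B s $$ (a, j) * y s $ j)"
      have "flops_within D (A \<union> S \<union> Z b) (Suc (Suc (0 + 0) + 0)) {?g}"
        using b a BA[of a "n - Suc b"] yA[of "n - Suc b"]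
        by (intro flops_within_add flops_within_mult flops_within_input) (auto simp: Z_def)
      moreover have "{n - Suc b..<n} = insert (n - Suc b) {n - b..<n}" using b by auto
      then have "(\<lambda>s. \<Sum>j\<in>{n - Suc b..<n}. B s $$ (a, j) * y s $ j) = ?g" using b by auto
      ultimately show "flops_within D (A \<union> S \<union> Z b) 2 {\<lambda>s. \<Sum>j\<in>{n - Suc b..<n}. B s $$ (a, j) * y s $ j}"
        by (simp add: numeral_2_eq_2)
    qed simp
    then show "flops_within D (A \<union> S \<union> Z b) (n * 2) (Z (Suc b))" by simp
  qed
  let ?V = "A \<union> (S \<union> (\<Union>b\<le>n. Z b))"
  have 3: "flops_within D ?V (n * (n * 9)) (mat_entries (n, n) (\<lambda>s. B s * rank_one_factor (\<alpha> s) (y s) n))"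
  proof (rule flops_within_mat_entries)
    fix a b assume ab: "a < n" "b < n"
    show "flops_within D ?V 9 {\<lambda>s. (B s * rank_one_factor (\<alpha> s) (y s) n) $$ (a, b)}"
    proof (cases "a < b")
      case True
      show ?thesis
      proof (rule flops_within_cong_single)
        show "flops_within D ?V 9 {\<lambda>_. 0}"
          by (rule flops_within_mono[OF flops_within_const]) auto
      qed (use True D ab in \<open>auto simp: index_mult_rank_one_factor simp del: index_mult_mat(1)\<close>)
    next
      case False
      let ?s = "\<lambda>j s. leading_minor (\<alpha> s) (y s) j"
      let ?z = "\<lambda>s. \<Sum>j\<in>{Suc b..<n}. B s $$ (a, j) * y s $ j"
      have s: "?s b \<in> ?V" "?s (Suc b) \<in> ?V" using ab by (auto simp: S_def)
      \<comment> \<open>\<open>Z\<close> is indexed by the length of the suffix, so the one starting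
        at \<open>Suc b\<close> has index \<open>n - Suc b\<close>.\<close>
      have "?z \<in> Z (n - Suc b)" unfolding Z_def using ab by (auto simp: Suc_leI)
      moreover have "n - Suc b \<in> {..n}" by simp
      ultimately have z: "?z \<in> ?V" by (intro UnI2 UN_I)
      \<comment> \<open>The nested successors mirror the expression tree: three flops for the first
        product, five for the second, one for the sum.\<close>
      have "flops_within D ?V (Suc (Suc (0 + Suc (Suc (0 + 0))) + Suc (Suc (Suc (0 + 0) + Suc (Suc (0 + 0))) + 0)))
        {\<lambda>s. B s $$ (a, b) * sqrt (?s (Suc b) s / ?s b s) + \<alpha> s * y s $ b / sqrt (?s b s * ?s (Suc b) s) * ?z s}"
        by (intro flops_within_add flops_within_mult flops_within_sqrt flops_within_divide flops_within_input
            s z UnI1[OF A(2)] UnI1[OF yA[OF ab(2)]] UnI1[OF BA[OF ab]])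
      then have "flops_within D ?V 9 {\<lambda>s. B s $$ (a, b) * sqrt (?s (Suc b) s / ?s b s) +
          \<alpha> s * y s $ b / sqrt (?s b s * ?s (Suc b) s) * ?z s}"
        by (rule flops_within_mono) auto
      then show ?thesis
        by (rule flops_within_cong_single)
          (use False D ab in \<open>auto simp: index_mult_rank_one_factor simp del: index_mult_mat(1)\<close>)
    qed
  qed
  from flops_within_seq[OF flops_within_seq[OF 1 2] 3] show ?thesis
    by (rule flops_within_mono) (auto simp: power2_eq_square)
qed

text \<open>One unit \<open>4 * n\<^sup>2 + q + 3 * n + 2\<close> is a product with P followed by a
  normalisation, hence r units for the power iteration. All other stages together cost 22 n^2 + 2 q
  + 9 n + 7, which six units cover; the leading n pays for the draws.\<close>

theorem iteration_flops_bound: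
  assumes G: "\<And>X. X \<in> spd n \<Longrightarrow> grad X \<in> symmetric_mats n"
    and q: "gradient_product_flops n R grad q"
  shows "iteration_flops n R grad r \<beta> (n + (r + 6) * (4 * n\<^sup>2 + q + 3 * n + 2))"
proof -
  define D where "D = spd n \<times> (carrier_vec n :: real vec set)"
  define B where "B = (\<lambda>s :: real mat \<times> real vec. cholesky n (fst s))"
  define Y where "Y = (\<lambda>i (s :: real mat \<times> real vec). power_iterate n grad (fst s) (snd s) i)"
  define Py where "Py = (\<lambda>s. pmat n grad (fst s) *\<^sub>v Y r s)"
  define ray where "ray = (\<lambda>s :: real mat \<times> real vec. rayleigh n grad r (fst s) (snd s))"
  define \<alpha> where "\<alpha> = (\<lambda>s. exp (- ray s * \<beta>) - 1)"
  define w where "w = (\<lambda>s. B s *\<^sub>v Y r s)"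
  define N where "N = (\<lambda>s :: real mat \<times> real vec. r1rsd_step n grad r \<beta> (fst s) (snd s))"
  define A where "A = mat_entries (n, n) (fst :: real mat \<times> real vec \<Rightarrow> _) \<union> mat_entries (n, n) B \<union>
      inverse_entries n R fst \<union> vec_entries n snd"
  define c where "c = 4 * n\<^sup>2 + q"
  have Dspd: "fst s \<in> spd n" and Dvec: "snd s \<in> carrier_vec n" if "s \<in> D" for s
    using that by (auto simp: D_def)
  have Bf: "cholesky_factor n (fst s) (B s)" if "s \<in> D" for s
    unfolding B_def by (rule cholesky_factor_cholesky[OF Dspd[OF that]])
  have Bc: "B s \<in> carrier_mat n n" and Bl: "lower_triangular (B s)" if "s \<in> D" for s
    using Bf[OF that] by (auto simp: cholesky_factor_def)
  have Yc: "Y i s \<in> carrier_vec n" if "s \<in> D" for s i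
    unfolding Y_def by (rule power_iterate_carrier[where grad=grad, OF Dspd[OF that] G[OF Dspd[OF that]] Dvec[OF that]])
  have Pc: "pmat n grad (fst s) \<in> carrier_mat n n" if "s \<in> D" for s
    using pmat_symmetric[where grad=grad, OF Dspd[OF that] G[OF Dspd[OF that]]] by (simp add: symmetric_mats_def)
  \<comment> \<open>Pulling B into the outer product gives the form w w^T expected by the granted
    update of the inverses, and three flops per entry of the new iterate.\<close>
  have Nw: "N s = fst s + \<alpha> s \<cdot>\<^sub>m outer_prod (w s) (w s)" if "s \<in> D" for s
    using mult_outer_prod[OF Bc Yc, OF that that]
    by (simp add: N_def r1rsd_step_def Let_def \<alpha>_def ray_def w_def B_def Y_def)
  have Nf: "cholesky_factor n (N s) (B s * rank_one_factor (\<alpha> s) (Y r s) n)" if "s \<in> D" for s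
    using r1rsd_step_cholesky_factor[where grad=grad, OF Dspd[OF that] G[OF Dspd[OF that]] Dvec[OF that]]
    by (simp add: N_def \<alpha>_def ray_def B_def Y_def)
  have pm: "flops_within D V c (vec_entries n (\<lambda>s. pmat n grad (fst s) *\<^sub>v y s))"
    if "A \<subseteq> V" "vec_entries n y \<subseteq> V" "\<And>s. s \<in> D \<Longrightarrow> y s \<in> carrier_vec n" for V y
    unfolding c_def by (rule flops_within_pmat_mult[OF G q Dspd])
      (use that in \<open>auto simp: A_def B_def\<close>)
  define Q1 where "Q1 = (\<Union>i\<le>r. vec_entries n (Y i))"
  have 1: "flops_within D A (3 * n + 2 + r * (c + (3 * n + 2))) Q1"
    unfolding Q1_def
  proof (rule flops_within_iterate)
    show "flops_within D A (3 * n + 2) (vec_entries n (Y 0))"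
      unfolding Y_def power_iterate.simps
      by (rule flops_within_normalize_vec) (auto simp: A_def Dvec)
    fix i
    let ?V = "A \<union> vec_entries n (Y i)"
    let ?p = "\<lambda>s. pmat n grad (fst s) *\<^sub>v Y i s"
    have "flops_within D (?V \<union> vec_entries n ?p) (3 * n + 2) (vec_entries n (Y (Suc i)))"
      unfolding Y_def power_iterate.simps
      by (rule flops_within_normalize_vec)
        (use mult_mat_vec_carrier[OF Pc Yc] in \<open>auto simp: Y_def\<close>)
    moreover have "flops_within D ?V c (vec_entries n ?p)"
      by (rule pm) (use Yc in auto)
    ultimately have "flops_within D ?V (c + (3 * n + 2)) (vec_entries n ?p \<union> vec_entries n (Y (Suc i)))"
      by (rule flops_within_seq[rotated])
    then show "flops_within D ?V (c + (3 * n + 2)) (vec_entries n (Y (Suc i)))"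
      by (rule flops_within_mono) auto
  qed
  have Q1: "vec_entries n (Y r) \<subseteq> Q1" unfolding Q1_def by blast
  define Q2 where "Q2 = Q1 \<union> vec_entries n Py"
  have 2: "flops_within D A (3 * n + 2 + r * (c + (3 * n + 2)) + c) Q2"
    unfolding Q2_def Py_def using Q1 Yc by (intro flops_within_seq[OF 1] pm) auto
  define Q3 where "Q3 = Q2 \<union> {ray}"
  have ray: "ray = (\<lambda>s. Y r s \<bullet> Py s)" by (simp add: ray_def rayleigh_def Y_def Py_def Let_def)
  have 3: "flops_within D A (3 * n + 2 + r * (c + (3 * n + 2)) + c + 2 * n) Q3"
    unfolding Q3_def ray
    by (rule flops_within_seq[OF 2], rule flops_within_scalar_prod)
      (use mult_mat_vec_carrier[OF Pc Yc] Q1 in \<open>auto simp: Q2_def Py_def\<close>)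
  define Q4 where "Q4 = Q3 \<union> {\<alpha>}"
  have 4: "flops_within D A (3 * n + 2 + r * (c + (3 * n + 2)) + c + 2 * n + 3) Q4"
    unfolding Q4_def
  proof (rule flops_within_seq[OF 3])
    \<comment> \<open>The sign sits on the constant \<beta>, so a product, an exponential and a
      difference suffice.\<close>
    have "flops_within D (A \<union> Q3) (Suc (Suc (Suc (0 + 0)) + 0)) {\<lambda>s. exp (ray s * (- \<beta>)) - 1}"
      by (intro flops_within_diff flops_within_exp flops_within_mult flops_within_const flops_within_input)
        (simp add: Q3_def)
    then show "flops_within D (A \<union> Q3) 3 {\<alpha>}" by (simp add: \<alpha>_def numeral_3_eq_3)
  qed
  define Q5 where "Q5 = Q4 \<union> vec_entries n w"
  have 5: "flops_within D A (3 * n + 2 + r * (c + (3 * n + 2)) + c + 2 * n + 3 + n * (2 * n)) Q5"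
    unfolding Q5_def w_def
    by (rule flops_within_seq[OF 4], rule flops_within_mult_mat_vec)
      (use Bc Yc Q1 in \<open>auto simp: A_def Q4_def Q3_def Q2_def\<close>)
  define Q6 where "Q6 = Q5 \<union> mat_entries (n, n) N"
  have 6: "flops_within D A (3 * n + 2 + r * (c + (3 * n + 2)) + c + 2 * n + 3 + n * (2 * n) + n * (n * 3)) Q6"
    unfolding Q6_def
  proof (rule flops_within_seq[OF 5], rule flops_within_mat_entries)
    fix i j assume ij: "i < n" "j < n"
    have wQ: "(\<lambda>s. w s $ k) \<in> Q5" if "k < n" for k
      using vec_entriesI[OF that, of w] by (simp add: Q5_def)
    have "flops_within D (A \<union> Q5) (Suc (0 + Suc (0 + Suc (0 + 0))))
        {\<lambda>s. fst s $$ (i, j) + \<alpha> s * (w s $ i * w s $ j)}"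
      by (intro flops_within_add flops_within_mult flops_within_input)
        (use wQ ij mat_entriesI[OF ij, of fst] in \<open>auto simp: A_def Q5_def Q4_def\<close>)
    then have "flops_within D (A \<union> Q5) 3 {\<lambda>s. fst s $$ (i, j) + \<alpha> s * (w s $ i * w s $ j)}"
      by (simp add: numeral_eq_Suc)
    then show "flops_within D (A \<union> Q5) 3 {\<lambda>s. N s $$ (i, j)}"
    proof (rule flops_within_cong_single)
      fix s assume s: "s \<in> D"
      then have "w s \<in> carrier_vec n"
        unfolding w_def by (intro mult_mat_vec_carrier[OF Bc Yc])
      then show "N s $$ (i, j) = fst s $$ (i, j) + \<alpha> s * (w s $ i * w s $ j)"
        using Nw[OF s] ij by (simp add: outer_prod_def)
    qed
  qed
  define Q7 where "Q7 = Q6 \<union> inverse_entries n R N"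
  have 7: "flops_within D A (3 * n + 2 + r * (c + (3 * n + 2)) + c + 2 * n + 3 + n * (2 * n) + n * (n * 3) + q) Q7"
    unfolding Q7_def
  proof (rule flops_within_seq[OF 6])
    let ?h = "\<lambda>s. (fst s, \<alpha> s, w s)"
    let ?D2 = "{(X, \<alpha>, w). X \<in> spd n \<and> w \<in> carrier_vec n \<and> X + \<alpha> \<cdot>\<^sub>m outer_prod w w \<in> spd n}"
    have "flops_within D (A \<union> Q6) (0 + q)
      ((\<lambda>q s. q (?h s)) ` inverse_entries n R (\<lambda>(X, \<alpha>, w). X + \<alpha> \<cdot>\<^sub>m outer_prod w w))"
    proof (rule flops_within_subst[OF q[unfolded gradient_product_flops_def, THEN conjunct2]])
      fix s assume s: "s \<in> D"
      \<comment> \<open>The granted update requires the new matrix to be positive definite, which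
        its explicit Cholesky factor certifies.\<close>
      show "?h s \<in> ?D2"
        using Dspd[OF s] Bc[OF s] Yc[OF s] cholesky_factor_spd[OF Nf[OF s]] Nw[OF s]
        mult_mat_vec_carrier[OF Bc Yc, OF s s] by (auto simp: w_def)
    qed (auto simp: image_Un vec_entries_comp mat_entries_comp inverse_entries_comp A_def Q6_def Q5_def Q4_def
        intro!: flops_within_inputs)
    then have "flops_within D (A \<union> Q6) q (inverse_entries n R (\<lambda>s. fst s + \<alpha> s \<cdot>\<^sub>m outer_prod (w s) (w s)))"
      by (simp add: inverse_entries_comp)
    then show "flops_within D (A \<union> Q6) q (inverse_entries n R N)"
    proof (rule flops_within_cong)
      fix q' assume "q' \<in> inverse_entries n R N"
      then obtain e i j where e: "e \<in> inverse_ops R" "i < fst (mdims n e)" "j < snd (mdims n e)"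
        "q' = (\<lambda>s. meval (N s) e $$ (i, j))"
        by (auto simp: inverse_entries_def mat_entries_def)
      show "\<exists>q\<in>inverse_entries n R (\<lambda>s. fst s + \<alpha> s \<cdot>\<^sub>m outer_prod (w s) (w s)). \<forall>s\<in>D. q' s = q s"
        by (rule bexI[of _ "\<lambda>s. meval (fst s + \<alpha> s \<cdot>\<^sub>m outer_prod (w s) (w s)) e $$ (i, j)"])
          (use e Nw in \<open>auto simp: inverse_entries_def mat_entries_def\<close>)
    qed
  qed
  define Q8 where "Q8 = Q7 \<union> mat_entries (n, n) (\<lambda>s. B s * rank_one_factor (\<alpha> s) (Y r s) n)"
  have 8: "flops_within D A (3 * n + 2 + r * (c + (3 * n + 2)) + c + 2 * n + 3 + n * (2 * n) + n * (n * 3) + q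
      + ((n + 1) * (2 * n + 2) + 11 * n\<^sup>2)) Q8"
    unfolding Q8_def
    by (rule flops_within_seq[OF 7], rule flops_within_rank_one_factor[OF Bc Bl Yc])
      (use Q1 in \<open>auto simp: A_def Q7_def Q6_def Q5_def Q4_def Q3_def Q2_def\<close>)
  have fin: "flops_within D A ((r + 6) * (4 * n\<^sup>2 + q + 3 * n + 2))
    (Q1 \<union> {ray} \<union> mat_entries (n, n) N \<union> mat_entries (n, n) (\<lambda>s. cholesky n (N s)) \<union> inverse_entries n R N)"
  proof (rule flops_within_cong[OF flops_within_mono[OF 8 _ order_refl]])
    show "3 * n + 2 + r * (c + (3 * n + 2)) + c + 2 * n + 3 + n * (2 * n) + n * (n * 3) + q
      + ((n + 1) * (2 * n + 2) + 11 * n\<^sup>2) \<le> (r + 6) * (4 * n\<^sup>2 + q + 3 * n + 2)"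
      by (simp add: c_def algebra_simps power2_eq_square)
    fix q' assume "q' \<in> Q1 \<union> {ray} \<union> mat_entries (n, n) N \<union> mat_entries (n, n) (\<lambda>s. cholesky n (N s)) \<union>
      inverse_entries n R N"
    then consider "q' \<in> Q8" | "q' \<in> mat_entries (n, n) (\<lambda>s. cholesky n (N s))"
      by (auto simp: Q8_def Q7_def Q6_def Q5_def Q4_def Q3_def Q2_def)
    then show "\<exists>q\<in>Q8. \<forall>s\<in>D. q' s = q s"
    proof cases
      case 2
      then obtain i j where ij: "i < n" "j < n" "q' = (\<lambda>s. cholesky n (N s) $$ (i, j))"
        by (auto simp: mat_entries_def)
      show ?thesis
        by (rule bexI[of _ "\<lambda>s. (B s * rank_one_factor (\<alpha> s) (Y r s) n) $$ (i, j)"])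
          (use ij cholesky_eqI[OF Nf] in \<open>auto simp: Q8_def mat_entries_def\<close>)
    qed auto
  qed
  show ?thesis unfolding iteration_flops_def
    using fin unfolding case_prod_beta' Q1_def ray_def N_def Y_def D_def A_def B_def
    by (intro exI[of _ "(r + 6) * (4 * n\<^sup>2 + q + 3 * n + 2)"]) simp
qed

section \<open>Gaussian vectors\<close>

abbreviation std_normal :: "real measure" where
  "std_normal \<equiv> density lborel (\<lambda>x. ennreal (std_normal_density x))"

abbreviation gaussian_vector :: "nat \<Rightarrow> (nat \<Rightarrow> real) measure" where
  "gaussian_vector n \<equiv> \<Pi>\<^sub>M i\<in>{..<n}. std_normal"

lemma prob_space_std_normal: "prob_space std_normal"
  by (rule prob_space_normal_density) simp

lemma prob_space_gaussian_vector: "prob_space (gaussian_vector n)"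
  by (intro prob_space_PiM prob_space_std_normal)

lemma prob_space_gaussian_draws: "prob_space (gaussian_draws n T)"
  unfolding gaussian_draws_def by (intro prob_space_PiM prob_space_std_normal)

lemma gaussian_coordinate_distributed:
  assumes "i < n"
  shows "distributed (gaussian_vector n) lborel (\<lambda>x. x i) std_normal_density"
  unfolding distributed_def
proof (intro conjI)
  have "distr (gaussian_vector n) std_normal (\<lambda>x. x i) = std_normal"
    using assms by (intro distr_PiM_component prob_space_std_normal) auto
  then show "distr (gaussian_vector n) lborel (\<lambda>x. x i) = density lborel (\<lambda>x. ennreal (std_normal_density x))"
    by (subst distr_cong[OF refl, of _ std_normal]) auto
  have "(\<lambda>x. x i) \<in> measurable (gaussian_vector n) std_normal"
    using assms by (intro measurable_component_singleton) auto
  then show "(\<lambda>x. x i) \<in> measurable (gaussian_vector n) lborel" by simp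
qed auto

text \<open>Independence means that the joint law is the product of the marginals, and here both are
  \<open>gaussian_vector n\<close>. Restricting to \<open>{..<n}\<close> changes nothing on a space
  of extensional functions.\<close>

lemma gaussian_coordinates_indep:
  assumes "n > 0"
  shows "prob_space.indep_vars (gaussian_vector n) (\<lambda>_. std_normal) (\<lambda>i x. x i) {..<n}"
proof -
  interpret prob_space "gaussian_vector n" by (rule prob_space_gaussian_vector)
  have "distr (gaussian_vector n) (gaussian_vector n) (\<lambda>x. \<lambda>i\<in>{..<n}. x i) = gaussian_vector n"
    by (subst distr_cong[OF refl refl, where g = "\<lambda>x. x"])
      (auto simp: space_PiM PiE_def extensional_restrict distr_id)
  moreover have "(\<Pi>\<^sub>M i\<in>{..<n}. distr (gaussian_vector n) std_normal (\<lambda>x. x i)) = gaussian_vector n"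
    by (intro PiM_cong refl distr_PiM_component prob_space_std_normal) auto
  ultimately show ?thesis
    using assms by (subst indep_vars_iff_distr_eq_PiM') auto
qed

text \<open>\<open>sum_indep_normal\<close> asks for positive standard deviations, so coordinates
  with v i = 0 are dropped first; the normalisation of v guarantees that some remain.\<close>

lemma gaussian_linear_form_distributed:
  fixes v :: "nat \<Rightarrow> real"
  assumes "(\<Sum>i<n. (v i)\<^sup>2) = 1"
  shows "distributed (gaussian_vector n) lborel (\<lambda>x. \<Sum>i<n. v i * x i) std_normal_density"
proof -
  interpret prob_space "gaussian_vector n" by (rule prob_space_gaussian_vector)
  define I where "I = {i. i < n \<and> v i \<noteq> 0}"
  have fin: "finite I" by (simp add: I_def)
  have sumI: "(\<Sum>i\<in>I. g i) = (\<Sum>i<n. g i)" if "\<And>i. v i = 0 \<Longrightarrow> g i = 0" for g :: "nat \<Rightarrow> real"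
    using that by (intro sum.mono_neutral_left) (auto simp: I_def)
  have "(\<Sum>i\<in>I. (v i)\<^sup>2) = 1" using assms by (subst sumI) auto
  then have I: "I \<noteq> {}" by auto
  then have "n > 0" by (auto simp: I_def)
  have "indep_vars (\<lambda>i. borel) (\<lambda>i x. v i * x i) {..<n}"
    by (rule indep_vars_compose2[OF gaussian_coordinates_indep[OF \<open>n > 0\<close>]]) simp
  then have indep: "indep_vars (\<lambda>i. borel) (\<lambda>i x. v i * x i) I"
    by (rule indep_vars_subset) (auto simp: I_def)
  have "distributed (gaussian_vector n) lborel (\<lambda>x. \<Sum>i\<in>I. v i * x i)
      (normal_density (\<Sum>i\<in>I. 0) (sqrt (\<Sum>i\<in>I. \<bar>v i\<bar>\<^sup>2)))"
  proof (rule sum_indep_normal[OF fin I indep])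
    fix i assume "i \<in> I"
    then have i: "i < n" "v i \<noteq> 0" by (auto simp: I_def)
    then show "0 < \<bar>v i\<bar>" by simp
    show "distributed (gaussian_vector n) lborel (\<lambda>x. v i * x i) (normal_density 0 \<bar>v i\<bar>)"
      using normal_density_affine[OF gaussian_coordinate_distributed[OF i(1)], of "v i" 0] i(2) by simp
  qed
  moreover have "(\<lambda>x. \<Sum>i\<in>I. v i * x i) = (\<lambda>x. \<Sum>i<n. v i * x i)"
    by (intro ext sumI) auto
  ultimately show ?thesis using \<open>(\<Sum>i\<in>I. (v i)\<^sup>2) = 1\<close> by simp
qed

lemma std_normal_density_le_half: "std_normal_density x \<le> 1 / 2"
proof -
  have "std_normal_density x = 1 / sqrt (2 * pi) * exp (- x\<^sup>2 / 2)" by (simp add: normal_density_def)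
  also have "\<dots> \<le> 1 / sqrt (2 * pi) * 1" by (intro mult_left_mono) auto
  also have "\<dots> \<le> 1 / 2"
  proof -
    have "2 \<le> sqrt (2 * pi)" using pi_ge_two by (intro real_le_rsqrt) simp
    then show ?thesis by (simp add: field_simps)
  qed
  finally show ?thesis .
qed

text \<open>A density of at most 1/2 on an interval of length 1/2 gives the bound without evaluating
  a Gaussian integral.\<close>

lemma gaussian_linear_form_small:
  fixes v :: "nat \<Rightarrow> real"
  assumes "(\<Sum>i<n. (v i)\<^sup>2) = 1"
  shows "emeasure (gaussian_vector n) {x \<in> space (gaussian_vector n). \<bar>\<Sum>i<n. v i * x i\<bar> \<le> 1 / 4} \<le> ennreal (1 / 4)"
proof -
  have "emeasure (gaussian_vector n) ((\<lambda>x. \<Sum>i<n. v i * x i) -` {- 1/4..1/4} \<inter> space (gaussian_vector n)) =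
      (\<integral>\<^sup>+x. ennreal (std_normal_density x) * indicator {- 1/4..1/4} x \<partial>lborel)"
    by (rule distributed_emeasure[OF gaussian_linear_form_distributed[OF assms]]) simp
  also have "\<dots> \<le> (\<integral>\<^sup>+x. ennreal (1 / 2) * indicator {- 1/4..1/4} (x :: real) \<partial>lborel)"
    by (intro nn_integral_mono mult_right_mono ennreal_leI std_normal_density_le_half) auto
  also have "\<dots> = ennreal (1 / 2) * ennreal (1 / 2)"
    by (subst nn_integral_cmult_indicator) auto
  also have "\<dots> = ennreal (1 / 4)" by (subst ennreal_mult[symmetric]) auto
  also have "(\<lambda>x. \<Sum>i<n. v i * x i) -` {- 1/4..1/4} \<inter> space (gaussian_vector n) =
      {x \<in> space (gaussian_vector n). \<bar>\<Sum>i<n. v i * x i\<bar> \<le> 1 / 4}" by (auto simp: abs_le_iff)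
  finally show ?thesis .
qed

text \<open>Markov's inequality: the squared norm has mean n, and the threshold is four times as
  large.\<close>

lemma gaussian_norm_large:
  assumes "n > 0"
  shows "emeasure (gaussian_vector n) {x \<in> space (gaussian_vector n). 4 * real n \<le> (\<Sum>i<n. (x i)\<^sup>2)} \<le> ennreal (1 / 4)"
proof -
  let ?M = "gaussian_vector n"
  have meas [measurable]: "(\<lambda>x. x i) \<in> borel_measurable ?M" if "i < n" for i
    using distributed_measurable[OF gaussian_coordinate_distributed[OF that]] by simp
  have 1: "(\<integral>\<^sup>+x. ennreal ((x i)\<^sup>2) \<partial>?M) = 1" if "i < n" for i
  proof -
    have "(\<integral>\<^sup>+x. ennreal ((x i)\<^sup>2) \<partial>?M) = (\<integral>\<^sup>+x. ennreal (std_normal_density x) * ennreal (x\<^sup>2) \<partial>lborel)"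
      by (rule distributed_nn_integral[OF gaussian_coordinate_distributed[OF that], symmetric]) auto
    also have "\<dots> = (\<integral>\<^sup>+x. ennreal (std_normal_density x * x\<^sup>2) \<partial>lborel)"
      by (simp add: ennreal_mult normal_density_nonneg)
    \<comment> \<open>The even moment formula at k = 1 gives 2! / (2 * 1!) = 1.\<close>
    also have "\<dots> = ennreal 1"
      using std_normal_moment_even[of 1]
      by (intro nn_integral_eq_integral[THEN trans]) (auto simp: has_bochner_integral_iff normal_density_nonneg)
    finally show ?thesis by simp
  qed
  have "emeasure ?M {x \<in> space ?M. 1 \<le> ennreal (1 / (4 * real n)) * ennreal (\<Sum>i<n. (x i)\<^sup>2)} \<le>
      ennreal (1 / (4 * real n)) * (\<integral>\<^sup>+x. ennreal (\<Sum>i<n. (x i)\<^sup>2) * indicator (space ?M) x \<partial>?M)"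
    by (rule nn_integral_Markov_inequality) (auto intro!: borel_measurable_times)
  also have "(\<integral>\<^sup>+x. ennreal (\<Sum>i<n. (x i)\<^sup>2) * indicator (space ?M) x \<partial>?M) = (\<integral>\<^sup>+x. (\<Sum>i<n. ennreal ((x i)\<^sup>2)) \<partial>?M)"
    by (intro nn_integral_cong) (simp add: sum_ennreal)
  also have "\<dots> = (\<Sum>i<n. \<integral>\<^sup>+x. ennreal ((x i)\<^sup>2) \<partial>?M)" by (intro nn_integral_sum) auto
  also have "\<dots> = (\<Sum>i<n. 1)" using 1 by (intro sum.cong) auto
  also have "ennreal (1 / (4 * real n)) * \<dots> = ennreal (1 / 4)"
    using assms by (simp add: ennreal_of_nat_eq_real_of_nat flip: ennreal_mult)
  also have "{x \<in> space ?M. 1 \<le> ennreal (1 / (4 * real n)) * ennreal (\<Sum>i<n. (x i)\<^sup>2)} =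
      {x \<in> space ?M. 4 * real n \<le> (\<Sum>i<n. (x i)\<^sup>2)}"
    using assms by (auto simp: ennreal_mult'[symmetric] sum_nonneg field_simps simp flip: ennreal_1)
  finally show ?thesis .
qed

lemma gaussian_power_iteration_start:
  fixes v :: "nat \<Rightarrow> real"
  assumes "(\<Sum>i<n. (v i)\<^sup>2) = 1" "n > 0"
  defines "S \<equiv> {x \<in> space (gaussian_vector n). 1 / 4 < \<bar>\<Sum>i<n. v i * x i\<bar> \<and> (\<Sum>i<n. (x i)\<^sup>2) < 4 * real n}"
  shows "S \<in> sets (gaussian_vector n)" "ennreal (1 / 2) \<le> emeasure (gaussian_vector n) S"
proof -
  let ?M = "gaussian_vector n"
  interpret prob_space ?M by (rule prob_space_gaussian_vector)
  let ?E = "{x \<in> space ?M. \<bar>\<Sum>i<n. v i * x i\<bar> \<le> 1 / 4}"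
  let ?F = "{x \<in> space ?M. 4 * real n \<le> (\<Sum>i<n. (x i)\<^sup>2)}"
  have [measurable]: "(\<lambda>x. x i) \<in> borel_measurable ?M" if "i < n" for i
    using distributed_measurable[OF gaussian_coordinate_distributed[OF that]] by simp
  have l: "(\<lambda>x. \<Sum>i<n. v i * x i) \<in> borel_measurable ?M" by (intro borel_measurable_sum borel_measurable_times) auto
  have q: "(\<lambda>x. \<Sum>i<n. (x i)\<^sup>2) \<in> borel_measurable ?M" by (intro borel_measurable_sum borel_measurable_power) auto
  have E: "?E \<in> sets ?M" using l by measurable
  have F: "?F \<in> sets ?M" using q by measurable
  have S: "S = space ?M - (?E \<union> ?F)" by (auto simp: S_def)
  show "S \<in> sets ?M" unfolding S using E F by auto
  have "measure ?M ?E \<le> 1 / 4" "measure ?M ?F \<le> 1 / 4"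
    using gaussian_linear_form_small[OF assms(1)] gaussian_norm_large[OF assms(2)]
    by (auto simp: emeasure_eq_measure)
  moreover have "measure ?M (?E \<union> ?F) \<le> measure ?M ?E + measure ?M ?F"
    using E F by (rule measure_Un_le)
  ultimately have "1 / 2 \<le> measure ?M S"
    unfolding S using E F by (subst prob_compl) auto
  then show "ennreal (1 / 2) \<le> emeasure ?M S"
    unfolding emeasure_eq_measure by (rule ennreal_leI)
qed

text \<open>The integrand is nonnegative, so only the event \<open>S\<close> is kept; there it is
  bounded below by a constant, and \<open>S\<close> has probability at least 1/2.\<close>

lemma expected_rayleigh_lower_bound:
  assumes X: "X \<in> spd n" and G: "grad X \<in> symmetric_mats n" and gap: "spectral_gap n \<rho> grad"
    and n: "n \<ge> 2" and \<rho>: "\<rho> \<le> 1" and r: "\<rho> ^ (2 * r) * (128 * real n) \<le> 1"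
  shows "ennreal (rinner X (rgrad grad X) (rgrad grad X) / (18 * real n)) \<le>
    (\<integral>\<^sup>+u. ennreal ((rayleigh n grad r X (vec n u))\<^sup>2) \<partial>gaussian_vector n)"
proof -
  let ?g = "rinner X (rgrad grad X) (rgrad grad X)"
  obtain v where v: "v \<in> carrier_vec n" "v \<bullet> v = 1"
    "\<And>u. u \<in> carrier_vec n \<Longrightarrow> (v \<bullet> u)\<^sup>2 \<ge> 1 / 16 \<Longrightarrow> u \<bullet> u \<le> 4 * real n \<Longrightarrow>
      ?g \<le> 9 * real n * (rayleigh n grad r X u)\<^sup>2"
    using power_iteration_estimate[where grad=grad, OF X G gap n \<rho> r] by blast
  have v1: "(\<Sum>i<n. (v $ i)\<^sup>2) = 1" using scalar_prod_self[OF v(1)] v(2) by simp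
  define S where "S = {x \<in> space (gaussian_vector n). 1 / 4 < \<bar>\<Sum>i<n. v $ i * x i\<bar> \<and> (\<Sum>i<n. (x i)\<^sup>2) < 4 * real n}"
  have S: "S \<in> sets (gaussian_vector n)" "ennreal (1 / 2) \<le> emeasure (gaussian_vector n) S"
    using gaussian_power_iteration_start[OF v1] n unfolding S_def by auto
  have g: "?g \<ge> 0" using rinner_rgrad_nonneg[where grad=grad, OF X G] .
  have "ennreal (?g / (18 * real n)) = ennreal (?g / (9 * real n)) * ennreal (1 / 2)"
    using g by (subst ennreal_mult[symmetric]) auto
  also have "\<dots> \<le> ennreal (?g / (9 * real n)) * emeasure (gaussian_vector n) S"
    by (intro mult_left_mono S) auto
  also have "\<dots> = (\<integral>\<^sup>+u. ennreal (?g / (9 * real n)) * indicator S u \<partial>gaussian_vector n)"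
    using S(1) by (rule nn_integral_cmult_indicator[symmetric])
  also have "\<dots> \<le> (\<integral>\<^sup>+u. ennreal ((rayleigh n grad r X (vec n u))\<^sup>2) \<partial>gaussian_vector n)"
  proof (rule nn_integral_mono)
    fix x :: "nat \<Rightarrow> real"
    show "ennreal (?g / (9 * real n)) * indicator S x \<le> ennreal ((rayleigh n grad r X (vec n x))\<^sup>2)"
    proof (cases "x \<in> S")
      case True
      then have "\<bar>1 / 4\<bar> \<le> \<bar>v \<bullet> vec n x\<bar>" "vec n x \<bullet> vec n x \<le> 4 * real n"
        by (auto simp: S_def scalar_prod_sum[of _ n] power2_eq_square)
      then have "(1 / 4)\<^sup>2 \<le> (v \<bullet> vec n x)\<^sup>2" "vec n x \<bullet> vec n x \<le> 4 * real n"
        by (auto simp only: abs_le_square_iff)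
      then have "?g \<le> 9 * real n * (rayleigh n grad r X (vec n x))\<^sup>2"
        by (intro v(3)) (auto simp: power2_eq_square)
      then show ?thesis using True n by (auto intro!: ennreal_leI simp: field_simps)
    qed simp
  qed
  finally show ?thesis .
qed

section \<open>The iterates as random matrices\<close>

context
  fixes n :: nat and R :: mexpr and grad :: "real mat \<Rightarrow> real mat" and X0 :: "real mat"
    and q r :: nat and \<beta> :: "nat \<Rightarrow> real"
  assumes G: "\<And>X. X \<in> spd n \<Longrightarrow> grad X \<in> symmetric_mats n"
    and X0: "X0 \<in> spd n"
    and q: "gradient_product_flops n R grad q"
begin

abbreviation iterate :: "nat \<Rightarrow> (nat \<Rightarrow> nat \<Rightarrow> real) \<Rightarrow> real mat" where
  "iterate t \<omega> \<equiv> r1rsd n grad r \<beta> X0 \<omega> t"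

abbreviation iterate_rayleigh :: "nat \<Rightarrow> (nat \<Rightarrow> nat \<Rightarrow> real) \<Rightarrow> real" where
  "iterate_rayleigh t \<omega> \<equiv> rayleigh n grad r (iterate t \<omega>) (vec n (\<omega> t))"

abbreviation sq_grad_norm :: "nat \<Rightarrow> (nat \<Rightarrow> nat \<Rightarrow> real) \<Rightarrow> real" where
  "sq_grad_norm t \<omega> \<equiv> rinner (iterate t \<omega>) (rgrad grad (iterate t \<omega>)) (rgrad grad (iterate t \<omega>))"

lemma iterate_spd: "iterate t \<omega> \<in> spd n"
  by (induction t) (auto intro!: X0 r1rsd_step_spd[where grad=grad] G)

text \<open>Adaptedness: an iterate is unaffected by its own draw and by all later ones, so draw t
  can be integrated out with iterate t held fixed.\<close>

lemma iterate_past: "(\<And>s. s < t \<Longrightarrow> \<omega> s = \<omega>' s) \<Longrightarrow> iterate t \<omega> = iterate t \<omega>'"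
  by (induction t) auto

lemma sq_grad_norm_nonneg: "sq_grad_norm t \<omega> \<ge> 0"
  using rinner_rgrad_nonneg[where grad=grad, OF iterate_spd G[OF iterate_spd]] .

section \<open>Measurability of the iterates and their gradient norms\<close>

lemma draw_measurable:
  assumes "t < T" "i < n"
  shows "(\<lambda>\<omega>. \<omega> t i) \<in> borel_measurable (gaussian_draws n T)"
proof -
  have "(\<lambda>\<omega>. \<omega> t) \<in> measurable (gaussian_draws n T) (gaussian_vector n)"
    unfolding gaussian_draws_def using assms(1) by (intro measurable_component_singleton) auto
  moreover have "(\<lambda>x. x i) \<in> measurable (gaussian_vector n) std_normal"
    using assms(2) by (intro measurable_component_singleton) auto
  ultimately have "(\<lambda>\<omega>. \<omega> t i) \<in> measurable (gaussian_draws n T) std_normal"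
    by (rule measurable_compose)
  then show ?thesis by simp
qed

text \<open>Measurability comes from the flop count: what a straight-line program computes depends
  measurably on its input, and the initial state is deterministic.\<close>

lemma iteration_quantity_measurable:
  assumes inp: "mat_entries (n, n) (iterate t) \<union> mat_entries (n, n) (\<lambda>\<omega>. cholesky n (iterate t \<omega>)) \<union>
      inverse_entries n R (iterate t) \<subseteq> borel_measurable (gaussian_draws n T)"
    and t: "t < T"
    and p: "p \<in> {\<lambda>(X, u). rayleigh n grad r X u} \<union>
        mat_entries (n, n) (\<lambda>(X, u). r1rsd_step n grad r b X u) \<union>
        mat_entries (n, n) (\<lambda>(X, u). cholesky n (r1rsd_step n grad r b X u)) \<union>
        inverse_entries n R (\<lambda>(X, u). r1rsd_step n grad r b X u)"
  shows "(\<lambda>\<omega>. p (iterate t \<omega>, vec n (\<omega> t))) \<in> borel_measurable (gaussian_draws n T)"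
proof -
  let ?M = "gaussian_draws n T"
  let ?h = "\<lambda>\<omega>. (iterate t \<omega>, vec n (\<omega> t))"
  let ?A = "mat_entries (n, n) fst \<union> mat_entries (n, n) (\<lambda>(X, u). cholesky n X) \<union>
        inverse_entries n R fst \<union> vec_entries n (snd :: real mat \<times> real vec \<Rightarrow> _)"
  obtain k where k: "flops_within (spd n \<times> carrier_vec n) ?A k
       ((\<Union>i\<le>r. vec_entries n (\<lambda>(X, u). power_iterate n grad X u i)) \<union>
        {\<lambda>(X, u). rayleigh n grad r X u} \<union>
        mat_entries (n, n) (\<lambda>(X, u). r1rsd_step n grad r b X u) \<union>
        mat_entries (n, n) (\<lambda>(X, u). cholesky n (r1rsd_step n grad r b X u)) \<union>
        inverse_entries n R (\<lambda>(X, u). r1rsd_step n grad r b X u))"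
    using iteration_flops_bound[OF G q, of r b] unfolding iteration_flops_def by blast
  show ?thesis
  proof (rule flops_within_measurable[where h = ?h, OF k])
    show "?h \<omega> \<in> spd n \<times> carrier_vec n" for \<omega> using iterate_spd by simp
    show "p \<in> ((\<Union>i\<le>r. vec_entries n (\<lambda>(X, u). power_iterate n grad X u i)) \<union>
        {\<lambda>(X, u). rayleigh n grad r X u} \<union>
        mat_entries (n, n) (\<lambda>(X, u). r1rsd_step n grad r b X u) \<union>
        mat_entries (n, n) (\<lambda>(X, u). cholesky n (r1rsd_step n grad r b X u)) \<union>
        inverse_entries n R (\<lambda>(X, u). r1rsd_step n grad r b X u))" using p by blast
    fix a assume "a \<in> ?A"
    then have "(\<lambda>\<omega>. a (?h \<omega>)) \<in> (\<lambda>a \<omega>. a (?h \<omega>)) ` ?A" by blast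
    also have "\<dots> = mat_entries (n, n) (iterate t) \<union> mat_entries (n, n) (\<lambda>\<omega>. cholesky n (iterate t \<omega>)) \<union>
      inverse_entries n R (iterate t) \<union> vec_entries n (\<lambda>\<omega>. vec n (\<omega> t))"
      by (simp add: image_Un vec_entries_comp mat_entries_comp inverse_entries_comp)
    also have "\<dots> \<subseteq> borel_measurable ?M"
      using inp draw_measurable[OF t] by (auto simp: vec_entries_def)
    finally show "(\<lambda>\<omega>. a (?h \<omega>)) \<in> borel_measurable ?M" .
  qed
qed

text \<open>The induction carries X, its Cholesky factor and the inverse outputs together, because
  all three are inputs of the next iteration's program. At time 0 they are constants.\<close>

lemma iterate_entries_measurable:
  assumes "t \<le> T"
  shows "mat_entries (n, n) (iterate t) \<union> mat_entries (n, n) (\<lambda>\<omega>. cholesky n (iterate t \<omega>)) \<union>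
      inverse_entries n R (iterate t) \<subseteq> borel_measurable (gaussian_draws n T)"
  using assms
proof (induction t)
  case 0
  then show ?case by (auto simp: mat_entries_def inverse_entries_def)
next
  case (Suc t)
  let ?h = "\<lambda>\<omega>. (iterate t \<omega>, vec n (\<omega> t))"
  let ?Q = "mat_entries (n, n) (\<lambda>(X, u). r1rsd_step n grad r (\<beta> t) X u) \<union>
        mat_entries (n, n) (\<lambda>(X, u). cholesky n (r1rsd_step n grad r (\<beta> t) X u)) \<union>
        inverse_entries n R (\<lambda>(X, u). r1rsd_step n grad r (\<beta> t) X u)"
  have "(\<lambda>p \<omega>. p (?h \<omega>)) ` ?Q \<subseteq> borel_measurable (gaussian_draws n T)"
    using iteration_quantity_measurable[of t T _ "\<beta> t"] Suc by auto
  then show ?case by (simp add: image_Un mat_entries_comp inverse_entries_comp)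
qed

lemma iterate_rayleigh_measurable:
  "t < T \<Longrightarrow> iterate_rayleigh t \<in> borel_measurable (gaussian_draws n T)"
  using iteration_quantity_measurable[OF iterate_entries_measurable, of t T "\<lambda>(X, u). rayleigh n grad r X u"]
  by simp

text \<open>P is not an output of the iteration program, but its products with vectors are
  computable; unit vectors have constant entries and yield its columns. The domain
  \<open>UNIV\<close> is admissible because every iterate is positive definite whatever the
  draws.\<close>

lemma sq_grad_norm_measurable:
  assumes "t < T"
  shows "sq_grad_norm t \<in> borel_measurable (gaussian_draws n T)"
proof -
  let ?M = "gaussian_draws n T"
  let ?P = "\<lambda>\<omega>. pmat n grad (iterate t \<omega>)"
  have P: "?P \<omega> \<in> carrier_mat n n" for \<omega>
    using pmat_symmetric[where grad=grad, OF iterate_spd G[OF iterate_spd]] by (simp add: symmetric_mats_def)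
  have [measurable]: "(\<lambda>\<omega>. ?P \<omega> $$ (i, j)) \<in> borel_measurable ?M" if ij: "i < n" "j < n" for i j
  proof -
    let ?e = "\<lambda>\<omega> :: nat \<Rightarrow> nat \<Rightarrow> real. unit_vec n j :: real vec"
    let ?A = "mat_entries (n, n) (iterate t) \<union> mat_entries (n, n) (\<lambda>\<omega>. cholesky n (iterate t \<omega>)) \<union>
      inverse_entries n R (iterate t) \<union> vec_entries n ?e"
    have "flops_within UNIV ?A (4 * n\<^sup>2 + q) (vec_entries n (\<lambda>\<omega>. ?P \<omega> *\<^sub>v ?e \<omega>))"
      by (rule flops_within_pmat_mult[OF G q iterate_spd]) auto
    then have "(\<lambda>\<omega>. (?P \<omega> *\<^sub>v ?e \<omega>) $ i) \<in> borel_measurable ?M"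
    proof (rule flops_within_measurable[where h = "\<lambda>x. x"])
      show "a \<in> borel_measurable ?M" if "a \<in> ?A" for a
        using that iterate_entries_measurable[of t T] assms by (auto simp: vec_entries_def)
    qed (auto intro: vec_entriesI ij(1))
    moreover have "(?P \<omega> *\<^sub>v ?e \<omega>) $ i = ?P \<omega> $$ (i, j)" for \<omega>
      using P[of \<omega>] ij by simp
    ultimately show ?thesis by simp
  qed
  have "sq_grad_norm t = (\<lambda>\<omega>. \<Sum>i<n. \<Sum>k<n. ?P \<omega> $$ (i, k) * ?P \<omega> $$ (k, i))"
    using rinner_rgrad[where grad=grad, OF iterate_spd G[OF iterate_spd]] mat_tr_mult[OF P P] by auto
  also have "\<dots> \<in> borel_measurable ?M"
    by (intro borel_measurable_sum borel_measurable_times) auto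
  finally show ?thesis .
qed

text \<open>Conditioning on all draws but the one at time t leaves the t-th iterate fixed.\<close>

lemma expected_sq_grad_norm_le:
  assumes gap: "spectral_gap n \<rho> grad" and n: "n \<ge> 2" and \<rho>: "\<rho> \<le> 1"
    and r: "\<rho> ^ (2 * r) * (128 * real n) \<le> 1" and t: "t < T"
  shows "(\<integral>\<^sup>+\<omega>. ennreal (sq_grad_norm t \<omega> / (18 * real n)) \<partial>gaussian_draws n T) \<le>
    (\<integral>\<^sup>+\<omega>. ennreal ((iterate_rayleigh t \<omega>)\<^sup>2) \<partial>gaussian_draws n T)"
proof -
  let ?I = "{..<T} - {t}"
  interpret product_sigma_finite "\<lambda>_. gaussian_vector n"
    by (rule product_sigma_finite.intro)
      (rule prob_space_imp_sigma_finite[OF prob_space_gaussian_vector])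
  have T: "gaussian_draws n T = Pi\<^sub>M (insert t ?I) (\<lambda>_. gaussian_vector n)"
    unfolding gaussian_draws_def using t by (simp add: insert_absorb)
  have past: "iterate t (x(t := u)) = iterate t x" for x u by (rule iterate_past) auto
  have "(\<integral>\<^sup>+\<omega>. ennreal (sq_grad_norm t \<omega> / (18 * real n)) \<partial>gaussian_draws n T) =
      (\<integral>\<^sup>+x. (\<integral>\<^sup>+u. ennreal (sq_grad_norm t (x(t := u)) / (18 * real n)) \<partial>gaussian_vector n)
        \<partial>Pi\<^sub>M ?I (\<lambda>_. gaussian_vector n))"
    unfolding T
    by (rule product_nn_integral_insert) (use sq_grad_norm_measurable[OF t, unfolded T] in auto)
  \<comment> \<open>The inner integrand does not involve u, and the law of u has total mass
    1.\<close>
  also have "\<dots> = (\<integral>\<^sup>+x. ennreal (sq_grad_norm t x / (18 * real n)) \<partial>Pi\<^sub>M ?I (\<lambda>_. gaussian_vector n))"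
    unfolding past by (simp add: prob_space.emeasure_space_1[OF prob_space_gaussian_vector])
  also have "\<dots> \<le> (\<integral>\<^sup>+x. (\<integral>\<^sup>+u. ennreal ((iterate_rayleigh t (x(t := u)))\<^sup>2) \<partial>gaussian_vector n)
        \<partial>Pi\<^sub>M ?I (\<lambda>_. gaussian_vector n))"
    unfolding past fun_upd_same
    by (intro nn_integral_mono expected_rayleigh_lower_bound[where grad=grad, OF iterate_spd G[OF iterate_spd] gap n \<rho> r])
  also have "\<dots> = (\<integral>\<^sup>+\<omega>. ennreal ((iterate_rayleigh t \<omega>)\<^sup>2) \<partial>gaussian_draws n T)"
    unfolding T
    by (rule product_nn_integral_insert[symmetric]) (use iterate_rayleigh_measurable[OF t, unfolded T] in auto)
  finally show ?thesis .
qed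

section \<open>Summed descent and the expected best gradient norm\<close>

lemma sum_iterate_rayleigh_le:
  assumes L: "L > 0" and smooth: "geodesically_smooth n L f grad" and \<beta>: "\<And>t. \<beta> t = 1 / L"
    and f: "\<And>X. X \<in> spd n \<Longrightarrow> f X \<ge> 0"
  shows "(\<Sum>t<T. (iterate_rayleigh t \<omega>)\<^sup>2) \<le> 2 * L * f X0"
proof -
  have "f (iterate T \<omega>) \<le> f X0 - (\<Sum>t<T. (iterate_rayleigh t \<omega>)\<^sup>2) / (2 * L)"
  proof (induction T)
    case (Suc T)
    have "f (iterate (Suc T) \<omega>) \<le> f (iterate T \<omega>) - (iterate_rayleigh T \<omega>)\<^sup>2 / (2 * L)"
      using r1rsd_step_descent[where grad=grad, OF iterate_spd G[OF iterate_spd] _ L smooth] \<beta> by simp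
    then show ?case using Suc by (simp add: add_divide_distrib)
  qed simp
  then have "(\<Sum>t<T. (iterate_rayleigh t \<omega>)\<^sup>2) / (2 * L) \<le> f X0" using f[OF iterate_spd, of \<omega> T] by linarith
  then show ?thesis using L by (simp add: field_simps)
qed

lemma best_gradient_norm_le:
  "t < T \<Longrightarrow> best_gradient_norm n grad r \<beta> X0 T \<omega> \<le> sqrt (sq_grad_norm t \<omega>)"
  unfolding best_gradient_norm_def rnorm_def Let_def by (rule Min_le) auto

lemma best_gradient_norm_nonneg:
  assumes "T \<ge> 1"
  shows "best_gradient_norm n grad r \<beta> X0 T \<omega> \<ge> 0"
proof -
  have "0 \<in> {..<T}" using assms by auto
  then show ?thesis unfolding best_gradient_norm_def rnorm_def Let_def
    by (subst Min_ge_iff) (auto simp: sq_grad_norm_nonneg)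
qed

lemma best_gradient_norm_measurable:
  "best_gradient_norm n grad r \<beta> X0 T \<in> borel_measurable (gaussian_draws n T)"
  unfolding best_gradient_norm_def rnorm_def Let_def
  using sq_grad_norm_measurable by (intro borel_measurable_Min) auto

text \<open>The minimum is at most its entry at time 0, which is the gradient norm at the
  deterministic point \<open>X0\<close>; this gives a constant bound.\<close>

lemma best_gradient_norm_power_integrable:
  assumes "T \<ge> 1"
  shows "integrable (gaussian_draws n T) (\<lambda>\<omega>. best_gradient_norm n grad r \<beta> X0 T \<omega> ^ k)"
proof -
  interpret prob_space "gaussian_draws n T" by (rule prob_space_gaussian_draws)
  show ?thesis
  proof (rule integrable_const_bound[where B = "(sqrt (rinner X0 (rgrad grad X0) (rgrad grad X0))) ^ k"])
    show "AE \<omega> in gaussian_draws n T. norm (best_gradient_norm n grad r \<beta> X0 T \<omega> ^ k) \<le>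
        (sqrt (rinner X0 (rgrad grad X0) (rgrad grad X0))) ^ k"
      using best_gradient_norm_nonneg[OF assms] best_gradient_norm_le[of 0 T] assms
      by (intro always_eventually allI) (auto simp: power_abs intro!: power_mono)
  qed (use best_gradient_norm_measurable in measurable)
qed

text \<open>The pathwise bound on the summed squared Rayleigh quotients is integrated and compared
  with the gradient norms at each time. Sums and integrals are exchanged in the extended nonnegative
  reals, where measurability suffices.\<close>

theorem expected_best_gradient_norm_le:
  assumes gap: "spectral_gap n \<rho> grad" and n: "n \<ge> 2" and \<rho>: "\<rho> \<le> 1"
    and r: "\<rho> ^ (2 * r) * (128 * real n) \<le> 1"
    and L: "L > 0" and smooth: "geodesically_smooth n L f grad" and \<beta>: "\<And>t. \<beta> t = 1 / L"
    and f: "\<And>X. X \<in> spd n \<Longrightarrow> f X \<ge> 0"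
    and \<epsilon>: "\<epsilon> > 0" and T: "T \<ge> 1" "real T \<ge> 36 * f X0 * (real n * L / \<epsilon>\<^sup>2)"
  shows "integral\<^sup>L (gaussian_draws n T) (best_gradient_norm n grad r \<beta> X0 T) \<le> \<epsilon>"
proof -
  let ?M = "gaussian_draws n T"
  let ?m = "best_gradient_norm n grad r \<beta> X0 T"
  interpret prob_space ?M by (rule prob_space_gaussian_draws)
  have int: "integrable ?M ?m" "integrable ?M (\<lambda>\<omega>. (?m \<omega>)\<^sup>2)"
    using best_gradient_norm_power_integrable[OF T(1), of 1] best_gradient_norm_power_integrable[OF T(1), of 2]
    by simp_all
  have msq: "(?m \<omega>)\<^sup>2 \<le> sq_grad_norm t \<omega>" if "t < T" for t \<omega>
    using power_mono[OF best_gradient_norm_le[OF that, of \<omega>] best_gradient_norm_nonneg[OF T(1)], of 2]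
      sq_grad_norm_nonneg[of \<omega> t] by simp
  \<comment> \<open>The minimum is written T times, so that each copy can be compared with a
    different iteration.\<close>
  have "ennreal (real T * expectation (\<lambda>\<omega>. (?m \<omega>)\<^sup>2 / (18 * real n))) =
      (\<Sum>t<T. \<integral>\<^sup>+\<omega>. ennreal ((?m \<omega>)\<^sup>2 / (18 * real n)) \<partial>?M)"
    using int(2) by (subst nn_integral_eq_integral)
      (auto simp: ennreal_of_nat_eq_real_of_nat simp flip: ennreal_mult')
  also have "\<dots> \<le> (\<Sum>t<T. \<integral>\<^sup>+\<omega>. ennreal (sq_grad_norm t \<omega> / (18 * real n)) \<partial>?M)"
    using msq by (intro sum_mono nn_integral_mono ennreal_leI divide_right_mono) auto
  also have "\<dots> \<le> (\<Sum>t<T. \<integral>\<^sup>+\<omega>. ennreal ((iterate_rayleigh t \<omega>)\<^sup>2) \<partial>?M)"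
    by (intro sum_mono expected_sq_grad_norm_le[OF gap n \<rho> r]) auto
  also have "\<dots> = (\<integral>\<^sup>+\<omega>. (\<Sum>t<T. ennreal ((iterate_rayleigh t \<omega>)\<^sup>2)) \<partial>?M)"
    using iterate_rayleigh_measurable by (intro nn_integral_sum[symmetric]) auto
  also have "\<dots> \<le> (\<integral>\<^sup>+\<omega>. ennreal (2 * L * f X0) \<partial>?M)"
    using sum_iterate_rayleigh_le[OF L smooth \<beta> f]
    by (intro nn_integral_mono) (simp add: sum_ennreal ennreal_leI)
  also have "\<dots> = ennreal (2 * L * f X0)" by (simp add: emeasure_space_1)
  finally have "real T * expectation (\<lambda>\<omega>. (?m \<omega>)\<^sup>2 / (18 * real n)) \<le> 2 * L * f X0"
    using L f[OF X0] by (subst (asm) ennreal_le_iff) auto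
  then have "real T * expectation (\<lambda>\<omega>. (?m \<omega>)\<^sup>2) \<le> 36 * f X0 * (real n * L)"
    using n by (simp add: field_simps)
  also have "\<dots> \<le> real T * \<epsilon>\<^sup>2" using T(2) \<epsilon> by (simp add: field_simps)
  finally have "expectation (\<lambda>\<omega>. (?m \<omega>)\<^sup>2) \<le> \<epsilon>\<^sup>2" using T(1) by simp
  moreover have "(expectation ?m)\<^sup>2 \<le> expectation (\<lambda>\<omega>. (?m \<omega>)\<^sup>2)"
    using variance_eq[OF int] variance_positive[of ?m] by simp
  ultimately have "(expectation ?m)\<^sup>2 \<le> \<epsilon>\<^sup>2" by linarith
  then show ?thesis by (rule power2_le_imp_le[OF _ less_imp_le[OF \<epsilon>]])
qed

end

section \<open>Choice of the number of power iterations and asymptotic cost\<close>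

lemma spectral_gap_mono:
  assumes "spectral_gap n \<rho> grad" "\<rho> \<le> \<rho>'"
  shows "spectral_gap n \<rho>' grad"
  unfolding spectral_gap_def
proof
  fix X assume "X \<in> spd n"
  then obtain es where "length es = n" "char_poly (pmat n grad X) = (\<Prod>e\<leftarrow>es. [:- e, 1:])"
    "sorted_wrt (\<lambda>a b. \<bar>a\<bar> \<ge> \<bar>b\<bar>) es" "\<bar>es ! 0\<bar> > \<bar>es ! 1\<bar>" "\<bar>es ! 1\<bar> / \<bar>es ! 0\<bar> \<le> \<rho>"
    using assms(1) unfolding spectral_gap_def by blast
  then show "\<exists>es. length es = n \<and> char_poly (pmat n grad X) = (\<Prod>e\<leftarrow>es. [:- e, 1:]) \<and>
      sorted_wrt (\<lambda>a b. \<bar>a\<bar> \<ge> \<bar>b\<bar>) es \<and> \<bar>es ! 0\<bar> > \<bar>es ! 1\<bar> \<and> \<bar>es ! 1\<bar> / \<bar>es ! 0\<bar> \<le> \<rho>'"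
    using assms(2) by (intro exI[of _ es]) simp
qed

text \<open>Taking logarithms turns the claim into 2 r ln (1 / \<rho>) \<ge> ln (128 n), which the
  ceiling solves.\<close>

lemma power_iteration_count:
  assumes "0 < \<rho>" "\<rho> < 1" "n \<ge> 1"
  shows "\<rho> ^ (2 * nat \<lceil>ln (128 * real n) / (2 * ln (1 / \<rho>))\<rceil>) * (128 * real n) \<le> 1"
proof -
  define r where "r = nat \<lceil>ln (128 * real n) / (2 * ln (1 / \<rho>))\<rceil>"
  have l: "ln (1 / \<rho>) > 0" using assms by simp
  have "ln (128 * real n) / (2 * ln (1 / \<rho>)) \<le> real r" unfolding r_def by (rule real_nat_ceiling_ge)
  then have "ln (128 * real n) \<le> real (2 * r) * ln (1 / \<rho>)" using l by (simp add: field_simps)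
  also have "\<dots> = - ln (\<rho> ^ (2 * r))" using assms by (simp add: ln_realpow ln_div)
  finally have "ln (\<rho> ^ (2 * r) * (128 * real n)) \<le> 0"
    using assms by (subst ln_mult) auto
  then show ?thesis unfolding r_def[symmetric] using assms by (simp add: ln_le_zero_iff)
qed

lemma total_flops_bigo:
  assumes q: "(\<lambda>n. real (q n)) \<in> O(\<lambda>n. real n ^ 2)" and c: "c > 0"
  defines "r \<equiv> \<lambda>n. nat \<lceil>ln (128 * real n) / c\<rceil>"
  shows "(\<lambda>n. real (n + (r n + 6) * (4 * n\<^sup>2 + q n + 3 * n + 2))) \<in> O(\<lambda>n. real n ^ 2 * ln (real n))"
proof -
  \<comment> \<open>Rounding up costs at most 1, which turns 6 into 7. For n \<ge> 1 the quotient is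
    nonnegative, so truncation by \<open>nat\<close> has no effect.\<close>
  have "(\<lambda>n. real (r n) + 6) \<in> O(\<lambda>n. ln (128 * real n) / c + 7)"
  proof (rule bigoI[of _ 1])
    show "\<forall>\<^sub>F n in sequentially. norm (real (r n) + 6) \<le> 1 * norm (ln (128 * real n) / c + 7)"
      using eventually_ge_at_top[of 1]
    proof eventually_elim
      case (elim n)
      then have "ln (128 * real n) / c \<ge> 0" using c by simp
      then show ?case unfolding r_def by (simp; linarith)
    qed
  qed
  also have "(\<lambda>n. ln (128 * real n) / c + 7) \<in> O(\<lambda>n. ln (real n))" using c by real_asymp
  finally have r: "(\<lambda>n. real (r n) + 6) \<in> O(\<lambda>n. ln (real n))" .
  have "(\<lambda>n. 4 * real n ^ 2 + real (q n) + (3 * real n + 2)) \<in> O(\<lambda>n. real n ^ 2)"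
    by (intro sum_in_bigo q) real_asymp+
  from landau_o.big.mult[OF r this]
  have "(\<lambda>n. (real (r n) + 6) * (4 * real n ^ 2 + real (q n) + (3 * real n + 2))) \<in> O(\<lambda>n. real n ^ 2 * ln (real n))"
    by (simp add: mult.commute)
  moreover have "(\<lambda>n. real n) \<in> O(\<lambda>n. real n ^ 2 * ln (real n))" by real_asymp
  ultimately have "(\<lambda>n. real n + (real (r n) + 6) * (4 * real n ^ 2 + real (q n) + (3 * real n + 2))) \<in>
      O(\<lambda>n. real n ^ 2 * ln (real n))" by (rule sum_in_bigo(1)[rotated])
  moreover have "real (n + (r n + 6) * (4 * n\<^sup>2 + q n + 3 * n + 2)) =
      real n + (real (r n) + 6) * (4 * real n ^ 2 + real (q n) + (3 * real n + 2))" for n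
    by (simp add: algebra_simps)
  ultimately show ?thesis by simp
qed

text \<open>The quantifier order expresses the uniformity of the O-bounds: \<open>C\<close> is
  absolute, the step sizes depend on L alone, and \<open>r\<close> and \<open>flops\<close> on
  \<rho> and \<open>q\<close> alone. The initialization enters only through the factor
  \<open>f X0\<close>.\<close>

theorem theorem1:
  "\<exists>C>0. \<exists>\<beta> :: real \<Rightarrow> nat \<Rightarrow> real. (\<forall>L>0. \<forall>t. \<beta> L t > 0) \<and>
     (\<forall>\<rho> <1. \<forall>q :: nat \<Rightarrow> nat. (\<lambda>n. real (q n)) \<in> O(\<lambda>n. real n ^ 2) \<longrightarrow>
       (\<exists>(r :: nat \<Rightarrow> nat) (flops :: nat \<Rightarrow> nat).
          (\<lambda>n. real (flops n)) \<in> O(\<lambda>n. real n ^ 2 * ln (real n)) \<and>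
          (\<forall>n\<ge>2. \<forall>R f grad L X0.
             residual_objective n R f \<longrightarrow>
             (\<forall>X \<in> spd n. has_euclidean_gradient n f (grad X) X) \<longrightarrow>
             gradient_product_flops n R grad (q n) \<longrightarrow>
             L > 0 \<longrightarrow> geodesically_smooth n L f grad \<longrightarrow>
             spectral_gap n \<rho> grad \<longrightarrow>
             X0 \<in> spd n \<longrightarrow>
             (\<forall>\<epsilon>>0. \<forall>T\<ge>1. real T \<ge> C * f X0 * (real n * L / \<epsilon>\<^sup>2) \<longrightarrow>
                integrable (gaussian_draws n T)
                  (best_gradient_norm n grad (r n) (\<beta> L) X0 T) \<and>
                integral\<^sup>L (gaussian_draws n T)
                  (best_gradient_norm n grad (r n) (\<beta> L) X0 T) \<le> \<epsilon>) \<and>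
             (\<forall>t. iteration_flops n R grad (r n) (\<beta> L t) (flops n)))))"
proof (intro exI[of _ "36 :: real"] exI[of _ "\<lambda>(L :: real) (t :: nat). 1 / L"] conjI allI impI)
  fix \<rho> :: real and q :: "nat \<Rightarrow> nat"
  assume \<rho>1: "\<rho> < 1" and qO: "(\<lambda>n. real (q n)) \<in> O(\<lambda>n. real n ^ 2)"
  \<comment> \<open>A positive bound on the ratio, so that its logarithm is meaningful.\<close>
  define \<rho>' where "\<rho>' = max \<rho> (1 / 2)"
  have \<rho>': "0 < \<rho>'" "\<rho>' < 1" "\<rho> \<le> \<rho>'" using \<rho>1 by (auto simp: \<rho>'_def)
  define r where "r = (\<lambda>n :: nat. nat \<lceil>ln (128 * real n) / (2 * ln (1 / \<rho>'))\<rceil>)"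
  define flops where "flops = (\<lambda>n. n + (r n + 6) * (4 * n\<^sup>2 + q n + 3 * n + 2))"
  show "\<exists>(r :: nat \<Rightarrow> nat) (flops :: nat \<Rightarrow> nat).
          (\<lambda>n. real (flops n)) \<in> O(\<lambda>n. real n ^ 2 * ln (real n)) \<and>
          (\<forall>n\<ge>2. \<forall>R f grad L X0.
             residual_objective n R f \<longrightarrow>
             (\<forall>X \<in> spd n. has_euclidean_gradient n f (grad X) X) \<longrightarrow>
             gradient_product_flops n R grad (q n) \<longrightarrow>
             L > 0 \<longrightarrow> geodesically_smooth n L f grad \<longrightarrow>
             spectral_gap n \<rho> grad \<longrightarrow>
             X0 \<in> spd n \<longrightarrow>
             (\<forall>\<epsilon>>0. \<forall>T\<ge>1. real T \<ge> 36 * f X0 * (real n * L / \<epsilon>\<^sup>2) \<longrightarrow>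
                integrable (gaussian_draws n T)
                  (best_gradient_norm n grad (r n) (\<lambda>t. 1 / L) X0 T) \<and>
                integral\<^sup>L (gaussian_draws n T)
                  (best_gradient_norm n grad (r n) (\<lambda>t. 1 / L) X0 T) \<le> \<epsilon>) \<and>
             (\<forall>t. iteration_flops n R grad (r n) (1 / L) (flops n)))"
  proof (rule exI[of _ r], rule exI[of _ flops], intro conjI allI impI)
    show "(\<lambda>n. real (flops n)) \<in> O(\<lambda>n. real n ^ 2 * ln (real n))"
      unfolding flops_def r_def using total_flops_bigo[OF qO, of "2 * ln (1 / \<rho>')"] \<rho>' by simp
    fix n R f grad L X0
    assume n: "2 \<le> (n :: nat)" and res: "residual_objective n R f"
      and D: "\<forall>X \<in> spd n. has_euclidean_gradient n f (grad X) X"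
      and q: "gradient_product_flops n R grad (q n)"
      and L: "(L :: real) > 0" and smooth: "geodesically_smooth n L f grad"
      and gap: "spectral_gap n \<rho> grad" and X0: "X0 \<in> spd n"
    have G: "\<And>X. X \<in> spd n \<Longrightarrow> grad X \<in> symmetric_mats n"
      using D has_euclidean_gradient_symmetric by blast
    have f: "\<And>X. X \<in> spd n \<Longrightarrow> f X \<ge> 0" using res by (simp add: residual_objective_def)
    show "iteration_flops n R grad (r n) (1 / L) (flops n)"
      unfolding flops_def by (rule iteration_flops_bound[OF G q])
    fix \<epsilon> :: real and T :: nat
    assume \<epsilon>: "\<epsilon> > 0" and T: "1 \<le> T" "real T \<ge> 36 * f X0 * (real n * L / \<epsilon>\<^sup>2)"
    show "integrable (gaussian_draws n T) (best_gradient_norm n grad (r n) (\<lambda>t. 1 / L) X0 T)"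
      using best_gradient_norm_power_integrable[OF G X0 q T(1), of "r n" "\<lambda>t. 1 / L" 1] by simp
    show "integral\<^sup>L (gaussian_draws n T) (best_gradient_norm n grad (r n) (\<lambda>t. 1 / L) X0 T) \<le> \<epsilon>"
      using power_iteration_count[OF \<rho>'(1,2), of n] n \<rho>'(2)
      by (intro expected_best_gradient_norm_le[OF G X0 q spectral_gap_mono[OF gap \<rho>'(3)] n _ _ L smooth _ f \<epsilon> T])
        (auto simp: r_def)
  qed
qed auto

end
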